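(* Let $\mathbf{i}=\sqrt{-1}$ and let $\bar U_{\mathbf{i}}=\bar U_{\mathbf{i}}(\mathfrak{sl}_2)$ be the Hopf algebra over $\mathbb{C}$ generated by $E,F,K$ with relations $$KE=-EK,\quad KF=-FK,\quad EF-FE=-\tfrac{\mathbf{i}}{2}(K-K^3),\quad E^2=F^2=0,\quad K^4=1,$$ and coproduct $\Delta(E)=1\otimes E+E\otimes K$, $\Delta(F)=F\otimes1+K^{-1}\otimes F$, $\Delta(K)=K\otimes K$. Put $\boldsymbol{e}=\frac{1-K^2}{2}$. Then a basis of $H^3_{\mathrm{DY}}(\bar U_{\mathbf{i}}\text{-}\mathrm{mod})$ is given by the classes of the cocycles \begin{align*} c_1&=\boldsymbol{e}\otimes EK^2\otimes EK^3-E\otimes K\boldsymbol{e}\otimes EK^3-E\otimes EK\otimes\boldsymbol{e},\\ c_2&=\boldsymbol{e}\otimes FK^3\otimes F-FK\otimes K\boldsymbol{e}\otimes F-FK\otimes FK^2\otimes\boldsymbol{e},\\ c_3&=\boldsymbol{e}\otimes EK^2\otimes FK^2-\boldsymbol{e}\otimes FK^3\otimes EK^3+EK^2\otimes K\boldsymbol{e}\otimes FK^2\\ &\quad+FK\otimes K\boldsymbol{e}\otimes EK^3-EK^2\otimes FK^2\otimes\boldsymbol{e}+FK\otimes EK\otimes\boldsymbol{e}. \end{align*}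
   Context: The counit of $\bar U_{\mathbf{i}}$ is $\varepsilon(E)=\varepsilon(F)=0$, $\varepsilon(K)=1$, and the antipode is $S(E)=-EK^{-1}$, $S(F)=-KF$, $S(K)=K^{-1}$. For a finite-dimensional Hopf algebra $H$, $H^\bullet_{\mathrm{DY}}(H\text{-}\mathrm{mod})$ denotes the Davydov--Yetter cohomology of the identity functor of the category of finite-dimensional $H$-modules, with trivial coefficients: the $n$-cochains are the natural endomorphisms of the functor $(X_1,\dots,X_n)\mapsto X_1\otimes\cdots\otimes X_n$. By evaluating on $1\otimes\cdots\otimes1\in H^{\otimes n}$, this complex is identified with $$0\to\mathbb{C}\xrightarrow{\delta^0}\mathcal{Z}(H)\xrightarrow{\delta^1}\mathcal{Z}(\Delta(H))\xrightarrow{\delta^2}\mathcal{Z}(\Delta^{(2)}(H))\xrightarrow{\delta^3}\cdots$$ where $\Delta^{(n-1)}:H\to H^{\otimes n}$ is the iterated coproduct, $\mathcal{Z}(\Delta^{(n-1)}(H))\subset H^{\otimes n}$ is the centralizer of its image, and $$\delta^n(\mathbf{x})=1\otimes\mathbf{x}+\sum_{i=1}^n(-1)^i(\mathrm{id}^{\otimes(i-1)}\otimes\Delta\otimes\mathrm{id}^{\otimes(n-i)})(\mathbf{x})+(-1)^{n+1}\mathbf{x}\otimes1.$$ The elements $c_1,c_2,c_3$ are viewed in $\mathcal{Z}(\Delta^{(2)}(\bar U_{\mathbf{i}}))\subset\bar U_{\mathbf{i}}^{\otimes3}$. *)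

theory Defs
  imports Complex_Main "Jordan_Normal_Form.VS_Connect"
begin

section \<open>Complex vector spaces and algebras\<close>

class complex_vector = ab_group_add +
  fixes scaleC :: "complex \<Rightarrow> 'a \<Rightarrow> 'a" (infixr "*\<^sub>C" 75)
  assumes scaleC_add_right: "a *\<^sub>C (x + y) = a *\<^sub>C x + a *\<^sub>C y"
    and scaleC_add_left: "(a + b) *\<^sub>C x = a *\<^sub>C x + b *\<^sub>C x"
    and scaleC_scaleC: "a *\<^sub>C b *\<^sub>C x = (a * b) *\<^sub>C x"
    and scaleC_one: "1 *\<^sub>C x = x"

global_interpretation complex_vector:
  vector_space "scaleC :: complex \<Rightarrow> 'a \<Rightarrow> 'a :: complex_vector"
  by unfold_locales (simp_all add: scaleC_add_right scaleC_add_left scaleC_scaleC scaleC_one)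

class complex_algebra_1 = complex_vector + ring_1 +
  assumes mult_scaleC_left: "(a *\<^sub>C x) * y = a *\<^sub>C (x * y)"
    and mult_scaleC_right: "x * (a *\<^sub>C y) = a *\<^sub>C (x * y)"


section \<open>Algebras given by generators and relations\<close>

text \<open>The unital associative \<open>\<complex>\<close>-algebra presented by generators \<open>'g\<close> and relations \<open>R\<close> is the
  set of algebra terms modulo the least congruence containing the algebra axioms and \<open>R\<close>.\<close>

datatype 'g alg_term =
    Gen 'g
  | Scal complex
  | Add "'g alg_term" "'g alg_term"
  | Mul "'g alg_term" "'g alg_term"

inductive alg_cong :: "('g alg_term \<Rightarrow> 'g alg_term \<Rightarrow> bool) \<Rightarrow> 'g alg_term \<Rightarrow> 'g alg_term \<Rightarrow> bool"
  for R where
  ac_rel: "R s t \<Longrightarrow> alg_cong R s t"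
| ac_refl: "alg_cong R s s"
| ac_sym: "alg_cong R s t \<Longrightarrow> alg_cong R t s"
| ac_trans: "alg_cong R s t \<Longrightarrow> alg_cong R t u \<Longrightarrow> alg_cong R s u"
| ac_Add: "alg_cong R s s' \<Longrightarrow> alg_cong R t t' \<Longrightarrow> alg_cong R (Add s t) (Add s' t')"
| ac_Mul: "alg_cong R s s' \<Longrightarrow> alg_cong R t t' \<Longrightarrow> alg_cong R (Mul s t) (Mul s' t')"
| ac_Add_assoc: "alg_cong R (Add (Add s t) u) (Add s (Add t u))"
| ac_Add_commute: "alg_cong R (Add s t) (Add t s)"
| ac_Add_zero: "alg_cong R (Add (Scal 0) s) s"
| ac_Add_minus: "alg_cong R (Add (Mul (Scal (-1)) s) s) (Scal 0)"
| ac_Mul_assoc: "alg_cong R (Mul (Mul s t) u) (Mul s (Mul t u))"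
| ac_Mul_one: "alg_cong R (Mul (Scal 1) s) s"
| ac_distrib_right: "alg_cong R (Mul (Add s t) u) (Add (Mul s u) (Mul t u))"
| ac_distrib_left: "alg_cong R (Mul s (Add t u)) (Add (Mul s t) (Mul s u))"
| ac_Scal_add: "alg_cong R (Add (Scal a) (Scal b)) (Scal (a + b))"
| ac_Scal_mult: "alg_cong R (Mul (Scal a) (Scal b)) (Scal (a * b))"
| ac_Scal_central: "alg_cong R (Mul s (Scal a)) (Mul (Scal a) s)"

lemma equivp_alg_cong: "equivp (alg_cong R)"
  by (intro equivpI reflpI sympI transpI) (blast intro: alg_cong.intros)+

primrec alg_eval :: "(complex \<Rightarrow> 'b) \<Rightarrow> ('g \<Rightarrow> 'b) \<Rightarrow> 'g alg_term \<Rightarrow> 'b :: ring" where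
  "alg_eval \<kappa> g (Gen x) = g x"
| "alg_eval \<kappa> g (Scal c) = \<kappa> c"
| "alg_eval \<kappa> g (Add s t) = alg_eval \<kappa> g s + alg_eval \<kappa> g t"
| "alg_eval \<kappa> g (Mul s t) = alg_eval \<kappa> g s * alg_eval \<kappa> g t"

text \<open>The subring \<open>A\<close> of the (non-unital) ring \<open>'b\<close> is a unital \<open>\<complex>\<close>-algebra via
  \<open>\<kappa> : \<complex> \<rightarrow> A\<close>; images of the generators satisfying the relations extend to the presented algebra.\<close>

lemma alg_eval_cong:
  fixes \<kappa> :: "complex \<Rightarrow> 'b :: ring"
  assumes "alg_cong R s t"
    and \<kappa>: "\<And>c. \<kappa> c \<in> A" and g: "\<And>x. g x \<in> A"
    and add: "\<And>x y. x \<in> A \<Longrightarrow> y \<in> A \<Longrightarrow> x + y \<in> A"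
    and mult: "\<And>x y. x \<in> A \<Longrightarrow> y \<in> A \<Longrightarrow> x * y \<in> A"
    and \<kappa>_add: "\<And>a b. \<kappa> (a + b) = \<kappa> a + \<kappa> b" and \<kappa>_mult: "\<And>a b. \<kappa> (a * b) = \<kappa> a * \<kappa> b"
    and unit: "\<And>x. x \<in> A \<Longrightarrow> \<kappa> 1 * x = x"
    and central: "\<And>c x. x \<in> A \<Longrightarrow> x * \<kappa> c = \<kappa> c * x"
    and R: "\<And>s t. R s t \<Longrightarrow> alg_eval \<kappa> g s = alg_eval \<kappa> g t"
  shows "alg_eval \<kappa> g s = alg_eval \<kappa> g t"
proof -
  have A: "alg_eval \<kappa> g u \<in> A" for u
    by (induction u) (auto intro: \<kappa> g add mult)
  have \<kappa>0: "\<kappa> 0 = 0" using \<kappa>_add[of 0 0] by simp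
  have neg: "\<kappa> (-1) * x = - x" if "x \<in> A" for x
  proof -
    have "\<kappa> (-1) * x + \<kappa> 1 * x = 0"
      using \<kappa>_add[of "-1" 1] \<kappa>0 distrib_right[of "\<kappa> (-1)" "\<kappa> 1" x] by simp
    then show ?thesis using unit[OF that] by (simp add: eq_neg_iff_add_eq_0)
  qed
  from assms(1) show ?thesis
    by induction
      (simp_all add: R distrib_left distrib_right add.assoc add.commute mult.assoc unit central A
        neg \<kappa>0 flip: \<kappa>_add \<kappa>_mult)
qed


section \<open>Tensor powers\<close>

text \<open>\<open>'a tens\<close> is the direct sum over all \<open>n\<close> of the tensor powers \<open>'a\<^sup>\<otimes>\<^sup>n\<close> over \<open>\<complex>\<close>: formal
  linear combinations of lists modulo multilinearity.  A list of length \<open>n\<close> stands for a pure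
  tensor in \<open>'a\<^sup>\<otimes>\<^sup>n\<close>, and the empty list for \<open>1 \<in> \<complex> = 'a\<^sup>\<otimes>\<^sup>0\<close>.\<close>

datatype 'a tens_term =
    TPure "'a list"
  | TZero
  | TAdd "'a tens_term" "'a tens_term"
  | TScale complex "'a tens_term"

inductive tens_cong :: "'a :: complex_vector tens_term \<Rightarrow> 'a tens_term \<Rightarrow> bool" where
  tc_refl: "tens_cong s s"
| tc_sym: "tens_cong s t \<Longrightarrow> tens_cong t s"
| tc_trans: "tens_cong s t \<Longrightarrow> tens_cong t u \<Longrightarrow> tens_cong s u"
| tc_TAdd: "tens_cong s s' \<Longrightarrow> tens_cong t t' \<Longrightarrow> tens_cong (TAdd s t) (TAdd s' t')"
| tc_TScale: "tens_cong s s' \<Longrightarrow> tens_cong (TScale c s) (TScale c s')"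
| tc_TAdd_assoc: "tens_cong (TAdd (TAdd s t) u) (TAdd s (TAdd t u))"
| tc_TAdd_commute: "tens_cong (TAdd s t) (TAdd t s)"
| tc_TAdd_zero: "tens_cong (TAdd TZero s) s"
| tc_TAdd_minus: "tens_cong (TAdd (TScale (-1) s) s) TZero"
| tc_TScale_add_right: "tens_cong (TScale a (TAdd s t)) (TAdd (TScale a s) (TScale a t))"
| tc_TScale_add_left: "tens_cong (TScale (a + b) s) (TAdd (TScale a s) (TScale b s))"
| tc_TScale_TScale: "tens_cong (TScale a (TScale b s)) (TScale (a * b) s)"
| tc_TScale_one: "tens_cong (TScale 1 s) s"
| tc_slot_add: "tens_cong (TPure (xs @ (x + y) # ys)) (TAdd (TPure (xs @ x # ys)) (TPure (xs @ y # ys)))"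
| tc_slot_scale: "tens_cong (TPure (xs @ (c *\<^sub>C x) # ys)) (TScale c (TPure (xs @ x # ys)))"

quotient_type (overloaded) 'a tens = "'a :: complex_vector tens_term" / tens_cong
  by (intro equivpI reflpI sympI transpI) (blast intro: tens_cong.intros)+

instantiation tens :: (complex_vector) complex_vector
begin

lift_definition zero_tens :: "'a tens" is TZero .
lift_definition plus_tens :: "'a tens \<Rightarrow> 'a tens \<Rightarrow> 'a tens" is TAdd by (rule tc_TAdd)
lift_definition scaleC_tens :: "complex \<Rightarrow> 'a tens \<Rightarrow> 'a tens" is TScale by (rule tc_TScale)
lift_definition uminus_tens :: "'a tens \<Rightarrow> 'a tens" is "TScale (-1)" by (rule tc_TScale)
definition minus_tens :: "'a tens \<Rightarrow> 'a tens \<Rightarrow> 'a tens" where "minus_tens x y = x + - y"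

instance
proof
  fix x y z :: "'a tens" and a b :: complex
  show "x + y + z = x + (y + z)" by transfer (rule tc_TAdd_assoc)
  show "x + y = y + x" by transfer (rule tc_TAdd_commute)
  show "0 + x = x" by transfer (rule tc_TAdd_zero)
  show "- x + x = 0" by transfer (rule tc_TAdd_minus)
  show "x - y = x + - y" by (rule minus_tens_def)
  show "a *\<^sub>C (x + y) = a *\<^sub>C x + a *\<^sub>C y" by transfer (rule tc_TScale_add_right)
  show "(a + b) *\<^sub>C x = a *\<^sub>C x + b *\<^sub>C x" by transfer (rule tc_TScale_add_left)
  show "a *\<^sub>C b *\<^sub>C x = (a * b) *\<^sub>C x" by transfer (rule tc_TScale_TScale)
  show "1 *\<^sub>C x = x" by transfer (rule tc_TScale_one)
qed

end

lift_definition pure :: "'a :: complex_vector list \<Rightarrow> 'a tens" is TPure .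

lemma pure_add: "pure (xs @ (x + y) # ys) = pure (xs @ x # ys) + pure (xs @ y # ys)"
  by transfer (rule tc_slot_add)

lemma pure_scale: "pure (xs @ (c *\<^sub>C x) # ys) = c *\<^sub>C pure (xs @ x # ys)"
  by transfer (rule tc_slot_scale)

lemma tens_induct [case_names pure zero add scale, induct type: tens]:
  assumes "\<And>xs. P (pure xs)" "P 0" "\<And>x y. P x \<Longrightarrow> P y \<Longrightarrow> P (x + y)" "\<And>c x. P x \<Longrightarrow> P (c *\<^sub>C x)"
  shows "P x"
proof (induction x rule: tens.abs_induct)
  fix t :: "'a tens_term"
  show "P (abs_tens t)"
  proof (induction t)
    case (TPure xs)
    then show ?case using assms(1)[of xs] by (simp only: pure.abs_eq)
  next
    case TZero
    then show ?case using assms(2) by (simp only: zero_tens_def)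
  next
    case (TAdd s t)
    then show ?case using assms(3)[of "abs_tens s" "abs_tens t"] by (simp only: plus_tens.abs_eq)
  next
    case (TScale c t)
    then show ?case using assms(4)[of "abs_tens t" c] by (simp only: scaleC_tens.abs_eq)
  qed
qed

definition tensor_power :: "nat \<Rightarrow> 'a :: complex_vector tens set" where
  "tensor_power n = complex_vector.span (pure ` {xs. length xs = n})"

definition slotwise_linear :: "('a :: complex_vector list \<Rightarrow> 'b :: complex_vector) \<Rightarrow> bool" where
  "slotwise_linear f \<longleftrightarrow>
    (\<forall>xs x y ys. f (xs @ (x + y) # ys) = f (xs @ x # ys) + f (xs @ y # ys)) \<and>
    (\<forall>xs c x ys. f (xs @ (c *\<^sub>C x) # ys) = c *\<^sub>C f (xs @ x # ys))"

primrec lin_eval :: "('a list \<Rightarrow> 'b) \<Rightarrow> 'a tens_term \<Rightarrow> 'b :: complex_vector" where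
  "lin_eval f (TPure xs) = f xs"
| "lin_eval f TZero = 0"
| "lin_eval f (TAdd s t) = lin_eval f s + lin_eval f t"
| "lin_eval f (TScale c s) = c *\<^sub>C lin_eval f s"

text \<open>For slotwise linear \<open>f\<close>, \<open>lin_ext f\<close> is the linear map with \<open>lin_ext f (pure xs) = f xs\<close>
  (see below); for other \<open>f\<close> its value is meaningless.\<close>

definition lin_ext :: "('a :: complex_vector list \<Rightarrow> 'b) \<Rightarrow> 'a tens \<Rightarrow> 'b :: complex_vector" where
  "lin_ext f x = lin_eval f (rep_tens x)"

lemma lin_eval_cong:
  assumes "slotwise_linear f" "tens_cong s t"
  shows "lin_eval f s = lin_eval f t"
  using assms(2,1)
  by induction
    (simp_all add: slotwise_linear_def add.assoc add.commute scaleC_add_right scaleC_add_left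
      scaleC_scaleC scaleC_one)

lemma lin_ext_abs:
  assumes "slotwise_linear f"
  shows "lin_ext f (abs_tens t) = lin_eval f t"
  unfolding lin_ext_def
  by (rule lin_eval_cong[OF assms]) (metis Quotient3_tens Quotient3_def tens.abs_eq_iff)

lemma
  assumes f: "slotwise_linear f"
  shows lin_ext_pure: "lin_ext f (pure xs) = f xs"
    and lin_ext_zero: "lin_ext f 0 = 0"
    and lin_ext_add: "lin_ext f (x + y) = lin_ext f x + lin_ext f y"
    and lin_ext_scale: "lin_ext f (c *\<^sub>C x) = c *\<^sub>C lin_ext f x"
proof -
  show "lin_ext f (pure xs) = f xs" by (simp add: pure.abs_eq lin_ext_abs[OF f])
  show "lin_ext f 0 = 0" by (simp add: zero_tens_def lin_ext_abs[OF f])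
  show "lin_ext f (x + y) = lin_ext f x + lin_ext f y"
    by (induction x rule: tens.abs_induct, induction y rule: tens.abs_induct)
      (simp add: plus_tens.abs_eq lin_ext_abs[OF f])
  show "lin_ext f (c *\<^sub>C x) = c *\<^sub>C lin_ext f x"
    by (induction x rule: tens.abs_induct) (simp add: scaleC_tens.abs_eq lin_ext_abs[OF f])
qed

text \<open>Concatenation of tensors: on \<open>'a\<^sup>\<otimes>\<^sup>m\<close> and \<open>'a\<^sup>\<otimes>\<^sup>n\<close> this is the canonical map to \<open>'a\<^sup>\<otimes>\<^sup>m\<^sup>+\<^sup>n\<close>.\<close>

definition tensor :: "'a :: complex_vector tens \<Rightarrow> 'a tens \<Rightarrow> 'a tens" (infixr "\<otimes>\<^sub>T" 70) where
  "x \<otimes>\<^sub>T y = lin_ext (\<lambda>xs. lin_ext (\<lambda>ys. pure (xs @ ys)) y) x"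

lemma slotwise_linearI:
  assumes "\<And>xs x y ys. f (xs @ (x + y) # ys) = f (xs @ x # ys) + f (xs @ y # ys)"
    and "\<And>xs c x ys. f (xs @ (c *\<^sub>C x) # ys) = c *\<^sub>C f (xs @ x # ys)"
  shows "slotwise_linear f"
  using assms unfolding slotwise_linear_def by blast

lemma slotwise_linear_append: "slotwise_linear (\<lambda>ys. pure (xs @ ys))"
proof (rule slotwise_linearI)
  show "pure (xs @ as @ (x + y) # bs) = pure (xs @ as @ x # bs) + pure (xs @ as @ y # bs)" for as x y bs
    using pure_add[of "xs @ as" x y bs] by simp
  show "pure (xs @ as @ (c *\<^sub>C x) # bs) = c *\<^sub>C pure (xs @ as @ x # bs)" for as c x bs
    using pure_scale[of "xs @ as" c x bs] by simp
qed

lemma lin_ext_fun_add: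
  "slotwise_linear f \<Longrightarrow> slotwise_linear g \<Longrightarrow> slotwise_linear h \<Longrightarrow>
    (\<And>xs. h xs = f xs + g xs) \<Longrightarrow> lin_ext h x = lin_ext f x + lin_ext g x"
  by (induction x) (simp_all add: lin_ext_pure lin_ext_zero lin_ext_add lin_ext_scale scaleC_add_right)

lemma lin_ext_fun_scale:
  "slotwise_linear f \<Longrightarrow> slotwise_linear h \<Longrightarrow>
    (\<And>xs. h xs = c *\<^sub>C f xs) \<Longrightarrow> lin_ext h x = c *\<^sub>C lin_ext f x"
  by (induction x)
    (simp_all add: lin_ext_pure lin_ext_zero lin_ext_add lin_ext_scale scaleC_add_right
      scaleC_scaleC mult.commute)

lemma slotwise_linear_tensor: "slotwise_linear (\<lambda>xs. lin_ext (\<lambda>ys. pure (xs @ ys)) y)"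
proof (rule slotwise_linearI)
  show "lin_ext (\<lambda>ys. pure ((xs @ (a + b) # zs) @ ys)) y =
    lin_ext (\<lambda>ys. pure ((xs @ a # zs) @ ys)) y + lin_ext (\<lambda>ys. pure ((xs @ b # zs) @ ys)) y"
    for xs a b zs
    by (rule lin_ext_fun_add) (rule slotwise_linear_append | simp add: pure_add)+
  show "lin_ext (\<lambda>ys. pure ((xs @ (c *\<^sub>C a) # zs) @ ys)) y =
    c *\<^sub>C lin_ext (\<lambda>ys. pure ((xs @ a # zs) @ ys)) y"
    for xs c a zs
    by (rule lin_ext_fun_scale) (rule slotwise_linear_append | simp add: pure_scale)+
qed

lemma tensor_pure: "pure xs \<otimes>\<^sub>T pure ys = pure (xs @ ys)"
  unfolding tensor_def
  by (rule HOL.trans[OF lin_ext_pure[OF slotwise_linear_tensor] lin_ext_pure[OF slotwise_linear_append]])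

lemma tensor_add_left: "(x + y) \<otimes>\<^sub>T z = x \<otimes>\<^sub>T z + y \<otimes>\<^sub>T z"
  and tensor_scale_left: "(c *\<^sub>C x) \<otimes>\<^sub>T z = c *\<^sub>C (x \<otimes>\<^sub>T z)"
  and tensor_zero_left: "0 \<otimes>\<^sub>T z = 0"
  by (simp_all add: tensor_def lin_ext_add lin_ext_scale lin_ext_zero slotwise_linear_tensor)

lemma tensor_add_right: "z \<otimes>\<^sub>T (x + y) = z \<otimes>\<^sub>T x + z \<otimes>\<^sub>T y"
  and tensor_scale_right: "z \<otimes>\<^sub>T (c *\<^sub>C x) = c *\<^sub>C (z \<otimes>\<^sub>T x)"
  and tensor_zero_right: "z \<otimes>\<^sub>T 0 = 0"
proof -
  have pure: "pure zs \<otimes>\<^sub>T w = lin_ext (\<lambda>ys. pure (zs @ ys)) w" for zs and w :: "'a tens"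
    by (simp add: tensor_def lin_ext_pure[OF slotwise_linear_tensor])
  show "z \<otimes>\<^sub>T (x + y) = z \<otimes>\<^sub>T x + z \<otimes>\<^sub>T y"
    by (induction z) (simp_all add: pure lin_ext_add[OF slotwise_linear_append] tensor_add_left
      tensor_scale_left tensor_zero_left scaleC_add_right)
  show "z \<otimes>\<^sub>T (c *\<^sub>C x) = c *\<^sub>C (z \<otimes>\<^sub>T x)"
    by (induction z) (simp_all add: pure lin_ext_scale[OF slotwise_linear_append] tensor_add_left
      tensor_scale_left tensor_zero_left scaleC_add_right scaleC_scaleC mult.commute)
  show "z \<otimes>\<^sub>T 0 = 0"
    by (induction z) (simp_all add: pure lin_ext_zero[OF slotwise_linear_append] tensor_add_left
      tensor_scale_left tensor_zero_left)
qed

text \<open>The product of \<open>'a tens\<close> is the factorwise product on each tensor power; the product of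
  elements of different tensor powers is \<open>0\<close>.  The unit of \<open>'a\<^sup>\<otimes>\<^sup>n\<close> is \<open>pure (replicate n 1)\<close>.\<close>

definition factorwise :: "'a :: complex_algebra_1 list \<Rightarrow> 'a list \<Rightarrow> 'a tens" where
  "factorwise xs ys = (if length xs = length ys then pure (map2 (*) xs ys) else 0)"

lemma slotwise_linear_factorwise_right: "slotwise_linear (factorwise zs)"
proof (rule slotwise_linearI)
  fix xs ys :: "'a list" and x y :: 'a and c :: complex
  show "factorwise zs (xs @ (x + y) # ys) = factorwise zs (xs @ x # ys) + factorwise zs (xs @ y # ys)"
  proof (cases "length zs = length xs + Suc (length ys)")
    case True
    then obtain us u vs where "zs = us @ u # vs" "length us = length xs"
      by (metis id_take_nth_drop add_less_cancel_left add.right_neutral length_take min.absorb4 zero_less_Suc)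
    with True show ?thesis by (simp add: factorwise_def pure_add distrib_left)
  qed (simp add: factorwise_def)
  show "factorwise zs (xs @ (c *\<^sub>C x) # ys) = c *\<^sub>C factorwise zs (xs @ x # ys)"
  proof (cases "length zs = length xs + Suc (length ys)")
    case True
    then obtain us u vs where "zs = us @ u # vs" "length us = length xs"
      by (metis id_take_nth_drop add_less_cancel_left add.right_neutral length_take min.absorb4 zero_less_Suc)
    with True show ?thesis by (simp add: factorwise_def pure_scale mult_scaleC_right)
  qed (simp add: factorwise_def)
qed

lemma slotwise_linear_factorwise_left: "slotwise_linear (\<lambda>xs. factorwise xs zs)"
proof (rule slotwise_linearI)
  fix xs ys :: "'a list" and x y :: 'a and c :: complex
  show "factorwise (xs @ (x + y) # ys) zs = factorwise (xs @ x # ys) zs + factorwise (xs @ y # ys) zs"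
  proof (cases "length zs = length xs + Suc (length ys)")
    case True
    then obtain us u vs where "zs = us @ u # vs" "length us = length xs"
      by (metis id_take_nth_drop add_less_cancel_left add.right_neutral length_take min.absorb4 zero_less_Suc)
    with True show ?thesis by (simp add: factorwise_def pure_add distrib_right)
  qed (simp add: factorwise_def)
  show "factorwise (xs @ (c *\<^sub>C x) # ys) zs = c *\<^sub>C factorwise (xs @ x # ys) zs"
  proof (cases "length zs = length xs + Suc (length ys)")
    case True
    then obtain us u vs where "zs = us @ u # vs" "length us = length xs"
      by (metis id_take_nth_drop add_less_cancel_left add.right_neutral length_take min.absorb4 zero_less_Suc)
    with True show ?thesis by (simp add: factorwise_def pure_scale mult_scaleC_left)
  qed (simp add: factorwise_def)
qed

instantiation tens :: (complex_algebra_1) times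
begin

definition times_tens :: "'a tens \<Rightarrow> 'a tens \<Rightarrow> 'a tens" where
  "x * y = lin_ext (\<lambda>xs. lin_ext (factorwise xs) y) x"

instance ..

end

lemma slotwise_linear_times: "slotwise_linear (\<lambda>xs. lin_ext (factorwise xs) y)"
proof (rule slotwise_linearI)
  show "lin_ext (factorwise (xs @ (a + b) # zs)) y =
    lin_ext (factorwise (xs @ a # zs)) y + lin_ext (factorwise (xs @ b # zs)) y" for xs a b zs
    by (rule lin_ext_fun_add)
      (rule slotwise_linear_factorwise_right
        | metis slotwise_linear_factorwise_left slotwise_linear_def)+
  show "lin_ext (factorwise (xs @ (c *\<^sub>C a) # zs)) y = c *\<^sub>C lin_ext (factorwise (xs @ a # zs)) y"
    for xs c a zs
    by (rule lin_ext_fun_scale)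
      (rule slotwise_linear_factorwise_right
        | metis slotwise_linear_factorwise_left slotwise_linear_def)+
qed

lemma pure_times: "pure xs * y = lin_ext (factorwise xs) y"
  by (simp add: times_tens_def lin_ext_pure[OF slotwise_linear_times])

lemma pure_times_pure:
  "pure xs * pure ys = (if length xs = length ys then pure (map2 (*) xs ys) else 0)"
  by (simp add: pure_times lin_ext_pure[OF slotwise_linear_factorwise_right] factorwise_def)

lemma times_tens_bilinear:
  fixes x y z :: "'a :: complex_algebra_1 tens"
  shows "(x + y) * z = x * z + y * z" "(c *\<^sub>C x) * z = c *\<^sub>C (x * z)" "0 * z = 0"
    "z * (x + y) = z * x + z * y" "z * (c *\<^sub>C x) = c *\<^sub>C (z * x)" "z * 0 = 0"
proof -
  show left: "(x + y) * z = x * z + y * z" "(c *\<^sub>C x) * z = c *\<^sub>C (x * z)" "0 * z = 0"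
    for x y z :: "'a tens" and c
    by (simp_all add: times_tens_def lin_ext_add lin_ext_scale lin_ext_zero slotwise_linear_times)
  show "z * (x + y) = z * x + z * y"
    by (induction z) (simp_all add: pure_times lin_ext_add[OF slotwise_linear_factorwise_right] left
      scaleC_add_right)
  show "z * (c *\<^sub>C x) = c *\<^sub>C (z * x)"
    by (induction z) (simp_all add: pure_times lin_ext_scale[OF slotwise_linear_factorwise_right] left
      scaleC_add_right scaleC_scaleC mult.commute)
  show "z * 0 = 0"
    by (induction z) (simp_all add: pure_times lin_ext_zero[OF slotwise_linear_factorwise_right] left)
qed

instance tens :: (complex_algebra_1) ring
proof
  fix x y z :: "'a tens"
  have ppp: "pure us * pure vs * pure ws = pure us * (pure vs * pure ws)" for us vs ws :: "'a list"
    by (auto simp: pure_times_pure times_tens_bilinear intro!: arg_cong[where f = pure] nth_equalityI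
        simp: mult.assoc)
  have pp: "pure us * pure vs * z = pure us * (pure vs * z)" for us vs
    by (induction z) (simp_all add: ppp times_tens_bilinear)
  have p: "pure us * y * z = pure us * (y * z)" for us
    by (induction y) (simp_all add: pp times_tens_bilinear)
  show "x * y * z = x * (y * z)"
    by (induction x) (simp_all add: p times_tens_bilinear)
  show "(x + y) * z = x * z + y * z" "x * (y + z) = x * y + x * z"
    by (rule times_tens_bilinear)+
qed

lemma tensor_power_subspace: "complex_vector.subspace (tensor_power n)"
  unfolding tensor_power_def by (rule complex_vector.subspace_span)

lemma pure_in_tensor_power: "length xs = n \<Longrightarrow> pure xs \<in> tensor_power n"
  unfolding tensor_power_def by (auto intro: complex_vector.span_base)

lemma tensor_power_times:
  assumes "x \<in> tensor_power n" "y \<in> tensor_power n"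
  shows "x * y \<in> tensor_power n"
proof -
  note sub = complex_vector.subspace_0[OF tensor_power_subspace]
    complex_vector.subspace_add[OF tensor_power_subspace]
    complex_vector.subspace_scale[OF tensor_power_subspace]
  have pure: "pure us * y \<in> tensor_power n" if "length us = n" for us :: "'a list"
    using assms(2) unfolding tensor_power_def[of n]
  proof (induction rule: complex_vector.span_induct_alt[consumes 1, case_names base step, folded tensor_power_def[of n]])
    case (step c q y)
    then show ?case
      using that by (auto simp: times_tens_bilinear pure_times_pure simp flip: tensor_power_def
          intro!: sub pure_in_tensor_power)
  qed (use sub(1) in \<open>simp add: times_tens_bilinear tensor_power_def\<close>)
  show ?thesis
    using assms(1) unfolding tensor_power_def[of n]
  proof (induction rule: complex_vector.span_induct_alt[consumes 1, case_names base step, folded tensor_power_def[of n]])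
    case (step c q x)
    then obtain us where "q = pure us" "length us = n" by auto
    with step show ?case
      using pure[of us] by (simp add: times_tens_bilinear sub flip: tensor_power_def)
  qed (use sub(1) in \<open>simp add: times_tens_bilinear tensor_power_def\<close>)
qed

lemma tensor_power_one:
  assumes "x \<in> tensor_power n"
  shows "pure (replicate n 1) * x = x" "x * pure (replicate n 1) = x"
proof -
  have *: "map2 (*) (replicate n 1) xs = xs" "map2 (*) xs (replicate n 1) = xs"
    if "length xs = n" for xs :: "'a list"
    using that by (auto intro!: nth_equalityI)
  from assms have "pure (replicate n 1) * x = x \<and> x * pure (replicate n 1) = x"
    unfolding tensor_power_def
  proof (induction rule: complex_vector.span_induct_alt[consumes 1, case_names base step])
    case (step c p y)
    then obtain xs where "p = pure xs" "length xs = n" by auto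
    with step show ?case by (simp add: times_tens_bilinear pure_times_pure *)
  qed (simp add: times_tens_bilinear)
  then show "pure (replicate n 1) * x = x" "x * pure (replicate n 1) = x" by simp_all
qed


section \<open>Davydov--Yetter cohomology\<close>

text \<open>\<open>id\<^sup>\<otimes>\<^sup>i\<^sup>-\<^sup>1 \<otimes> \<Delta> \<otimes> id\<^sup>\<otimes>\<^sup>n\<^sup>-\<^sup>i\<close> on \<open>'a\<^sup>\<otimes>\<^sup>n\<close> for \<open>1 \<le> i \<le> n\<close>, for linear \<open>\<Delta> : 'a \<rightarrow> 'a \<otimes> 'a\<close>; it is
  \<open>0\<close> on \<open>'a\<^sup>\<otimes>\<^sup>n\<close> with \<open>n < i\<close>.\<close>

definition comult_at :: "('a :: complex_vector \<Rightarrow> 'a tens) \<Rightarrow> nat \<Rightarrow> 'a tens \<Rightarrow> 'a tens" where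
  "comult_at \<Delta> i = lin_ext (\<lambda>xs.
     if 1 \<le> i \<and> i \<le> length xs
     then pure (take (i - 1) xs) \<otimes>\<^sub>T \<Delta> (xs ! (i - 1)) \<otimes>\<^sub>T pure (drop i xs) else 0)"

text \<open>\<open>iter_comult \<Delta> k\<close> is \<open>\<Delta>\<^sup>(\<^sup>k\<^sup>) : 'a \<rightarrow> 'a\<^sup>\<otimes>\<^sup>k\<^sup>+\<^sup>1\<close>.\<close>

primrec iter_comult :: "('a :: complex_vector \<Rightarrow> 'a tens) \<Rightarrow> nat \<Rightarrow> 'a \<Rightarrow> 'a tens" where
  "iter_comult \<Delta> 0 h = pure [h]"
| "iter_comult \<Delta> (Suc k) h = comult_at \<Delta> 1 (iter_comult \<Delta> k h)"

primrec DY_cochains :: "('a :: complex_algebra_1 \<Rightarrow> 'a tens) \<Rightarrow> nat \<Rightarrow> 'a tens set" where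
  "DY_cochains \<Delta> 0 = tensor_power 0"
| "DY_cochains \<Delta> (Suc k) =
    {x \<in> tensor_power (Suc k). \<forall>h. x * iter_comult \<Delta> k h = iter_comult \<Delta> k h * x}"

definition DY_diff :: "('a :: complex_algebra_1 \<Rightarrow> 'a tens) \<Rightarrow> nat \<Rightarrow> 'a tens \<Rightarrow> 'a tens" where
  "DY_diff \<Delta> n x =
    pure [1] \<otimes>\<^sub>T x + (\<Sum>i = 1..n. (-1) ^ i *\<^sub>C comult_at \<Delta> i x) + (-1) ^ (n + 1) *\<^sub>C (x \<otimes>\<^sub>T pure [1])"

definition DY_cocycles :: "('a :: complex_algebra_1 \<Rightarrow> 'a tens) \<Rightarrow> nat \<Rightarrow> 'a tens set" where
  "DY_cocycles \<Delta> n = {x \<in> DY_cochains \<Delta> n. DY_diff \<Delta> n x = 0}"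

primrec DY_coboundaries :: "('a :: complex_algebra_1 \<Rightarrow> 'a tens) \<Rightarrow> nat \<Rightarrow> 'a tens set" where
  "DY_coboundaries \<Delta> 0 = {0}"
| "DY_coboundaries \<Delta> (Suc k) = DY_diff \<Delta> k ` DY_cochains \<Delta> k"

text \<open>The complex vector space \<open>Z / B\<close> of cosets \<open>z + B\<close> with \<open>z \<in> Z\<close>.\<close>

definition quotient_space :: "'a :: complex_vector set \<Rightarrow> 'a set \<Rightarrow> (complex, 'a set) module" where
  "quotient_space Z B = \<lparr>
     carrier = (\<lambda>z. (+) z ` B) ` Z,
     monoid.mult = undefined,
     one = undefined,
     zero = B,
     add = (\<lambda>X Y. {x + y | x y. x \<in> X \<and> y \<in> Y}),
     smult = (\<lambda>c X. {c *\<^sub>C x + b | x b. x \<in> X \<and> b \<in> B}) \<rparr>"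

definition DY_cohomology :: "('a :: complex_algebra_1 \<Rightarrow> 'a tens) \<Rightarrow> nat \<Rightarrow> (complex, 'a tens set) module" where
  "DY_cohomology \<Delta> n = quotient_space (DY_cocycles \<Delta> n) (DY_coboundaries \<Delta> n)"

definition DY_class :: "('a :: complex_algebra_1 \<Rightarrow> 'a tens) \<Rightarrow> nat \<Rightarrow> 'a tens \<Rightarrow> 'a tens set" where
  "DY_class \<Delta> n x = (+) x ` DY_coboundaries \<Delta> n"

lemma slotwise_linear_comult_at:
  assumes add: "\<And>x y. \<Delta> (x + y) = \<Delta> x + \<Delta> y" and scale: "\<And>c x. \<Delta> (c *\<^sub>C x) = c *\<^sub>C \<Delta> x"
  shows "slotwise_linear (\<lambda>xs.
     if 1 \<le> i \<and> i \<le> length xs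
     then pure (take (i - 1) xs) \<otimes>\<^sub>T \<Delta> (xs ! (i - 1)) \<otimes>\<^sub>T pure (drop i xs) else 0)"
    (is "slotwise_linear ?f")
proof -
  have cases: thesis
    if "(\<And>z. ?f (us @ z # vs) = 0) \<Longrightarrow> thesis"
      and "\<And>A d B. (\<And>z. ?f (us @ z # vs) = pure A \<otimes>\<^sub>T d \<otimes>\<^sub>T pure (B @ z # vs)) \<Longrightarrow> thesis"
      and "\<And>A B. (\<And>z. ?f (us @ z # vs) = pure A \<otimes>\<^sub>T \<Delta> z \<otimes>\<^sub>T pure B) \<Longrightarrow> thesis"
      and "\<And>A d B. (\<And>z. ?f (us @ z # vs) = pure (us @ z # A) \<otimes>\<^sub>T d \<otimes>\<^sub>T pure B) \<Longrightarrow> thesis"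
    for us vs :: "'a list" and thesis
  proof (cases "1 \<le> i \<and> i \<le> length us + Suc (length vs)")
    case True
    then obtain k where k: "i = Suc k" "k \<le> length us + length vs" by (cases i) auto
    consider "k < length us" | "k = length us" | "length us < k" by linarith
    then show thesis
    proof cases
      case 1
      then show thesis
        using k by (intro that(2)[of "take k us" "\<Delta> (us ! k)" "drop i us"]) (simp add: nth_append)
    next
      case 2
      then show thesis using k by (intro that(3)[of us vs]) simp
    next
      case 3
      then obtain m where m: "k = length us + Suc m" using less_imp_Suc_add by fastforce
      show thesis
        using k m by (intro that(4)[of "take m vs" "\<Delta> (vs ! m)" "drop (Suc m) vs"]) (simp add: nth_append)
    qed
  next
    case False
    then show thesis by (intro that(1)) auto
  qed
  show ?thesis
  proof (rule slotwise_linearI)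
    fix us vs :: "'a list" and x y :: 'a and c :: complex
    show "?f (us @ (x + y) # vs) = ?f (us @ x # vs) + ?f (us @ y # vs)"
      by (rule cases[of us vs])
        (simp_all only: pure_add add tensor_add_left tensor_add_right add_0_left)
    show "?f (us @ (c *\<^sub>C x) # vs) = c *\<^sub>C ?f (us @ x # vs)"
      by (rule cases[of us vs])
        (simp_all only: pure_scale scale tensor_scale_left tensor_scale_right
          complex_vector.scale_zero_right)
  qed
qed

lemma
  assumes "\<And>x y. \<Delta> (x + y) = \<Delta> x + \<Delta> y" and "\<And>c x. \<Delta> (c *\<^sub>C x) = c *\<^sub>C \<Delta> x"
  shows comult_at_pure: "1 \<le> i \<Longrightarrow> i \<le> length xs \<Longrightarrow>
      comult_at \<Delta> i (pure xs) = pure (take (i - 1) xs) \<otimes>\<^sub>T \<Delta> (xs ! (i - 1)) \<otimes>\<^sub>T pure (drop i xs)"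
    and comult_at_add: "comult_at \<Delta> i (x + y) = comult_at \<Delta> i x + comult_at \<Delta> i y"
    and comult_at_scale: "comult_at \<Delta> i (c *\<^sub>C x) = c *\<^sub>C comult_at \<Delta> i x"
    and comult_at_zero: "comult_at \<Delta> i 0 = 0"
proof -
  note sl = slotwise_linear_comult_at[of \<Delta> i, OF assms]
  show "comult_at \<Delta> i (pure xs) = pure (take (i - 1) xs) \<otimes>\<^sub>T \<Delta> (xs ! (i - 1)) \<otimes>\<^sub>T pure (drop i xs)"
    if "1 \<le> i" "i \<le> length xs"
    unfolding comult_at_def lin_ext_pure[OF sl] using that by simp
  show "comult_at \<Delta> i (x + y) = comult_at \<Delta> i x + comult_at \<Delta> i y"
    "comult_at \<Delta> i (c *\<^sub>C x) = c *\<^sub>C comult_at \<Delta> i x" "comult_at \<Delta> i 0 = 0"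
    unfolding comult_at_def by (rule lin_ext_add[OF sl] lin_ext_scale[OF sl] lin_ext_zero[OF sl])+
qed

lemma
  assumes "\<And>x y. \<Delta> (x + y) = \<Delta> x + \<Delta> y" and "\<And>c x. \<Delta> (c *\<^sub>C x) = c *\<^sub>C \<Delta> x"
  shows DY_diff_add: "DY_diff \<Delta> n (x + y) = DY_diff \<Delta> n x + DY_diff \<Delta> n y"
    and DY_diff_scale: "DY_diff \<Delta> n (c *\<^sub>C x) = c *\<^sub>C DY_diff \<Delta> n x"
    and DY_diff_zero: "DY_diff \<Delta> n 0 = 0"
  by (simp_all add: DY_diff_def comult_at_add[of \<Delta>, OF assms] comult_at_scale[of \<Delta>, OF assms]
      comult_at_zero[of \<Delta>, OF assms] tensor_add_left tensor_add_right tensor_scale_left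
      tensor_scale_right tensor_zero_left tensor_zero_right scaleC_add_right scaleC_scaleC
      complex_vector.scale_sum_right complex_vector.scale_right_diff_distrib
      sum.distrib mult.commute)

lemma DY_cochains_subspace: "complex_vector.subspace (DY_cochains \<Delta> n)"
proof (cases n)
  case 0
  then show ?thesis by (simp add: tensor_power_subspace)
next
  case (Suc k)
  show ?thesis
    unfolding Suc DY_cochains.simps
    by (rule complex_vector.subspaceI)
      (auto simp: times_tens_bilinear complex_vector.subspace_0 complex_vector.subspace_add
        complex_vector.subspace_scale tensor_power_subspace)
qed

lemma vectorspace_quotient_space:
  fixes Z B :: "'a :: complex_vector set"
  assumes Z: "complex_vector.subspace Z" and B: "complex_vector.subspace B"
  shows "vectorspace class_ring (quotient_space Z B)"
proof -
  let ?Q = "quotient_space Z B"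
  define co where "co z = (+) z ` B" for z
  note B0 = complex_vector.subspace_0[OF B] and Badd = complex_vector.subspace_add[OF B]
    and Bscale = complex_vector.subspace_scale[OF B]
  note Z0 = complex_vector.subspace_0[OF Z] and Zadd = complex_vector.subspace_add[OF Z]
    and Zscale = complex_vector.subspace_scale[OF Z]
  have carrier: "carrier ?Q = co ` Z" and zero: "\<zero>\<^bsub>?Q\<^esub> = co 0"
    by (simp_all add: quotient_space_def co_def)
  have add: "co x \<oplus>\<^bsub>?Q\<^esub> co y = co (x + y)" for x y
  proof -
    have "{u + v | u v. u \<in> co x \<and> v \<in> co y} = co (x + y)"
    proof (intro equalityI subsetI; unfold co_def)
      fix w assume "w \<in> {u + v | u v. u \<in> (+) x ` B \<and> v \<in> (+) y ` B}"
      then obtain b b' where b: "b \<in> B" "b' \<in> B" "w = (x + b) + (y + b')" by blast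
      then have "w = (x + y) + (b + b')" by (simp add: algebra_simps)
      then show "w \<in> (+) (x + y) ` B" using Badd[OF b(1,2)] by (rule image_eqI)
    next
      fix w assume "w \<in> (+) (x + y) ` B"
      then obtain b where "b \<in> B" "w = (x + 0) + (y + b)" by (auto simp: add.assoc)
      then show "w \<in> {u + v | u v. u \<in> (+) x ` B \<and> v \<in> (+) y ` B}" using B0 by blast
    qed
    then show ?thesis by (simp add: quotient_space_def)
  qed
  have smult: "a \<odot>\<^bsub>?Q\<^esub> co x = co (a *\<^sub>C x)" for a x
  proof -
    have "{a *\<^sub>C u + v | u v. u \<in> co x \<and> v \<in> B} = co (a *\<^sub>C x)"
    proof (intro equalityI subsetI; unfold co_def)
      fix w assume "w \<in> {a *\<^sub>C u + v | u v. u \<in> (+) x ` B \<and> v \<in> B}"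
      then obtain b b' where b: "b \<in> B" "b' \<in> B" "w = a *\<^sub>C (x + b) + b'" by blast
      then have "w = a *\<^sub>C x + (a *\<^sub>C b + b')" by (simp add: scaleC_add_right add.assoc)
      then show "w \<in> (+) (a *\<^sub>C x) ` B" using Badd[OF Bscale[OF b(1)] b(2)] by (rule image_eqI)
    next
      fix w assume "w \<in> (+) (a *\<^sub>C x) ` B"
      then obtain b where "b \<in> B" "w = a *\<^sub>C (x + 0) + b" by auto
      then show "w \<in> {a *\<^sub>C u + v | u v. u \<in> (+) x ` B \<and> v \<in> B}" using B0 by blast
    qed
    then show ?thesis by (simp add: quotient_space_def)
  qed
  have "abelian_group ?Q"
  proof (rule abelian_groupI)
    fix X assume "X \<in> carrier ?Q"
    then obtain z where z: "z \<in> Z" "X = co z" unfolding carrier by blast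
    have "co (- z) \<in> carrier ?Q"
      unfolding carrier using complex_vector.subspace_neg[OF Z z(1)] by (rule imageI)
    then show "\<exists>Y\<in>carrier ?Q. Y \<oplus>\<^bsub>?Q\<^esub> X = \<zero>\<^bsub>?Q\<^esub>"
      by (rule bexI[rotated]) (simp only: z zero add left_minus)
  qed (auto simp: carrier zero add ac_simps intro!: imageI Zadd Z0)
  moreover have "module_axioms class_ring ?Q"
    by unfold_locales
      (auto simp: carrier add smult scaleC_add_left scaleC_add_right scaleC_scaleC scaleC_one
        intro!: imageI Zscale)
  ultimately show ?thesis
    by (intro vectorspace.intro Module.module.intro class_field class_cring.is_cring)
qed

lemma vectorspace_DY_cohomology:
  assumes "\<And>x y. \<Delta> (x + y) = \<Delta> x + \<Delta> y" and "\<And>c x. \<Delta> (c *\<^sub>C x) = c *\<^sub>C \<Delta> x"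
  shows "vectorspace class_ring (DY_cohomology \<Delta> n)"
proof -
  note diff = DY_diff_add[of \<Delta>, OF assms] DY_diff_scale[of \<Delta>, OF assms] DY_diff_zero[of \<Delta>, OF assms]
  note C = DY_cochains_subspace[of \<Delta>]
  have "complex_vector.subspace (DY_cocycles \<Delta> n)"
    unfolding DY_cocycles_def
    by (rule complex_vector.subspaceI)
      (auto simp: diff complex_vector.subspace_0[OF C] complex_vector.subspace_add[OF C]
        complex_vector.subspace_scale[OF C])
  moreover have "complex_vector.subspace (DY_coboundaries \<Delta> n)"
  proof (cases n)
    case (Suc k)
    show ?thesis
      unfolding Suc DY_coboundaries.simps
    proof (rule complex_vector.subspaceI)
      show "0 \<in> DY_diff \<Delta> k ` DY_cochains \<Delta> k"
        using complex_vector.subspace_0[OF C] diff(3) by (metis imageI)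
    next
      fix x y assume "x \<in> DY_diff \<Delta> k ` DY_cochains \<Delta> k" "y \<in> DY_diff \<Delta> k ` DY_cochains \<Delta> k"
      then show "x + y \<in> DY_diff \<Delta> k ` DY_cochains \<Delta> k"
        by (auto simp: diff(1)[symmetric] intro!: imageI complex_vector.subspace_add[OF C])
    next
      fix c x assume "x \<in> DY_diff \<Delta> k ` DY_cochains \<Delta> k"
      then show "c *\<^sub>C x \<in> DY_diff \<Delta> k ` DY_cochains \<Delta> k"
        by (auto simp: diff(2)[symmetric] intro!: imageI complex_vector.subspace_scale[OF C])
    qed
  qed simp
  ultimately show ?thesis
    unfolding DY_cohomology_def by (rule vectorspace_quotient_space)
qed


section \<open>The Hopf algebra \<open>U\<^sub>i(sl\<^sub>2)\<close>\<close>

datatype uq_gen = GE | GF | GK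

abbreviation (input) Minus :: "'g alg_term \<Rightarrow> 'g alg_term \<Rightarrow> 'g alg_term" where
  "Minus s t \<equiv> Add s (Mul (Scal (-1)) t)"

inductive uq_rel :: "uq_gen alg_term \<Rightarrow> uq_gen alg_term \<Rightarrow> bool" where
  uq_KE: "uq_rel (Mul (Gen GK) (Gen GE)) (Mul (Scal (-1)) (Mul (Gen GE) (Gen GK)))"
| uq_KF: "uq_rel (Mul (Gen GK) (Gen GF)) (Mul (Scal (-1)) (Mul (Gen GF) (Gen GK)))"
| uq_EF: "uq_rel (Minus (Mul (Gen GE) (Gen GF)) (Mul (Gen GF) (Gen GE)))
    (Mul (Scal (- \<i> / 2)) (Minus (Gen GK) (Mul (Gen GK) (Mul (Gen GK) (Gen GK)))))"
| uq_EE: "uq_rel (Mul (Gen GE) (Gen GE)) (Scal 0)"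
| uq_FF: "uq_rel (Mul (Gen GF) (Gen GF)) (Scal 0)"
| uq_KKKK: "uq_rel (Mul (Gen GK) (Mul (Gen GK) (Mul (Gen GK) (Gen GK)))) (Scal 1)"

quotient_type uq = "uq_gen alg_term" / "alg_cong uq_rel"
  by (rule equivp_alg_cong)

text \<open>The counit comes first because it shows \<open>1 \<noteq> 0\<close>.  The Davydov--Yetter complex uses neither
  the counit nor the antipode.\<close>

lift_definition uq_counit :: "uq \<Rightarrow> complex" is
  "alg_eval (\<lambda>c. c) (\<lambda>x. case x of GE \<Rightarrow> 0 | GF \<Rightarrow> 0 | GK \<Rightarrow> 1)"
  by (erule alg_eval_cong[where A = UNIV]) (auto elim: uq_rel.cases)

instantiation uq :: complex_algebra_1
begin

lift_definition zero_uq :: uq is "Scal 0" .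
lift_definition one_uq :: uq is "Scal 1" .
lift_definition plus_uq :: "uq \<Rightarrow> uq \<Rightarrow> uq" is Add by (rule ac_Add)
lift_definition times_uq :: "uq \<Rightarrow> uq \<Rightarrow> uq" is Mul by (rule ac_Mul)
lift_definition scaleC_uq :: "complex \<Rightarrow> uq \<Rightarrow> uq" is "\<lambda>c. Mul (Scal c)"
  by (intro ac_Mul ac_refl)
lift_definition uminus_uq :: "uq \<Rightarrow> uq" is "Mul (Scal (-1))" by (intro ac_Mul ac_refl)
lift_definition minus_uq :: "uq \<Rightarrow> uq \<Rightarrow> uq" is Minus by (intro ac_Add ac_Mul ac_refl)

instance
proof
  fix x y z :: uq and a b :: complex
  show "x + y + z = x + (y + z)" by transfer (rule ac_Add_assoc)
  show "x + y = y + x" by transfer (rule ac_Add_commute)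
  show "0 + x = x" by transfer (rule ac_Add_zero)
  show "- x + x = 0" by transfer (rule ac_Add_minus)
  show "x - y = x + - y" by transfer (rule ac_refl)
  show "x * y * z = x * (y * z)" by transfer (rule ac_Mul_assoc)
  show "1 * x = x" by transfer (rule ac_Mul_one)
  show "x * 1 = x" by transfer (meson ac_Scal_central ac_Mul_one ac_trans)
  show "(x + y) * z = x * z + y * z" by transfer (rule ac_distrib_right)
  show "x * (y + z) = x * y + x * z" by transfer (rule ac_distrib_left)
  show "a *\<^sub>C (x + y) = a *\<^sub>C x + a *\<^sub>C y" by transfer (rule ac_distrib_left)
  show "(a + b) *\<^sub>C x = a *\<^sub>C x + b *\<^sub>C x"
    by transfer (meson ac_Scal_add ac_distrib_right ac_Mul ac_refl ac_sym ac_trans)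
  show "a *\<^sub>C b *\<^sub>C x = (a * b) *\<^sub>C x"
    by transfer (meson ac_Scal_mult ac_Mul_assoc ac_Mul ac_refl ac_sym ac_trans)
  show "1 *\<^sub>C x = x" by transfer (rule ac_Mul_one)
  show "(a *\<^sub>C x) * y = a *\<^sub>C (x * y)" by transfer (rule ac_Mul_assoc)
  show "x * (a *\<^sub>C y) = a *\<^sub>C (x * y)"
    by transfer (meson ac_Scal_central ac_Mul_assoc ac_Mul ac_refl ac_sym ac_trans)
  have "uq_counit 0 = 0" "uq_counit 1 = 1" by (transfer, simp)+
  then show "(0 :: uq) \<noteq> 1" by auto
qed

end

lift_definition uE :: uq is "Gen GE" .
lift_definition uF :: uq is "Gen GF" .
lift_definition uK :: uq is "Gen GK" .

lemma uq_relations: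
  "uK * uE = - (uE * uK)"
  "uK * uF = - (uF * uK)"
  "uE * uF - uF * uE = (- \<i> / 2) *\<^sub>C (uK - uK ^ 3)"
  "uE ^ 2 = 0" "uF ^ 2 = 0" "uK ^ 4 = 1"
  unfolding power2_eq_square power3_eq_cube power4_eq_xxxx mult.assoc
  by (transfer; rule ac_rel uq_rel.intros)+

text \<open>\<open>\<Delta>\<close> is the algebra morphism determined by its values on the generators; \<open>K\<^sup>-\<^sup>1 = K\<^sup>3\<close>.\<close>

primrec uq_comult_gen :: "uq_gen \<Rightarrow> uq tens" where
  "uq_comult_gen GE = pure [1, uE] + pure [uE, uK]"
| "uq_comult_gen GF = pure [uF, 1] + pure [uK ^ 3, uF]"
| "uq_comult_gen GK = pure [uK, uK]"

lemma uq_normalize: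
  "uE * uE = 0" "uF * uF = 0" "uK * (uK * (uK * uK)) = 1" 
  "uK * (uE * x) = - (uE * (uK * x))" "uK * (uF * x) = - (uF * (uK * x))"
  "uK * uE = - (uE * uK)" "uK * uF = - (uF * uK)"
  "uE * uF = uF * uE + (- \<i> / 2) *\<^sub>C (uK - uK * (uK * uK))"
  using uq_relations by (simp_all add: power2_eq_square power3_eq_cube power4_eq_xxxx mult.assoc
      flip: mult.assoc[of uK uE x] mult.assoc[of uK uF x])
   (simp_all add: mult.assoc algebra_simps)

lemma pure_2:
  fixes x y z :: "'a :: complex_vector"
  shows "pure [x + y, z] = pure [x, z] + pure [y, z]" "pure [z, x + y] = pure [z, x] + pure [z, y]"
    and "pure [c *\<^sub>C x, z] = c *\<^sub>C pure [x, z]" "pure [z, c *\<^sub>C x] = c *\<^sub>C pure [z, x]"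
    and "pure [- x, z] = - pure [x, z]" "pure [z, - x] = - pure [z, x]"
    and "pure [x - y, z] = pure [x, z] - pure [y, z]" "pure [z, x - y] = pure [z, x] - pure [z, y]"
    and "pure [0, z] = 0" "pure [z, 0] = 0"
proof -
  show 1: "pure [x + y, z] = pure [x, z] + pure [y, z]" "pure [z, x + y] = pure [z, x] + pure [z, y]"
    "pure [c *\<^sub>C x, z] = c *\<^sub>C pure [x, z]" "pure [z, c *\<^sub>C x] = c *\<^sub>C pure [z, x]" for x y c
    using pure_add[of "[]" _ _ "[z]"] pure_add[of "[z]" _ _ "[]"]
      pure_scale[of "[]" _ _ "[z]"] pure_scale[of "[z]" _ _ "[]"] by simp_all
  have m: "- v = (-1) *\<^sub>C v" for v :: "'b :: complex_vector"
    by (simp add: complex_vector.scale_minus_left)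
  show 2: "pure [- x, z] = - pure [x, z]" "pure [z, - x] = - pure [z, x]" for x
    by (simp_all only: m 1)
  show "pure [x - y, z] = pure [x, z] - pure [y, z]" "pure [z, x - y] = pure [z, x] - pure [z, y]"
    by (simp_all only: diff_conv_add_uminus 1 2)
  show "pure [0, z] = 0" "pure [z, 0] = 0"
    using 1(3)[of 0 0] 1(4)[of 0 0] by simp_all
qed

lift_definition uq_comult :: "uq \<Rightarrow> uq tens" is
  "alg_eval (\<lambda>c. c *\<^sub>C pure [1, 1]) uq_comult_gen"
proof (erule alg_eval_cong[where A = "tensor_power 2"])
  fix s t assume "uq_rel s t"
  then show "alg_eval (\<lambda>c. c *\<^sub>C pure [1, 1]) uq_comult_gen s =
    alg_eval (\<lambda>c. c *\<^sub>C pure [1, 1]) uq_comult_gen t"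
    by (cases rule: uq_rel.cases)
      (simp_all add: times_tens_bilinear pure_times_pure distrib_left distrib_right pure_2 uq_normalize
        mult.assoc power3_eq_cube complex_vector.scale_right_diff_distrib scaleC_add_right
        left_diff_distrib right_diff_distrib)
next
  note sub = complex_vector.subspace_0[OF tensor_power_subspace]
    complex_vector.subspace_add[OF tensor_power_subspace]
    complex_vector.subspace_scale[OF tensor_power_subspace]
  show "uq_comult_gen x \<in> tensor_power 2" for x
    by (cases x) (auto intro!: sub pure_in_tensor_power)
  show "c *\<^sub>C pure [1, 1] \<in> tensor_power 2" for c
    by (intro sub pure_in_tensor_power) simp
  have one: "pure [1, 1] * x = x" "x * pure [1, 1] = x" if "x \<in> tensor_power 2" for x :: "uq tens"
    using tensor_power_one[OF that] by (simp_all add: numeral_2_eq_2)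
  show "1 *\<^sub>C pure [1, 1] * x = x" "x * c *\<^sub>C pure [1, 1] = c *\<^sub>C pure [1, 1] * x"
    if "x \<in> tensor_power 2" for x :: "uq tens" and c
    using one[OF that] by (simp_all add: times_tens_bilinear scaleC_one)
qed (auto simp: scaleC_add_left times_tens_bilinear pure_times_pure scaleC_scaleC
    intro: tensor_power_times complex_vector.subspace_add[OF tensor_power_subspace])

lemma uq_comult:
  "uq_comult (x + y) = uq_comult x + uq_comult y"
  "uq_comult (x * y) = uq_comult x * uq_comult y"
  "uq_comult (c *\<^sub>C x) = c *\<^sub>C uq_comult x"
  "uq_comult 1 = pure [1, 1]"
  "uq_comult uE = pure [1, uE] + pure [uE, uK]"
  "uq_comult uF = pure [uF, 1] + pure [uK ^ 3, uF]"
  "uq_comult uK = pure [uK, uK]"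
  "uq_comult x \<in> tensor_power 2"
proof -
  note sub = complex_vector.subspace_add[OF tensor_power_subspace]
    complex_vector.subspace_scale[OF tensor_power_subspace]
  have gen: "uq_comult_gen g \<in> tensor_power 2" for g
    by (cases g) (auto intro!: sub pure_in_tensor_power)
  have *: "alg_eval (\<lambda>c. c *\<^sub>C pure [1, 1]) uq_comult_gen t \<in> tensor_power 2" for t
    by (induction t) (auto intro!: sub pure_in_tensor_power tensor_power_times gen)
  show "uq_comult x \<in> tensor_power 2"
    by (induction x rule: uq.abs_induct) (simp only: uq_comult.abs_eq *)
  have "pure [1, 1] * z = z" if "z \<in> tensor_power 2" for z :: "uq tens"
    using tensor_power_one(1)[OF that] by (simp add: numeral_2_eq_2)
  with * show "uq_comult (c *\<^sub>C x) = c *\<^sub>C uq_comult x"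
    by (induction x rule: uq.abs_induct)
      (simp add: uq_comult.abs_eq scaleC_uq.abs_eq times_tens_bilinear)
  show "uq_comult (x + y) = uq_comult x + uq_comult y"
    by transfer simp
  show "uq_comult (x * y) = uq_comult x * uq_comult y"
    by transfer simp
  show "uq_comult 1 = pure [1, 1]"
    by transfer (simp add: scaleC_one)
  show "uq_comult uE = pure [1, uE] + pure [uE, uK]"
    "uq_comult uF = pure [uF, 1] + pure [uK ^ 3, uF]"
    "uq_comult uK = pure [uK, uK]"
    using uq_comult.abs_eq[of "Gen GE"] uq_comult.abs_eq[of "Gen GF"] uq_comult.abs_eq[of "Gen GK"]
    unfolding alg_eval.simps uq_comult_gen.simps by (simp_all only: uE_def uF_def uK_def map_fun_apply id_apply)
qed

lemma vectorspace_DY_cohomology_uq: "vectorspace class_ring (DY_cohomology uq_comult n)"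
  by (rule vectorspace_DY_cohomology) (simp_all add: uq_comult)

definition uq_e :: uq where
  "uq_e = (1 / 2) *\<^sub>C (1 - uK ^ 2)"

definition dy_c1 :: "uq tens" where
  "dy_c1 =
    pure [uq_e, uE * uK ^ 2, uE * uK ^ 3]
    - pure [uE, uK * uq_e, uE * uK ^ 3]
    - pure [uE, uE * uK, uq_e]"

definition dy_c2 :: "uq tens" where
  "dy_c2 =
    pure [uq_e, uF * uK ^ 3, uF]
    - pure [uF * uK, uK * uq_e, uF]
    - pure [uF * uK, uF * uK ^ 2, uq_e]"

definition dy_c3 :: "uq tens" where
  "dy_c3 =
    pure [uq_e, uE * uK ^ 2, uF * uK ^ 2]
    - pure [uq_e, uF * uK ^ 3, uE * uK ^ 3]
    + pure [uE * uK ^ 2, uK * uq_e, uF * uK ^ 2]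
    + pure [uF * uK, uK * uq_e, uE * uK ^ 3]
    - pure [uE * uK ^ 2, uF * uK ^ 2, uq_e]
    + pure [uF * uK, uE * uK, uq_e]"

end

theory Submission
  imports Defs
begin

text \<open>Write \<open>G = F K\<close>. Then \<open>E\<close> and \<open>G\<close> are of the same kind: both anticommute with \<open>K\<close>, have
  square \<open>0\<close> and satisfy \<open>\<Delta> h = 1 \<otimes> h + h \<otimes> K\<close>, while \<open>E G + G E = (\<i> / 2) (1 - K\<^sup>2)\<close>. The
  Davydov--Yetter complex consists of the elements of the cobar complex \<open>U\<^sup>\<otimes>\<^sup>n\<close> that commute with
  the iterated coproduct, and the proof compares the two complexes.

  As a coalgebra \<open>U\<close> is an exterior coalgebra on \<open>E\<close> and \<open>G\<close>, extended by the group of powers of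
  \<open>K\<close>. Let the two outer faces \<open>1 \<otimes> x\<close> and \<open>x \<otimes> 1\<close> of the cobar differential be replaced by \<open>K\<^sup>j
  \<otimes> x\<close> and \<open>x \<otimes> K\<^sup>m\<close>. As for the Koszul dual of an exterior algebra, classes of degree \<open>n\<close> are
  forms of degree \<open>n\<close> in \<open>E\<close> and \<open>G\<close>, and each factor raises the power of \<open>K\<close> by one; so the
  cohomology in degree \<open>n\<close> vanishes unless \<open>m = j + n\<close> modulo \<open>4\<close> (\<open>cobar_exact\<close>), and in degree
  \<open>1\<close> with \<open>m = j + 1\<close> it is spanned by \<open>E K\<^sup>j\<close> and \<open>G K\<^sup>j\<close> (\<open>cobar_1_cocycle\<close>).

  Therefore a Davydov--Yetter cocycle \<open>x\<close> of degree \<open>3\<close> is the cobar differential of some \<open>y\<close> in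
  \<open>U \<otimes> U\<close>, and all that matters is how far \<open>y\<close> is from commuting with \<open>\<Delta> E\<close> and \<open>\<Delta> G\<close>. The
  commutator of \<open>\<Delta> h\<close> with \<open>y\<close> is a \<open>2\<close>-cocycle for the twist \<open>m = 1\<close>, so it is the differential
  of an element \<open>b\<^sub>h\<close> of \<open>U\<close>, which can be chosen odd in \<open>E\<close> and \<open>G\<close>. The pair \<open>(b\<^sub>E, b\<^sub>G)\<close> is the
  transgression of \<open>x\<close>. It is determined up to the \<open>1\<close>-cocycles \<open>E\<close>, \<open>G\<close> and up to the
  commutators \<open>([E, a], [G, a])\<close> that come from changing \<open>y\<close> by a differential, and \<open>x\<close> is a
  coboundary exactly when the pair is of this trivial form (\<open>transgresses_coboundary\<close>,
  \<open>coboundary_of_transgresses\<close>).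

  The derivation rule applied to \<open>E\<^sup>2 = G\<^sup>2 = 0\<close> and to \<open>E G + G E\<close> shows that the anticommutators
  \<open>E b\<^sub>E + b\<^sub>E E\<close>, \<open>G b\<^sub>G + b\<^sub>G G\<close> and \<open>E b\<^sub>G + b\<^sub>G E + G b\<^sub>E + b\<^sub>E G\<close> are multiples of \<open>1 - K\<^sup>2\<close>. In the
  \<open>16\<close>-dimensional algebra this leaves, modulo trivial pairs, exactly the pairs \<open>(\<beta> G K\<^sup>2 + \<sigma> E
  K\<^sup>2, \<gamma> E K\<^sup>2 + \<sigma> G K\<^sup>2)\<close> (\<open>transgression_normal_form\<close>, \<open>commutator_even_coords\<close>). Up to nonzero
  factors, \<open>c\<^sub>1\<close>, \<open>c\<^sub>2\<close>, \<open>c\<^sub>3\<close> transgress to the pairs with parameters \<open>\<gamma>\<close>, \<open>\<beta>\<close>, \<open>\<sigma>\<close>.\<close>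

section \<open>A monomial basis of the algebra\<close>

text \<open>Replacing \<open>F\<close> by \<open>G = F K\<close> makes the coproducts of the two odd generators alike, so that
  most arguments treat \<open>E\<close> and \<open>G\<close> at once.\<close>

definition uG :: uq where "uG = uF * uK"

lemma uK_pow_4: "uK ^ 4 = 1"
  by (rule uq_relations)

lemma uK_pow_mod: "uK ^ (j mod 4) = uK ^ j"
proof -
  have "uK ^ j = uK ^ (4 * (j div 4) + j mod 4)" by simp
  also have "\<dots> = uK ^ (j mod 4)" by (simp only: power_add power_mult uK_pow_4) simp
  finally show ?thesis ..
qed

lemma uK_pow_eqI: "i mod 4 = j mod 4 \<Longrightarrow> uK ^ i = uK ^ j"
  by (metis uK_pow_mod)

lemma uF_eq: "uF = uG * uK ^ 3"
proof -
  have "uG * uK ^ 3 = uF * uK ^ 4" by (simp add: uG_def mult.assoc power_numeral_reduce)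
  then show ?thesis by (simp add: uK_pow_4)
qed

lemma uK_uE: "uK * uE = - (uE * uK)" and uK_uG: "uK * uG = - (uG * uK)"
  using uq_relations(1,2) by (simp_all add: uG_def flip: mult.assoc)

lemma uK_pow_uE: "uK ^ j * uE = (-1) ^ j *\<^sub>C (uE * uK ^ j)"
proof (induction j)
  case (Suc j)
  have "uK ^ Suc j * uE = uK * (uK ^ j * uE)" by (simp add: mult.assoc)
  also have "\<dots> = (-1) ^ j *\<^sub>C ((uK * uE) * uK ^ j)" by (simp add: Suc mult_scaleC_right mult.assoc)
  finally show ?case by (simp add: uK_uE mult.assoc)
qed (simp add: scaleC_one)

lemma uK_pow_uG: "uK ^ j * uG = (-1) ^ j *\<^sub>C (uG * uK ^ j)"
proof (induction j)
  case (Suc j)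
  have "uK ^ Suc j * uG = uK * (uK ^ j * uG)" by (simp add: mult.assoc)
  also have "\<dots> = (-1) ^ j *\<^sub>C ((uK * uG) * uK ^ j)" by (simp add: Suc mult_scaleC_right mult.assoc)
  finally show ?case by (simp add: uK_uG mult.assoc)
qed (simp add: scaleC_one)

lemma uE_uE: "uE * uE = 0"
  using uq_relations by (simp add: power2_eq_square)

lemma uG_uG: "uG * uG = 0"
proof -
  have "uG * uG = uF * (uK * uF) * uK" by (simp add: uG_def mult.assoc)
  then show ?thesis by (simp add: uq_normalize mult.assoc) (simp add: uq_normalize flip: mult.assoc)
qed

lemma uG_uE: "uG * uE = (\<i> / 2) *\<^sub>C (1 - uK ^ 2) - uE * uG"
proof -
  have "uE * uG + uG * uE = (uE * uF - uF * uE) * uK"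
    by (simp add: uG_def algebra_simps uK_uE)
  also have "\<dots> = (- \<i> / 2) *\<^sub>C (uK ^ 2 - uK ^ 4)"
    by (simp add: uq_relations(3) mult_scaleC_left left_diff_distrib power_numeral_reduce mult.assoc)
  also have "\<dots> = (\<i> / 2) *\<^sub>C (1 - uK ^ 2)"
    by (simp add: uK_pow_4 complex_vector.scale_right_diff_distrib)
  finally show ?thesis by (simp add: algebra_simps)
qed

type_synonym coefun = "bool \<Rightarrow> bool \<Rightarrow> nat \<Rightarrow> complex"

text \<open>Linear independence of the monomials \<open>E\<^sup>a G\<^sup>b K\<^sup>c\<close> comes from a representation. A function
  \<open>\<phi>\<close> stands for the linear form with value \<open>\<phi> a b c\<close> at \<open>E\<^sup>a G\<^sup>b K\<^sup>c\<close>, and \<open>h\<close> acts by \<open>(h \<phi>)(m) =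
  \<phi> (m h)\<close>. With \<open>c\<close> ranging over all natural numbers \<open>K\<close> is a plain shift, and \<open>K\<^sup>4 = 1\<close> holds
  on functions of period \<open>4\<close> in \<open>c\<close>.\<close>

primrec gen_act :: "uq_gen \<Rightarrow> coefun \<Rightarrow> coefun" where
  "gen_act GK \<phi> = (\<lambda>a b c. \<phi> a b (c + 1))"
| "gen_act GE \<phi> = (\<lambda>a b c. (-1) ^ c *
    (if b then \<i> / 2 * (\<phi> a False c - \<phi> a False (c + 2)) - (if a then 0 else \<phi> True True c)
     else if a then 0 else \<phi> True False c))"
| "gen_act GF \<phi> = (\<lambda>a b c. (-1) ^ c * (if b then 0 else \<phi> a True (c + 3)))"

primrec term_act :: "uq_gen alg_term \<Rightarrow> coefun \<Rightarrow> coefun" where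
  "term_act (Gen x) \<phi> = gen_act x \<phi>"
| "term_act (Scal s) \<phi> = (\<lambda>a b c. s * \<phi> a b c)"
| "term_act (Add s t) \<phi> = (\<lambda>a b c. term_act s \<phi> a b c + term_act t \<phi> a b c)"
| "term_act (Mul s t) \<phi> = term_act s (term_act t \<phi>)"

definition periodic :: "coefun \<Rightarrow> bool" where
  "periodic \<phi> \<longleftrightarrow> (\<forall>a b c. \<phi> a b (c + 4) = \<phi> a b c)"

lemma periodic_term_act: "periodic \<phi> \<Longrightarrow> periodic (term_act t \<phi>)"
proof (induction t arbitrary: \<phi>)
  case (Gen x)
  have *: "\<phi> a b (Suc (Suc (Suc (Suc c)))) = \<phi> a b c" for a b c
    using Gen by (simp add: periodic_def eval_nat_numeral)
  show ?case
    by (cases x) (simp_all add: periodic_def eval_nat_numeral *)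
qed (auto simp: periodic_def)

lemma term_act_add: "term_act t (\<lambda>a b c. \<phi> a b c + \<psi> a b c) = (\<lambda>a b c. term_act t \<phi> a b c + term_act t \<psi> a b c)"
proof (induction t arbitrary: \<phi> \<psi>)
  case (Gen x)
  show ?case by (cases x) (auto simp: algebra_simps fun_eq_iff)
qed (auto simp: algebra_simps)

lemma term_act_scale: "term_act t (\<lambda>a b c. s * \<phi> a b c) = (\<lambda>a b c. s * term_act t \<phi> a b c)"
proof (induction t arbitrary: \<phi>)
  case (Gen x)
  show ?case by (cases x) (auto simp: algebra_simps fun_eq_iff)
qed (auto simp: algebra_simps)

lemma term_act_rel:
  assumes "uq_rel s t" "periodic \<phi>"
  shows "term_act s \<phi> = term_act t \<phi>"
proof -
  have *: "\<phi> a b (Suc (Suc (Suc (Suc c)))) = \<phi> a b c" for a b c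
    using assms(2) by (simp add: periodic_def eval_nat_numeral)
  from assms(1) show ?thesis
    by cases (auto simp: fun_eq_iff eval_nat_numeral * algebra_simps)
qed

lemma term_act_cong:
  assumes "alg_cong uq_rel s t"
  shows "periodic \<phi> \<Longrightarrow> term_act s \<phi> = term_act t \<phi>"
  using assms
proof (induction arbitrary: \<phi>)
  case (ac_rel s t)
  then show ?case by (rule term_act_rel)
qed (auto simp: periodic_term_act term_act_add term_act_scale algebra_simps)

lift_definition uq_act :: "uq \<Rightarrow> coefun \<Rightarrow> coefun" is
  "\<lambda>t \<phi>. if periodic \<phi> then term_act t \<phi> else \<phi>"
  by (auto simp: fun_eq_iff term_act_cong)

lemma uq_act:
  assumes "periodic \<phi>"
  shows "uq_act (x + y) \<phi> = (\<lambda>a b c. uq_act x \<phi> a b c + uq_act y \<phi> a b c)"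
    and "uq_act (s *\<^sub>C x) \<phi> = (\<lambda>a b c. s * uq_act x \<phi> a b c)"
    and "uq_act (x * y) \<phi> = uq_act x (uq_act y \<phi>)"
    and "uq_act 1 \<phi> = \<phi>"
    and "uq_act uE \<phi> = gen_act GE \<phi>" and "uq_act uF \<phi> = gen_act GF \<phi>" and "uq_act uK \<phi> = gen_act GK \<phi>"
    and "periodic (uq_act x \<phi>)"
  using assms by (transfer; simp add: periodic_term_act)+

definition point :: "bool \<Rightarrow> bool \<Rightarrow> nat \<Rightarrow> coefun" where
  "point a b j = (\<lambda>a' b' c. if a' = a \<and> b' = b \<and> c mod 4 = j mod 4 then 1 else 0)"

text \<open>The form \<open>h \<phi>\<close> has value \<open>\<phi> h\<close> at the monomial \<open>1\<close>; for the form \<open>\<phi>\<close> dual to \<open>E\<^sup>a G\<^sup>b K\<^sup>j\<close>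
  this is the coefficient of \<open>h\<close> at that monomial.\<close>

definition coord :: "bool \<Rightarrow> bool \<Rightarrow> nat \<Rightarrow> uq \<Rightarrow> complex" where
  "coord a b j h = uq_act h (point a b j) False False 0"

lemma periodic_point: "periodic (point a b j)"
  by (simp add: periodic_def point_def)

lemma coord_add: "coord a b j (x + y) = coord a b j x + coord a b j y"
  and coord_scale: "coord a b j (s *\<^sub>C x) = s * coord a b j x"
  by (simp_all add: coord_def uq_act periodic_point)

lemma uq_act_uK_pow: "periodic \<phi> \<Longrightarrow> uq_act (uK ^ i) \<phi> = (\<lambda>a b c. \<phi> a b (c + i))"
  by (induction i) (auto simp: uq_act fun_eq_iff)

lemma coord_monomials:
  "coord a b j (uK ^ i) = (if \<not> a \<and> \<not> b \<and> i mod 4 = j mod 4 then 1 else 0)"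
  "coord a b j (uE * uK ^ i) = (if a \<and> \<not> b \<and> i mod 4 = j mod 4 then 1 else 0)"
  "coord a b j (uG * uK ^ i) = (if \<not> a \<and> b \<and> i mod 4 = j mod 4 then 1 else 0)"
  "coord a b j (uE * (uG * uK ^ i)) = (if a \<and> b \<and> i mod 4 = j mod 4 then 1 else 0)"
proof -
  have m: "Suc (Suc (Suc (Suc n))) mod 4 = n mod 4" for n
    by presburger
  have p: "periodic (\<lambda>a' b' c. point a b j a' b' (c + i))"
    unfolding periodic_def
  proof (intro allI)
    fix a' b' c
    have "(c + 4 + i) mod 4 = (c + i) mod 4"
      using mod_add_self2[of "c + i" 4] by (simp add: ac_simps)
    then show "point a b j a' b' (c + 4 + i) = point a b j a' b' (c + i)"
      by (simp only: point_def)
  qed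
  show "coord a b j (uK ^ i) = (if \<not> a \<and> \<not> b \<and> i mod 4 = j mod 4 then 1 else 0)"
    by (simp add: coord_def uq_act_uK_pow periodic_point) (simp add: point_def)
  note s = coord_def uq_act_uK_pow periodic_point uq_act uG_def
  show "coord a b j (uE * uK ^ i) = (if a \<and> \<not> b \<and> i mod 4 = j mod 4 then 1 else 0)"
    by (simp add: s p) (auto simp: point_def)
  show "coord a b j (uG * uK ^ i) = (if \<not> a \<and> b \<and> i mod 4 = j mod 4 then 1 else 0)"
    using p uq_act(8)[OF p, of uK]
    by (simp add: s) (auto simp: point_def m)
  show "coord a b j (uE * (uG * uK ^ i)) = (if a \<and> b \<and> i mod 4 = j mod 4 then 1 else 0)"
    using p uq_act(8)[OF p, of uK] uq_act(8)[OF uq_act(8)[OF p, of uK], of uF]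
    by (simp add: s) (auto simp: point_def m)
qed

definition expansion :: "uq \<Rightarrow> uq" where
  "expansion h = (\<Sum>j<4. coord False False j h *\<^sub>C uK ^ j + coord True False j h *\<^sub>C (uE * uK ^ j)
     + coord False True j h *\<^sub>C (uG * uK ^ j) + coord True True j h *\<^sub>C (uE * (uG * uK ^ j)))"

lemma sum_lessThan_4: "(\<Sum>j<4. f j) = f 0 + f 1 + f 2 + f (3::nat)" for f :: "nat \<Rightarrow> 'a :: comm_monoid_add"
  by (simp add: eval_nat_numeral lessThan_Suc ac_simps)

lemma expansion_linear: "expansion (x + y) = expansion x + expansion y"
  "expansion (s *\<^sub>C x) = s *\<^sub>C expansion x"
  unfolding expansion_def sum_lessThan_4
  by (simp_all add: coord_add coord_scale scaleC_add_left scaleC_add_right scaleC_scaleC algebra_simps)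

definition monomials :: "uq set" where
  "monomials = range (\<lambda>j. uK ^ j) \<union> range (\<lambda>j. uE * uK ^ j) \<union> range (\<lambda>j. uG * uK ^ j)
     \<union> range (\<lambda>j. uE * (uG * uK ^ j))"

lemma expansion_monomial:
  assumes "x \<in> monomials"
  shows "expansion x = x"
proof -
  have sum: "(\<Sum>j<4. (if i mod 4 = j then 1 else 0) *\<^sub>C f j) = f (i mod 4)" for i and f :: "nat \<Rightarrow> uq"
  proof -
    have "(\<Sum>j<4. (if i mod 4 = j then 1 else 0) *\<^sub>C f j) = (\<Sum>j<4. if j = i mod 4 then f j else 0)"
      by (intro sum.cong) (auto simp: scaleC_one)
    then show ?thesis by simp
  qed
  from assms show ?thesis
    unfolding monomials_def
    by (auto simp: expansion_def coord_monomials sum uK_pow_mod)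
qed

lemma generator_times_monomial:
  "uK * uK ^ j = uK ^ Suc j" "uK * (uE * uK ^ j) = - (uE * uK ^ Suc j)"
  "uK * (uG * uK ^ j) = - (uG * uK ^ Suc j)" "uK * (uE * (uG * uK ^ j)) = uE * (uG * uK ^ Suc j)"
  "uE * (uE * z) = 0" "uG * (uG * z) = 0"
  "uG * (uE * uK ^ j) = (\<i> / 2) *\<^sub>C (uK ^ j - uK ^ (j + 2)) - uE * (uG * uK ^ j)"
  "uG * (uE * (uG * uK ^ j)) = (\<i> / 2) *\<^sub>C (uG * uK ^ j - uG * uK ^ (j + 2))"
proof -
  have K: "uK * (uE * z) = - (uE * (uK * z))" "uK * (uG * z) = - (uG * (uK * z))" for z
    by (simp_all flip: mult.assoc add: uK_uE uK_uG)
  show "uK * uK ^ j = uK ^ Suc j" "uK * (uE * uK ^ j) = - (uE * uK ^ Suc j)"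
    "uK * (uG * uK ^ j) = - (uG * uK ^ Suc j)" "uK * (uE * (uG * uK ^ j)) = uE * (uG * uK ^ Suc j)"
    by (simp_all add: K)
  show EE: "uE * (uE * z) = 0" and GG: "uG * (uG * z) = 0" for z
    by (simp_all flip: mult.assoc add: uE_uE uG_uG)
  have GE: "uG * (uE * z) = (\<i> / 2) *\<^sub>C (z - uK ^ 2 * z) - uE * (uG * z)" for z
    by (simp flip: mult.assoc add: uG_uE left_diff_distrib mult_scaleC_left)
  show "uG * (uE * uK ^ j) = (\<i> / 2) *\<^sub>C (uK ^ j - uK ^ (j + 2)) - uE * (uG * uK ^ j)"
    by (simp only: GE add.commute[of j] power_add)
  have "uK ^ 2 * (uG * uK ^ j) = uG * uK ^ (j + 2)"
    by (simp add: power2_eq_square K mult.assoc)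
  then show "uG * (uE * (uG * uK ^ j)) = (\<i> / 2) *\<^sub>C (uG * uK ^ j - uG * uK ^ (j + 2))"
    by (simp only: GE GG) simp
qed

lemma left_mult_monomials:
  assumes "x \<in> complex_vector.span monomials" "g \<in> {uE, uG, uK}"
  shows "g * x \<in> complex_vector.span monomials"
  using assms(1)
proof (induction rule: complex_vector.span_induct_alt)
  case base
  then show ?case by (simp add: complex_vector.span_zero)
next
  case (step c x y)
  have mon: "uK ^ j \<in> complex_vector.span monomials" "uE * uK ^ j \<in> complex_vector.span monomials"
    "uG * uK ^ j \<in> complex_vector.span monomials" "uE * (uG * uK ^ j) \<in> complex_vector.span monomials" for j
    unfolding monomials_def by (auto intro!: complex_vector.span_base)
  have "g * x \<in> complex_vector.span monomials"
    using step(1) assms(2) unfolding monomials_def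
    by (auto simp only: Un_iff image_iff insert_iff empty_iff generator_times_monomial
        intro!: mon[unfolded monomials_def] complex_vector.span_zero complex_vector.span_neg
          complex_vector.span_scale complex_vector.span_diff)
  with step show ?case
    by (auto simp: distrib_left mult_scaleC_right
        intro!: complex_vector.span_add complex_vector.span_scale)
qed

text \<open>The span of the monomials contains \<open>1\<close> and is closed under left multiplication by the
  generators.\<close>

lemma monomials_span: "complex_vector.span monomials = UNIV"
proof -
  let ?S = "complex_vector.span monomials"
  have "abs_uq t * x \<in> ?S" if "x \<in> ?S" for t x
    using that
  proof (induction t arbitrary: x)
    case (Gen g)
    have "uF * x = uG * (uK * (uK * (uK * x)))" by (simp add: uF_eq mult.assoc power3_eq_cube)
    moreover have "abs_uq (Gen GE) = uE" "abs_uq (Gen GF) = uF" "abs_uq (Gen GK) = uK"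
      by (simp_all add: uE_def uF_def uK_def)
    ultimately show ?case
      using Gen by (cases g) (simp_all add: left_mult_monomials)
  next
    case (Scal c)
    have "abs_uq (Scal c) = c *\<^sub>C 1"
      unfolding one_uq_def scaleC_uq.abs_eq uq.abs_eq_iff
      by (meson ac_Mul_one ac_Scal_central ac_trans ac_sym)
    then show ?case using Scal by (simp add: mult_scaleC_left complex_vector.span_scale)
  next
    case (Add s t)
    then show ?case by (simp flip: plus_uq.abs_eq add: distrib_right complex_vector.span_add)
  next
    case (Mul s t)
    then show ?case by (simp flip: times_uq.abs_eq add: mult.assoc)
  qed
  moreover have "1 \<in> ?S"
    by (intro complex_vector.span_base) (auto simp: monomials_def intro: range_eqI[of _ _ 0])
  ultimately have "abs_uq t * 1 \<in> ?S" for t by blast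
  then have "h \<in> ?S" for h by (induction h rule: uq.abs_induct) simp
  then show ?thesis by blast
qed

lemma expansion_eq: "expansion h = h"
proof -
  have "h \<in> complex_vector.span monomials" by (simp add: monomials_span)
  then show ?thesis
  proof (induction rule: complex_vector.span_induct_alt)
    case base
    show ?case using expansion_linear(2)[of 0 0] by simp
  next
    case (step c x y)
    then show ?case by (simp add: expansion_linear expansion_monomial)
  qed
qed

section \<open>Tensor powers and contraction of the first factor\<close>

lemma tensor_assoc: "(x \<otimes>\<^sub>T y) \<otimes>\<^sub>T z = x \<otimes>\<^sub>T (y \<otimes>\<^sub>T z)"
proof (induction x)
  case (pure xs)
  show ?case
  proof (induction y)
    case (pure ys)
    show ?case
      by (induction z) (simp_all add: tensor_pure tensor_add_right tensor_scale_right tensor_zero_right)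
  qed (simp_all add: tensor_add_right tensor_scale_right tensor_zero_right
      tensor_add_left tensor_scale_left tensor_zero_left)
qed (simp_all add: tensor_add_left tensor_scale_left tensor_zero_left)

lemma tensor_unit: "pure [] \<otimes>\<^sub>T x = x" "x \<otimes>\<^sub>T pure [] = x"
  by (induction x; simp add: tensor_pure tensor_add_right tensor_scale_right tensor_zero_right
      tensor_add_left tensor_scale_left tensor_zero_left)+

lemma tensor_minus: "(- x) \<otimes>\<^sub>T y = - (x \<otimes>\<^sub>T y)" "y \<otimes>\<^sub>T (- x) = - (y \<otimes>\<^sub>T x)"
  "(x - z) \<otimes>\<^sub>T y = x \<otimes>\<^sub>T y - z \<otimes>\<^sub>T y" "y \<otimes>\<^sub>T (x - z) = y \<otimes>\<^sub>T x - y \<otimes>\<^sub>T z"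
proof -
  show 1: "(- x) \<otimes>\<^sub>T y = - (x \<otimes>\<^sub>T y)" "y \<otimes>\<^sub>T (- x) = - (y \<otimes>\<^sub>T x)" for x
    using tensor_scale_left[of "-1" x y] tensor_scale_right[of y "-1" x] by simp_all
  show "(x - z) \<otimes>\<^sub>T y = x \<otimes>\<^sub>T y - z \<otimes>\<^sub>T y" "y \<otimes>\<^sub>T (x - z) = y \<otimes>\<^sub>T x - y \<otimes>\<^sub>T z"
    by (simp_all add: diff_conv_add_uminus tensor_add_left tensor_add_right 1
        del: add_uminus_conv_diff)
qed

lemmas tensor_bilinear = tensor_add_left tensor_add_right tensor_scale_left tensor_scale_right
  tensor_zero_left tensor_zero_right tensor_minus

lemma pure_1: "pure [x + y] = pure [x] + pure [y]" "pure [c *\<^sub>C x] = c *\<^sub>C pure [x]"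
  "pure [- x] = - pure [x]" "pure [x - y] = pure [x] - pure [y]" "pure [0 :: 'a] = 0"
  for x y :: "'a :: complex_vector"
proof -
  show 1: "pure [x + y] = pure [x] + pure [y]" "pure [c *\<^sub>C x] = c *\<^sub>C pure [x]" for x y :: 'a and c
    using pure_add[of "[]" x y "[]"] pure_scale[of "[]" c x "[]"] by simp_all
  show 2: "pure [0 :: 'a] = 0" "pure [- x] = - pure [x]" for x :: 'a
    using 1(2)[of 0 0] 1(2)[of "-1" x] by simp_all
  show "pure [x - y] = pure [x] - pure [y]"
    using 1(1)[of x "- y"] 2 by simp
qed

lemma tensor_power_add: "x \<in> tensor_power n \<Longrightarrow> y \<in> tensor_power n \<Longrightarrow> x + y \<in> tensor_power n"
  and tensor_power_scale: "x \<in> tensor_power n \<Longrightarrow> c *\<^sub>C x \<in> tensor_power n"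
  and tensor_power_zero: "0 \<in> tensor_power n"
  and tensor_power_neg: "x \<in> tensor_power n \<Longrightarrow> - x \<in> tensor_power n"
  and tensor_power_diff: "x \<in> tensor_power n \<Longrightarrow> y \<in> tensor_power n \<Longrightarrow> x - y \<in> tensor_power n"
  using tensor_power_subspace
  by (auto intro: complex_vector.subspace_add complex_vector.subspace_scale complex_vector.subspace_0
      complex_vector.subspace_neg complex_vector.subspace_diff)

lemmas tensor_power_intros = tensor_power_add tensor_power_scale tensor_power_zero tensor_power_neg
  tensor_power_diff

lemma tensor_power_pure_induct [consumes 1, case_names pure zero add scale]:
  assumes "x \<in> tensor_power n"
    and "\<And>xs. length xs = n \<Longrightarrow> P (pure xs)" "P 0" "\<And>x y. P x \<Longrightarrow> P y \<Longrightarrow> P (x + y)" "\<And>c x. P x \<Longrightarrow> P (c *\<^sub>C x)"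
  shows "P x"
  using assms(1) unfolding tensor_power_def
proof (induction rule: complex_vector.span_induct_alt)
  case (step c x y)
  then show ?case using assms(2) by (auto intro!: assms(4,5))
qed (rule assms(3))

lemma tensor_in_tensor_power:
  assumes "x \<in> tensor_power m" "y \<in> tensor_power n"
  shows "x \<otimes>\<^sub>T y \<in> tensor_power (m + n)"
  using assms(1)
proof (induction rule: tensor_power_pure_induct)
  case (pure xs)
  with assms(2) show ?case
    by (induction rule: tensor_power_pure_induct)
      (auto simp: tensor_pure tensor_bilinear intro!: pure_in_tensor_power tensor_power_intros)
qed (auto simp: tensor_bilinear intro!: tensor_power_intros)

lemma tensor_power_Suc_induct [consumes 1, case_names tensor zero add]:
  assumes "x \<in> tensor_power (Suc n)"
    and "\<And>h y. y \<in> tensor_power n \<Longrightarrow> P (pure [h] \<otimes>\<^sub>T y)" "P 0" "\<And>x y. P x \<Longrightarrow> P y \<Longrightarrow> P (x + y)"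
  shows "P x"
  using assms(1) unfolding tensor_power_def
proof (induction rule: complex_vector.span_induct_alt)
  case (step c x y)
  then obtain h xs where xs: "x = pure (h # xs)" "length xs = n"
    by (auto simp: length_Suc_conv)
  then have "c *\<^sub>C x = pure [h] \<otimes>\<^sub>T (c *\<^sub>C pure xs)"
    by (simp add: tensor_bilinear tensor_pure)
  moreover have "P (pure [h] \<otimes>\<^sub>T (c *\<^sub>C pure xs))"
    using xs by (intro assms(2) tensor_power_scale pure_in_tensor_power)
  ultimately show ?case using step assms(4) by simp
qed (rule assms(3))

lemma tensor_power_0E:
  assumes "x \<in> tensor_power 0"
  obtains s where "x = s *\<^sub>C pure []"
proof -
  have "\<exists>s. x = s *\<^sub>C pure []"
    using assms
  proof (induction rule: tensor_power_pure_induct)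
    case (pure xs)
    then show ?case by (intro exI[of _ 1]) (simp add: scaleC_one)
  next
    case zero
    show ?case by (intro exI[of _ 0]) simp
  next
    case (add x y)
    then show ?case by (metis scaleC_add_left)
  next
    case (scale c x)
    then show ?case by (metis scaleC_scaleC)
  qed
  then show thesis using that by blast
qed

lemma tensor_power_1E:
  assumes "x \<in> tensor_power (Suc 0)"
  obtains h where "x = pure [h]"
proof -
  have "\<exists>h. x = pure [h]"
    using assms
  proof (induction rule: tensor_power_Suc_induct)
    case (tensor h y)
    then obtain s where "y = s *\<^sub>C pure []" using tensor_power_0E by blast
    then have "pure [h] \<otimes>\<^sub>T y = pure [s *\<^sub>C h]" by (simp add: pure_1 tensor_unit tensor_bilinear)
    then show ?case by blast
  qed (metis pure_1)+
  then show thesis using that by blast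
qed

text \<open>Contraction of the first tensor factor with a linear form. It recovers the components of a
  tensor along a basis in the first factor, and it is a homotopy operator on the cobar complex.\<close>

definition contract :: "(uq \<Rightarrow> complex) \<Rightarrow> uq tens \<Rightarrow> uq tens" where
  "contract f = lin_ext (\<lambda>xs. case xs of [] \<Rightarrow> 0 | h # hs \<Rightarrow> f h *\<^sub>C pure hs)"

definition functional :: "(uq \<Rightarrow> complex) \<Rightarrow> bool" where
  "functional f \<longleftrightarrow> (\<forall>x y. f (x + y) = f x + f y) \<and> (\<forall>c x. f (c *\<^sub>C x) = c * f x)"

lemma functional_coord: "functional (coord a b j)"
  by (simp add: functional_def coord_add coord_scale)

lemma functional_simps:
  assumes "functional f"
  shows "f (x + y) = f x + f y" "f (c *\<^sub>C x) = c * f x" "f 0 = 0" "f (- x) = - f x" "f (x - y) = f x - f y"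
proof -
  show 1: "f (x + y) = f x + f y" "f (c *\<^sub>C x) = c * f x" for x y c
    using assms by (auto simp: functional_def)
  show 2: "f 0 = 0" "f (- x) = - f x" for x
    using 1(2)[of 0 0] 1(2)[of "-1" x] by simp_all
  show "f (x - y) = f x - f y" using 1(1)[of x "- y"] 2 by simp
qed

lemmas coord_linear = functional_simps[OF functional_coord]

lemma
  assumes f: "functional f"
  shows contract_tensor: "contract f (pure [h] \<otimes>\<^sub>T x) = f h *\<^sub>C x"
    and contract_add: "contract f (u + v) = contract f u + contract f v"
    and contract_scale: "contract f (c *\<^sub>C u) = c *\<^sub>C contract f u"
    and contract_zero: "contract f 0 = 0"
    and contract_neg: "contract f (- u) = - contract f u"
    and contract_diff: "contract f (u - v) = contract f u - contract f v"
proof -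
  let ?F = "\<lambda>xs. case xs of [] \<Rightarrow> 0 | h # hs \<Rightarrow> f h *\<^sub>C pure hs"
  have sl: "slotwise_linear ?F"
  proof (rule slotwise_linearI)
    show "?F (xs @ (x + y) # ys) = ?F (xs @ x # ys) + ?F (xs @ y # ys)" for xs x y ys
      by (cases xs) (simp_all add: functional_simps[OF f] scaleC_add_left pure_add scaleC_add_right)
    show "?F (xs @ (c *\<^sub>C x) # ys) = c *\<^sub>C ?F (xs @ x # ys)" for xs c x ys
      by (cases xs) (simp_all add: functional_simps[OF f] scaleC_scaleC pure_scale mult.commute)
  qed
  note l = lin_ext_pure[OF sl] lin_ext_zero[OF sl] lin_ext_add[OF sl] lin_ext_scale[OF sl]
  show 1: "contract f (u + v) = contract f u + contract f v"
    "contract f (c *\<^sub>C u) = c *\<^sub>C contract f u" "contract f 0 = 0" for u v c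
    by (simp_all add: contract_def l)
  show 2: "contract f (- u) = - contract f u" for u using 1(2)[of "-1" u] by simp
  show "contract f (u - v) = contract f u - contract f v" using 1(1)[of u "- v"] 2 by simp
  show "contract f (pure [h] \<otimes>\<^sub>T x) = f h *\<^sub>C x"
    by (induction x)
      (simp_all add: tensor_bilinear 1 tensor_pure scaleC_add_right scaleC_scaleC mult.commute,
       simp add: contract_def l)
qed

lemmas contract_linear = contract_add contract_scale contract_zero contract_neg contract_diff

lemmas contract_coord = contract_linear[OF functional_coord] contract_tensor[OF functional_coord]

lemma contract_tensor_left:
  assumes f: "functional f" and "u \<in> tensor_power (Suc m)"
  shows "contract f (u \<otimes>\<^sub>T x) = contract f u \<otimes>\<^sub>T x"
  using assms(2)
  by (induction rule: tensor_power_Suc_induct)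
    (simp_all add: tensor_assoc tensor_bilinear contract_linear[OF f] contract_tensor[OF f])

lemma contract_in_tensor_power:
  assumes f: "functional f" and "x \<in> tensor_power (Suc n)"
  shows "contract f x \<in> tensor_power n"
  using assms(2)
  by (induction rule: tensor_power_Suc_induct)
    (simp_all add: contract_linear[OF f] contract_tensor[OF f] tensor_power_intros)

lemma pure_1_eq_iff: "pure [x] = pure [y] \<longleftrightarrow> x = y" for x y :: uq
proof
  let ?F = "\<lambda>xs :: uq list. if length xs = 1 then hd xs else 0"
  have sl: "slotwise_linear ?F"
  proof (rule slotwise_linearI)
    show "?F (xs @ (x + y) # ys) = ?F (xs @ x # ys) + ?F (xs @ y # ys)" for xs x y ys
      by (cases xs) simp_all
    show "?F (xs @ (c *\<^sub>C x) # ys) = c *\<^sub>C ?F (xs @ x # ys)" for xs c x ys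
      by (cases xs) simp_all
  qed
  assume "pure [x] = pure [y]"
  then show "x = y" using lin_ext_pure[OF sl, of "[x]"] lin_ext_pure[OF sl, of "[y]"] by simp
qed simp

lemmas comult_at_uq_linear =
  comult_at_add[of uq_comult, OF uq_comult(1,3)] comult_at_scale[of uq_comult, OF uq_comult(1,3)]
  comult_at_zero[of uq_comult, OF uq_comult(1,3)]

lemma comult_at_tensor:
  "comult_at uq_comult (Suc 0) (pure [h] \<otimes>\<^sub>T x) = uq_comult h \<otimes>\<^sub>T x"
  "1 \<le> i \<Longrightarrow> comult_at uq_comult (Suc i) (pure [h] \<otimes>\<^sub>T x) = pure [h] \<otimes>\<^sub>T comult_at uq_comult i x"
proof -
  note p = comult_at_pure[of uq_comult, OF uq_comult(1,3)]
  have z: "comult_at uq_comult i (pure xs) = 0" if "\<not> (1 \<le> i \<and> i \<le> length xs)" for i xs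
    unfolding comult_at_def
    using lin_ext_pure[OF slotwise_linear_comult_at[of uq_comult i, OF uq_comult(1,3)], of xs] that
    by auto
  show "comult_at uq_comult (Suc 0) (pure [h] \<otimes>\<^sub>T x) = uq_comult h \<otimes>\<^sub>T x"
    by (induction x) (simp_all add: tensor_bilinear comult_at_uq_linear tensor_pure p tensor_unit)
  show "comult_at uq_comult (Suc i) (pure [h] \<otimes>\<^sub>T x) = pure [h] \<otimes>\<^sub>T comult_at uq_comult i x" if i: "1 \<le> i"
  proof (induction x)
    case (pure xs)
    show ?case
    proof (cases "i \<le> length xs")
      case True
      obtain k where "i = Suc k" using i by (cases i) auto
      with True show ?thesis
        by (simp add: tensor_pure p flip: tensor_assoc)
    next
      case False
      then show ?thesis by (simp add: z tensor_pure tensor_bilinear)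
    qed
  qed (simp_all add: tensor_bilinear comult_at_uq_linear)
qed

section \<open>The cobar complex with group-like twists\<close>

text \<open>The cobar complex of \<open>U\<close> with group-like elements \<open>l\<close> and \<open>g\<close> in the two outer faces; \<open>l =
  g = 1\<close> gives the Davydov--Yetter differential. The left twist has to vary because splitting
  off a first factor \<open>E\<close> leaves a cochain whose left twist is multiplied by \<open>K\<close>.\<close>

definition cobar :: "uq \<Rightarrow> uq \<Rightarrow> nat \<Rightarrow> uq tens \<Rightarrow> uq tens" where
  "cobar l g n x = pure [l] \<otimes>\<^sub>T x + (\<Sum>i = 1..n. (-1) ^ i *\<^sub>C comult_at uq_comult i x)
     + (-1) ^ (n + 1) *\<^sub>C (x \<otimes>\<^sub>T pure [g])"

lemma DY_diff_eq_cobar: "DY_diff uq_comult n = cobar 1 1 n"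
  by (simp add: fun_eq_iff DY_diff_def cobar_def)

lemma cobar_linear:
  "cobar l g n (x + y) = cobar l g n x + cobar l g n y" "cobar l g n (c *\<^sub>C x) = c *\<^sub>C cobar l g n x"
  "cobar l g n 0 = 0" "cobar l g n (- x) = - cobar l g n x"
      "cobar l g n (x - y) = cobar l g n x - cobar l g n y"
proof -
  show 1: "cobar l g n (x + y) = cobar l g n x + cobar l g n y"
    "cobar l g n (c *\<^sub>C x) = c *\<^sub>C cobar l g n x" for x y c
    by (simp_all add: cobar_def comult_at_uq_linear tensor_bilinear sum.distrib scaleC_add_right
        complex_vector.scale_sum_right scaleC_scaleC mult.commute algebra_simps)
  show 2: "cobar l g n 0 = 0" "cobar l g n (- x) = - cobar l g n x" for x
    using 1(2)[of 0 0] 1(2)[of "-1" x] by simp_all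
  show "cobar l g n (x - y) = cobar l g n x - cobar l g n y" using 1(1)[of x "- y"] 2 by simp
qed

lemma cobar_0: "cobar l g 0 (s *\<^sub>C pure []) = pure [s *\<^sub>C (l - g)]"
  by (simp add: cobar_def tensor_bilinear tensor_unit pure_1 complex_vector.scale_right_diff_distrib)

lemma cobar_1: "cobar l g (Suc 0) (pure [h]) = pure [l, h] - uq_comult h + pure [h, g]"
  using comult_at_tensor(1)[of h "pure []"]
  by (simp add: cobar_def tensor_unit tensor_pure scaleC_one)

text \<open>The two occurrences of \<open>k\<close> cancel, so \<open>k\<close> is free. For \<open>h\<close> with \<open>\<Delta> h = l \<otimes> h + h \<otimes> k\<close> the
  first summand vanishes, and tensoring with \<open>h\<close> anticommutes with the differentials.\<close>

lemma cobar_tensor: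
  "cobar l g (Suc n) (pure [h] \<otimes>\<^sub>T x) =
     (pure [l, h] - uq_comult h + pure [h, k]) \<otimes>\<^sub>T x - pure [h] \<otimes>\<^sub>T cobar k g n x"
proof -
  have "(\<Sum>i = 1..Suc n. (-1) ^ i *\<^sub>C comult_at uq_comult i (pure [h] \<otimes>\<^sub>T x)) =
      - (uq_comult h \<otimes>\<^sub>T x) + (\<Sum>i = 1..n. (-1) ^ Suc i *\<^sub>C comult_at uq_comult (Suc i) (pure [h] \<otimes>\<^sub>T x))"
  proof -
    have split: "sum f {1..Suc n} = f 1 + (\<Sum>i = 1..n. f (Suc i))" for f :: "nat \<Rightarrow> uq tens"
      by (induction n) (simp_all add: add.assoc)
    show ?thesis by (subst split) (simp add: comult_at_tensor scaleC_one)
  qed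
  also have "(\<Sum>i = 1..n. (-1) ^ Suc i *\<^sub>C comult_at uq_comult (Suc i) (pure [h] \<otimes>\<^sub>T x)) =
      - (pure [h] \<otimes>\<^sub>T (\<Sum>i = 1..n. (-1) ^ i *\<^sub>C comult_at uq_comult i x))"
  proof -
    have sum: "pure [h] \<otimes>\<^sub>T (\<Sum>i\<in>A. f i) = (\<Sum>i\<in>A. pure [h] \<otimes>\<^sub>T f i)" for f :: "nat \<Rightarrow> uq tens" and A
      by (induction A rule: infinite_finite_induct) (simp_all add: tensor_bilinear)
    show ?thesis
      unfolding sum sum_negf[symmetric]
      by (intro sum.cong) (simp_all add: comult_at_tensor tensor_bilinear)
  qed
  finally show ?thesis
    unfolding cobar_def
    by (simp add: tensor_bilinear tensor_assoc algebra_simps flip: tensor_pure[of "[_]" "[_]", simplified])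
qed

lemma comult_monomials:
  "uq_comult (uK ^ j) = pure [uK ^ j, uK ^ j]"
  "uq_comult (uE * uK ^ j) = pure [uK ^ j, uE * uK ^ j] + pure [uE * uK ^ j, uK ^ Suc j]"
  "uq_comult (uG * uK ^ j) = pure [uK ^ j, uG * uK ^ j] + pure [uG * uK ^ j, uK ^ Suc j]"
  "uq_comult (uE * (uG * uK ^ j)) = pure [uK ^ j, uE * (uG * uK ^ j)] + pure [uG * uK ^ j, uE * uK ^ Suc j]
     - pure [uE * uK ^ j, uG * uK ^ Suc j] + pure [uE * (uG * uK ^ j), uK ^ (j + 2)]"
proof -
  show K: "uq_comult (uK ^ j) = pure [uK ^ j, uK ^ j]" for j
    by (induction j) (simp_all add: uq_comult pure_times_pure)
  show "uq_comult (uE * uK ^ j) = pure [uK ^ j, uE * uK ^ j] + pure [uE * uK ^ j, uK ^ Suc j]"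
    by (simp add: uq_comult K times_tens_bilinear pure_times_pure)
  have "uK ^ 3 * uK = 1" using uK_pow_4 by (simp add: power_numeral_reduce mult.assoc)
  then have "uq_comult uG = pure [1, uG] + pure [uG, uK]"
    by (simp add: uG_def uq_comult times_tens_bilinear pure_times_pure)
  then show G: "uq_comult (uG * uK ^ j) = pure [uK ^ j, uG * uK ^ j] + pure [uG * uK ^ j, uK ^ Suc j]"
    by (simp add: uq_comult K times_tens_bilinear pure_times_pure)
  have KG: "uK * (uG * z) = - (uG * (uK * z))" for z
    by (simp flip: mult.assoc add: uK_uG)
  show "uq_comult (uE * (uG * uK ^ j)) = pure [uK ^ j, uE * (uG * uK ^ j)] + pure [uG * uK ^ j, uE * uK ^ Suc j]
     - pure [uE * uK ^ j, uG * uK ^ Suc j] + pure [uE * (uG * uK ^ j), uK ^ (j + 2)]"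
    by (simp only: uq_comult(2)[of uE] uq_comult(5) G)
      (simp add: times_tens_bilinear pure_times_pure KG pure_2 algebra_simps)
qed

lemma uq_monomial_induct [case_names K E G EG add scale]:
  assumes "\<And>j. P (uK ^ j)" "\<And>j. P (uE * uK ^ j)" "\<And>j. P (uG * uK ^ j)" "\<And>j. P (uE * (uG * uK ^ j))"
    and "\<And>x y. P x \<Longrightarrow> P y \<Longrightarrow> P (x + y)" "\<And>c x. P x \<Longrightarrow> P (c *\<^sub>C x)"
  shows "P h"
proof -
  have "h \<in> complex_vector.span monomials" by (simp add: monomials_span)
  then show ?thesis
  proof (induction rule: complex_vector.span_induct_alt)
    case base
    show ?case using assms(6)[OF assms(1), of 0 0] by simp
  next
    case (step c x y)
    then show ?case by (auto simp: monomials_def intro!: assms)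
  qed
qed

text \<open>Contracting the left leg of the coproduct is an action of the dual algebra: the form dual
  to \<open>K\<^sup>j\<close> acts as the projection to the monomials with \<open>c = j\<close>, and the other forms lower the
  degree in \<open>E\<close> and \<open>G\<close>.\<close>

lemma contract_comult:
  "contract (coord False False j) (uq_comult h) = pure [coord False False j h *\<^sub>C uK ^ j
     + coord True False j h *\<^sub>C (uE * uK ^ j) + coord False True j h *\<^sub>C (uG * uK ^ j)
     + coord True True j h *\<^sub>C (uE * (uG * uK ^ j))]"
  "contract (coord True False j) (uq_comult h) =
     pure [coord True False j h *\<^sub>C uK ^ Suc j - coord True True j h *\<^sub>C (uG * uK ^ Suc j)]"
  "contract (coord False True j) (uq_comult h) =
     pure [coord False True j h *\<^sub>C uK ^ Suc j + coord True True j h *\<^sub>C (uE * uK ^ Suc j)]"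
  "contract (coord True True j) (uq_comult h) = pure [coord True True j h *\<^sub>C uK ^ (j + 2)]"
proof -
  have K: "uK ^ i = uK ^ j \<and> uK ^ Suc i = uK ^ Suc j \<and> uK ^ (i + 2) = uK ^ (j + 2)" if "i mod 4 = j mod 4" for i
    using uK_pow_eqI[OF that] by (simp add: power_add)
  have p: "contract f (pure [a, b]) = f a *\<^sub>C pure [b]" if "functional f" for f a b
    using contract_tensor[OF that, of a "pure [b]"] by (simp add: tensor_pure)
  note s = comult_monomials coord_monomials contract_coord p[OF functional_coord]
    uq_comult(1,3) coord_linear pure_1 scaleC_add_left scaleC_add_right scaleC_scaleC scaleC_one
  show "contract (coord False False j) (uq_comult h) = pure [coord False False j h *\<^sub>C uK ^ j
     + coord True False j h *\<^sub>C (uE * uK ^ j) + coord False True j h *\<^sub>C (uG * uK ^ j)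
     + coord True True j h *\<^sub>C (uE * (uG * uK ^ j))]"
    by (induction h rule: uq_monomial_induct) (auto simp: s simp del: power_Suc dest!: K)
  show "contract (coord True False j) (uq_comult h) =
     pure [coord True False j h *\<^sub>C uK ^ Suc j - coord True True j h *\<^sub>C (uG * uK ^ Suc j)]"
    by (induction h rule: uq_monomial_induct)
      (auto simp: s complex_vector.scale_right_diff_distrib simp del: power_Suc dest!: K)
  show "contract (coord False True j) (uq_comult h) =
     pure [coord False True j h *\<^sub>C uK ^ Suc j + coord True True j h *\<^sub>C (uE * uK ^ Suc j)]"
    by (induction h rule: uq_monomial_induct) (auto simp: s simp del: power_Suc dest!: K)
  show "contract (coord True True j) (uq_comult h) = pure [coord True True j h *\<^sub>C uK ^ (j + 2)]"
    by (induction h rule: uq_monomial_induct) (auto simp: s simp del: power_Suc dest!: K)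
qed

section \<open>Cohomology of the cobar complex\<close>

text \<open>By the first identity, contraction with the form dual to \<open>K\<^sup>j\<close> is a homotopy from the
  identity to the part of \<open>x\<close> with first factor \<open>E K\<^sup>j\<close>, \<open>G K\<^sup>j\<close> or \<open>E G K\<^sup>j\<close>. The other three
  identities are the equations which the components \<open>a\<close>, \<open>b\<close>, \<open>c\<close> of that part satisfy when \<open>x\<close>
  is a cocycle.\<close>

lemma contract_cobar:
  fixes j :: nat and x :: "uq tens"
  assumes "x \<in> tensor_power (Suc n)"
  defines "a \<equiv> contract (coord True False j) x" and "b \<equiv> contract (coord False True j) x"
    and "c \<equiv> contract (coord True True j) x" and "k \<equiv> contract (coord False False j) x"
  shows "contract (coord False False j) (cobar (uK ^ j) g (Suc n) x) =
      x - pure [uE * uK ^ j] \<otimes>\<^sub>T a - pure [uG * uK ^ j] \<otimes>\<^sub>T b - pure [uE * (uG * uK ^ j)] \<otimes>\<^sub>T c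
      - cobar (uK ^ j) g n k"
    and "contract (coord True False j) (cobar (uK ^ j) g (Suc n) x) =
      pure [uG * uK ^ Suc j] \<otimes>\<^sub>T c - cobar (uK ^ Suc j) g n a"
    and "contract (coord False True j) (cobar (uK ^ j) g (Suc n) x) =
      - (pure [uE * uK ^ Suc j] \<otimes>\<^sub>T c) - cobar (uK ^ Suc j) g n b"
    and "contract (coord True True j) (cobar (uK ^ j) g (Suc n) x) = - cobar (uK ^ (j + 2)) g n c"
proof -
  have *: "contract f (cobar l g (Suc n) (pure [h] \<otimes>\<^sub>T y)) =
      f l *\<^sub>C (pure [h] \<otimes>\<^sub>T y) - contract f (uq_comult h) \<otimes>\<^sub>T y + f h *\<^sub>C (pure [k] \<otimes>\<^sub>T y)
      - f h *\<^sub>C cobar k g n y" if f: "functional f" for f l h k y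
  proof -
    have "uq_comult h \<in> tensor_power (Suc (Suc 0))"
      using uq_comult(8)[of h] by (simp add: numeral_2_eq_2)
    then show ?thesis
      unfolding cobar_tensor[of l g n h y k]
      by (simp add: contract_linear[OF f] contract_tensor[OF f] tensor_bilinear tensor_assoc
          contract_tensor_left[OF f] flip: tensor_pure[of "[_]" "[_]", simplified])
  qed
  note linear = tensor_bilinear cobar_linear contract_coord pure_1 algebra_simps scaleC_add_left scaleC_add_right
    complex_vector.scale_right_diff_distrib
  note s = contract_comult coord_monomials[of _ _ _ j, simplified] scaleC_one
  show "contract (coord False False j) (cobar (uK ^ j) g (Suc n) x) =
      x - pure [uE * uK ^ j] \<otimes>\<^sub>T a - pure [uG * uK ^ j] \<otimes>\<^sub>T b - pure [uE * (uG * uK ^ j)] \<otimes>\<^sub>T c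
      - cobar (uK ^ j) g n k"
    using assms(1) unfolding a_def b_def c_def k_def
  proof (induction rule: tensor_power_Suc_induct)
    case (tensor h y)
    show ?case by (simp only: s *[OF functional_coord, where k = "uK ^ j"])
        (simp add: coord_monomials linear scaleC_one)
  next
    case (add x y)
    show ?case by (simp only: cobar_linear contract_coord add tensor_bilinear) (simp add: algebra_simps)
  qed (simp_all add: linear)
  show "contract (coord True False j) (cobar (uK ^ j) g (Suc n) x) =
      pure [uG * uK ^ Suc j] \<otimes>\<^sub>T c - cobar (uK ^ Suc j) g n a"
    using assms(1) unfolding a_def c_def
  proof (induction rule: tensor_power_Suc_induct)
    case (tensor h y)
    show ?case by (simp only: s *[OF functional_coord, where k = "uK ^ Suc j"])
        (simp add: coord_monomials linear scaleC_one)
  next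
    case (add x y)
    show ?case by (simp only: cobar_linear contract_coord add tensor_bilinear) (simp add: algebra_simps)
  qed (simp_all add: linear)
  show "contract (coord False True j) (cobar (uK ^ j) g (Suc n) x) =
      - (pure [uE * uK ^ Suc j] \<otimes>\<^sub>T c) - cobar (uK ^ Suc j) g n b"
    using assms(1) unfolding b_def c_def
  proof (induction rule: tensor_power_Suc_induct)
    case (tensor h y)
    show ?case by (simp only: s *[OF functional_coord, where k = "uK ^ Suc j"])
        (simp add: coord_monomials linear scaleC_one)
  next
    case (add x y)
    show ?case by (simp only: cobar_linear contract_coord add tensor_bilinear) (simp add: algebra_simps)
  qed (simp_all add: linear)
  show "contract (coord True True j) (cobar (uK ^ j) g (Suc n) x) = - cobar (uK ^ (j + 2)) g n c"
    using assms(1) unfolding c_def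
  proof (induction rule: tensor_power_Suc_induct)
    case (tensor h y)
    show ?case by (simp only: s *[OF functional_coord, where k = "uK ^ (j + 2)"])
        (simp add: coord_monomials linear scaleC_one)
  next
    case (add x y)
    show ?case by (simp only: cobar_linear contract_coord add tensor_bilinear) (simp add: algebra_simps)
  qed (simp_all add: linear)
qed

lemma cobar_monomial_tensor:
  "cobar (uK ^ j) g (Suc n) (pure [uE * uK ^ j] \<otimes>\<^sub>T y) = - (pure [uE * uK ^ j] \<otimes>\<^sub>T cobar (uK ^ Suc j) g n y)"
  "cobar (uK ^ j) g (Suc n) (pure [uG * uK ^ j] \<otimes>\<^sub>T y) = - (pure [uG * uK ^ j] \<otimes>\<^sub>T cobar (uK ^ Suc j) g n y)"
  "cobar (uK ^ j) g (Suc n) (pure [uE * (uG * uK ^ j)] \<otimes>\<^sub>T y) =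
     pure [uE * uK ^ j] \<otimes>\<^sub>T pure [uG * uK ^ Suc j] \<otimes>\<^sub>T y - pure [uG * uK ^ j] \<otimes>\<^sub>T pure [uE * uK ^ Suc j] \<otimes>\<^sub>T y
     - pure [uE * (uG * uK ^ j)] \<otimes>\<^sub>T cobar (uK ^ (j + 2)) g n y"
proof -
  have pp: "pure [a, b] = pure [a] \<otimes>\<^sub>T pure [b]" for a b :: uq by (simp add: tensor_pure)
  note s = comult_monomials pp tensor_bilinear tensor_assoc
  show "cobar (uK ^ j) g (Suc n) (pure [uE * uK ^ j] \<otimes>\<^sub>T y) = - (pure [uE * uK ^ j] \<otimes>\<^sub>T cobar (uK ^ Suc j) g n y)"
    "cobar (uK ^ j) g (Suc n) (pure [uG * uK ^ j] \<otimes>\<^sub>T y) = - (pure [uG * uK ^ j] \<otimes>\<^sub>T cobar (uK ^ Suc j) g n y)"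
    by (simp_all add: cobar_tensor[where k = "uK ^ Suc j"] s)
  show "cobar (uK ^ j) g (Suc n) (pure [uE * (uG * uK ^ j)] \<otimes>\<^sub>T y) =
     pure [uE * uK ^ j] \<otimes>\<^sub>T pure [uG * uK ^ Suc j] \<otimes>\<^sub>T y - pure [uG * uK ^ j] \<otimes>\<^sub>T pure [uE * uK ^ Suc j] \<otimes>\<^sub>T y
     - pure [uE * (uG * uK ^ j)] \<otimes>\<^sub>T cobar (uK ^ (j + 2)) g n y"
    by (simp add: cobar_tensor[where k = "uK ^ (j + 2)"] s)
qed

primrec cobar_boundaries :: "uq \<Rightarrow> uq \<Rightarrow> nat \<Rightarrow> uq tens set" where
  "cobar_boundaries l g 0 = {0}"
| "cobar_boundaries l g (Suc n) = cobar l g n ` tensor_power n"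

lemma subspace_cobar_boundaries: "complex_vector.subspace (cobar_boundaries l g n)"
proof (cases n)
  case (Suc m)
  show ?thesis
    unfolding Suc cobar_boundaries.simps
  proof (rule complex_vector.subspaceI)
    show "0 \<in> cobar l g m ` tensor_power m"
      by (rule image_eqI[of _ _ 0]) (simp_all add: cobar_linear tensor_power_zero)
    fix x y c assume x: "x \<in> cobar l g m ` tensor_power m"
    then show "c *\<^sub>C x \<in> cobar l g m ` tensor_power m"
      by (auto simp flip: cobar_linear intro!: imageI tensor_power_scale)
    assume "y \<in> cobar l g m ` tensor_power m"
    with x show "x + y \<in> cobar l g m ` tensor_power m"
      by (auto simp flip: cobar_linear intro!: imageI tensor_power_add)
  qed
qed simp

lemmas cobar_boundaries_intros =
  complex_vector.subspace_0[OF subspace_cobar_boundaries] complex_vector.subspace_add[OF subspace_cobar_boundaries]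
  complex_vector.subspace_diff[OF subspace_cobar_boundaries]
      complex_vector.subspace_neg[OF subspace_cobar_boundaries]
  complex_vector.subspace_scale[OF subspace_cobar_boundaries]

lemma skew_primitive_tensor_boundary:
  assumes "y \<in> cobar_boundaries (uK ^ Suc j) g n" "h \<in> {uE, uG}"
  shows "pure [h * uK ^ j] \<otimes>\<^sub>T y \<in> cobar_boundaries (uK ^ j) g (Suc n)"
proof (cases n)
  case 0
  with assms show ?thesis by (simp add: tensor_bilinear) (metis cobar_linear(3) image_eqI tensor_power_zero)
next
  case (Suc m)
  with assms obtain z where z: "z \<in> tensor_power m" "y = cobar (uK ^ Suc j) g m z" by auto
  have "pure [h * uK ^ j] \<otimes>\<^sub>T z \<in> tensor_power (Suc m)"
    using tensor_in_tensor_power[OF pure_in_tensor_power z(1), of "[h * uK ^ j]" 1] by simp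
  moreover have "pure [h * uK ^ j] \<otimes>\<^sub>T y = cobar (uK ^ j) g n (- (pure [h * uK ^ j] \<otimes>\<^sub>T z))"
    using assms(2) by (auto simp: Suc z cobar_linear cobar_monomial_tensor simp del: power_Suc)
  ultimately show ?thesis
    using Suc by (auto intro!: image_eqI tensor_power_neg)
qed

text \<open>Multiplication by the class of \<open>G\<close> is injective on cohomology, as it is on polynomials in
  \<open>E\<close> and \<open>G\<close>: contracting the equation \<open>d x = G \<otimes> y\<close> with the form dual to \<open>G\<close> expresses \<open>y\<close>,
  modulo boundaries, as \<open>E \<otimes> c\<close> for a component \<open>c\<close> of \<open>x\<close>, and contracting it with the form
  dual to \<open>E\<close> shows that \<open>G \<otimes> c\<close> is a boundary, so induction applies to \<open>c\<close>.\<close>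

lemma skew_primitive_product_boundary:
  assumes "x \<in> tensor_power n" "y \<in> tensor_power n"
    and "cobar (uK ^ j) (uK ^ m) n x = pure [uG * uK ^ j] \<otimes>\<^sub>T y"
  shows "y \<in> cobar_boundaries (uK ^ Suc j) (uK ^ m) n"
  using assms
proof (induction n arbitrary: j x y)
  case 0
  obtain s t where st: "x = s *\<^sub>C pure []" "y = t *\<^sub>C pure []"
    using 0 tensor_power_0E by metis
  have "s *\<^sub>C (uK ^ j - uK ^ m) = t *\<^sub>C (uG * uK ^ j)"
    using 0(3) by (simp add: st cobar_0 tensor_bilinear tensor_unit pure_1_eq_iff flip: pure_1)
  from arg_cong[OF this, of "coord False True j"] have "t = 0"
    by (simp add: coord_linear coord_monomials)
  then show ?case by (simp add: st)
next
  case (Suc n)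
  let ?c = "contract (coord True True j) x"
  note in_power = contract_in_tensor_power[OF functional_coord]
  note eqs = contract_cobar[OF Suc.prems(1), of j "uK ^ m", unfolded Suc.prems(3) contract_coord coord_monomials]
  have y: "y = - (pure [uE * uK ^ Suc j] \<otimes>\<^sub>T ?c) - cobar (uK ^ Suc j) (uK ^ m) n (contract (coord False True j) x)"
    and c: "cobar (uK ^ Suc j) (uK ^ m) n (contract (coord True False j) x) = pure [uG * uK ^ Suc j] \<otimes>\<^sub>T ?c"
    using eqs(2,3) by (simp_all add: scaleC_one del: power_Suc)
  have "?c \<in> cobar_boundaries (uK ^ Suc (Suc j)) (uK ^ m) n"
    using Suc.prems in_power by (intro Suc.IH[OF _ _ c]) auto
  then have "pure [uE * uK ^ Suc j] \<otimes>\<^sub>T ?c \<in> cobar_boundaries (uK ^ Suc j) (uK ^ m) (Suc n)"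
    by (rule skew_primitive_tensor_boundary) simp
  moreover have "cobar (uK ^ Suc j) (uK ^ m) n (contract (coord False True j) x)
      \<in> cobar_boundaries (uK ^ Suc j) (uK ^ m) (Suc n)"
    using Suc.prems in_power by (auto simp del: power_Suc)
  ultimately show ?case
    unfolding y by (intro cobar_boundaries_intros)
qed

text \<open>The component of a cocycle along \<open>E G\<close> is a boundary by injectivity of multiplication by
  \<open>G\<close>, and can therefore be removed by subtracting a differential; the components along \<open>E\<close> and
  \<open>G\<close> are then cocycles of lower degree.\<close>

lemma cobar_cocycle_cases:
  assumes "x \<in> tensor_power (Suc n)" "cobar (uK ^ j) (uK ^ m) (Suc n) x = 0"
  obtains a b where "a \<in> tensor_power n" "b \<in> tensor_power n"
    and "cobar (uK ^ Suc j) (uK ^ m) n a = 0" "cobar (uK ^ Suc j) (uK ^ m) n b = 0"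
    and "x - pure [uE * uK ^ j] \<otimes>\<^sub>T a - pure [uG * uK ^ j] \<otimes>\<^sub>T b \<in> cobar_boundaries (uK ^ j) (uK ^ m) (Suc n)"
proof -
  let ?a = "contract (coord True False j) x" and ?b = "contract (coord False True j) x"
    and ?c = "contract (coord True True j) x" and ?k = "contract (coord False False j) x"
  note in_power = contract_in_tensor_power[OF functional_coord assms(1)]
  note eqs = contract_cobar[OF assms(1), of j "uK ^ m", unfolded assms(2) contract_coord]
  have a: "cobar (uK ^ Suc j) (uK ^ m) n ?a = pure [uG * uK ^ Suc j] \<otimes>\<^sub>T ?c"
    using eqs(2) by (simp del: power_Suc)
  have b: "cobar (uK ^ Suc j) (uK ^ m) n ?b = - (pure [uE * uK ^ Suc j] \<otimes>\<^sub>T ?c)"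
    using right_minus_eq[THEN iffD1, OF eqs(3)[symmetric]] by (rule sym)
  have c: "?c \<in> cobar_boundaries (uK ^ Suc (Suc j)) (uK ^ m) n"
    by (rule skew_primitive_product_boundary[OF _ _ a]) (rule in_power)+
  define x' where "x' = x - pure [uE * uK ^ j] \<otimes>\<^sub>T ?a - pure [uG * uK ^ j] \<otimes>\<^sub>T ?b
      - pure [uE * (uG * uK ^ j)] \<otimes>\<^sub>T ?c"
  have x': "x' \<in> cobar_boundaries (uK ^ j) (uK ^ m) (Suc n)"
    using eqs(1) in_power by (simp add: x'_def)
  show thesis
  proof (cases n)
    case 0
    with c have "?c = 0" by simp
    then show thesis
      using x' a b in_power by (intro that[of ?a ?b]) (simp_all add: x'_def tensor_bilinear del: power_Suc)
  next
    case (Suc n')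
    with c obtain z where z: "z \<in> tensor_power n'" "?c = cobar (uK ^ (j + 2)) (uK ^ m) n' z"
      by auto
    define ez where "ez = pure [uE * (uG * uK ^ j)] \<otimes>\<^sub>T z"
    have lift: "pure [h] \<otimes>\<^sub>T z \<in> tensor_power n" for h
      using tensor_in_tensor_power[OF pure_in_tensor_power z(1), of "[h]" 1] by (simp add: Suc)
    let ?a' = "?a + pure [uG * uK ^ Suc j] \<otimes>\<^sub>T z" and ?b' = "?b - pure [uE * uK ^ Suc j] \<otimes>\<^sub>T z"
    show thesis
    proof (rule that)
      show "?a' \<in> tensor_power n" "?b' \<in> tensor_power n"
        by (intro tensor_power_intros lift in_power)+
      show "cobar (uK ^ Suc j) (uK ^ m) n ?a' = 0"
        unfolding cobar_linear a unfolding Suc cobar_monomial_tensor z by simp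
      show "cobar (uK ^ Suc j) (uK ^ m) n ?b' = 0"
        unfolding cobar_linear b unfolding Suc cobar_monomial_tensor z by simp
      have "cobar (uK ^ j) (uK ^ m) n ez = pure [uE * uK ^ j] \<otimes>\<^sub>T pure [uG * uK ^ Suc j] \<otimes>\<^sub>T z
          - pure [uG * uK ^ j] \<otimes>\<^sub>T pure [uE * uK ^ Suc j] \<otimes>\<^sub>T z - pure [uE * (uG * uK ^ j)] \<otimes>\<^sub>T ?c"
        unfolding ez_def Suc cobar_monomial_tensor z ..
      then have "x - pure [uE * uK ^ j] \<otimes>\<^sub>T ?a' - pure [uG * uK ^ j] \<otimes>\<^sub>T ?b' = x' - cobar (uK ^ j) (uK ^ m) n ez"
        by (simp add: x'_def tensor_bilinear algebra_simps del: power_Suc)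
      moreover have "cobar (uK ^ j) (uK ^ m) n ez \<in> cobar_boundaries (uK ^ j) (uK ^ m) (Suc n)"
        using lift by (simp add: ez_def)
      ultimately show "x - pure [uE * uK ^ j] \<otimes>\<^sub>T ?a' - pure [uG * uK ^ j] \<otimes>\<^sub>T ?b'
          \<in> cobar_boundaries (uK ^ j) (uK ^ m) (Suc n)"
        using x' by (auto intro: cobar_boundaries_intros simp del: cobar_boundaries.simps)
    qed
  qed
qed

text \<open>Splitting off one factor \<open>E\<close> or \<open>G\<close> lowers the degree by one and multiplies the left twist
  by \<open>K\<close>. In degree \<open>0\<close> the differential is multiplication by \<open>K\<^sup>i - K\<^sup>m\<close>, which vanishes only if
  \<open>i = m\<close> modulo \<open>4\<close>.\<close>

theorem cobar_exact:
  assumes "x \<in> tensor_power n" "cobar (uK ^ j) (uK ^ m) n x = 0" "m mod 4 \<noteq> (j + n) mod 4"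
  shows "x \<in> cobar_boundaries (uK ^ j) (uK ^ m) n"
  using assms
proof (induction n arbitrary: j x)
  case 0
  obtain s where x: "x = s *\<^sub>C pure []" using 0(1) by (rule tensor_power_0E)
  have "s *\<^sub>C (uK ^ j - uK ^ m) = 0"
    using 0(2) pure_1_eq_iff[of _ 0] by (simp only: x cobar_0 pure_1(5))
  from arg_cong[OF this, of "coord False False j"] show ?case
    using 0(3) by (simp add: coord_linear coord_monomials x)
next
  case (Suc n)
  obtain a b where ab: "a \<in> tensor_power n" "b \<in> tensor_power n"
      "cobar (uK ^ Suc j) (uK ^ m) n a = 0" "cobar (uK ^ Suc j) (uK ^ m) n b = 0"
    and x: "x - pure [uE * uK ^ j] \<otimes>\<^sub>T a - pure [uG * uK ^ j] \<otimes>\<^sub>T b \<in> cobar_boundaries (uK ^ j) (uK ^ m) (Suc n)"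
    using Suc.prems(1,2) by (rule cobar_cocycle_cases)
  have "a \<in> cobar_boundaries (uK ^ Suc j) (uK ^ m) n" "b \<in> cobar_boundaries (uK ^ Suc j) (uK ^ m) n"
    using Suc.prems(3) by (simp_all only: Suc.IH[OF ab(1,3)] Suc.IH[OF ab(2,4)] add_Suc add_Suc_right
        not_False_eq_True)
  then have "pure [uE * uK ^ j] \<otimes>\<^sub>T a \<in> cobar_boundaries (uK ^ j) (uK ^ m) (Suc n)"
    "pure [uG * uK ^ j] \<otimes>\<^sub>T b \<in> cobar_boundaries (uK ^ j) (uK ^ m) (Suc n)"
    by (auto intro!: skew_primitive_tensor_boundary simp del: cobar_boundaries.simps power_Suc)
  from complex_vector.subspace_add[OF subspace_cobar_boundaries
      complex_vector.subspace_add[OF subspace_cobar_boundaries x this(2)] this(1)]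
  show ?case by simp
qed

lemma cobar_1_cocycle:
  assumes "cobar (uK ^ j) (uK ^ Suc j) (Suc 0) (pure [h]) = 0"
  obtains s \<alpha> \<beta> where "h = s *\<^sub>C (uK ^ j - uK ^ Suc j) + \<alpha> *\<^sub>C (uE * uK ^ j) + \<beta> *\<^sub>C (uG * uK ^ j)"
proof -
  have "pure [h] \<in> tensor_power (Suc 0)" by (simp add: pure_in_tensor_power)
  then obtain a b where ab: "a \<in> tensor_power 0" "b \<in> tensor_power 0"
    and x: "pure [h] - pure [uE * uK ^ j] \<otimes>\<^sub>T a - pure [uG * uK ^ j] \<otimes>\<^sub>T b
        \<in> cobar_boundaries (uK ^ j) (uK ^ Suc j) (Suc 0)"
    using assms by (rule cobar_cocycle_cases)
  from x obtain c where c: "c \<in> tensor_power 0"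
    "pure [h] - pure [uE * uK ^ j] \<otimes>\<^sub>T a - pure [uG * uK ^ j] \<otimes>\<^sub>T b = cobar (uK ^ j) (uK ^ Suc j) 0 c"
    by auto
  obtain s \<alpha> \<beta> where "c = s *\<^sub>C pure []" "a = \<alpha> *\<^sub>C pure []" "b = \<beta> *\<^sub>C pure []"
    using ab c(1) tensor_power_0E by metis
  with c(2) have "pure [h] = pure [s *\<^sub>C (uK ^ j - uK ^ Suc j) + \<alpha> *\<^sub>C (uE * uK ^ j) + \<beta> *\<^sub>C (uG * uK ^ j)]"
    by (simp add: cobar_0 tensor_bilinear tensor_unit pure_1 algebra_simps del: power_Suc)
  then show thesis using that by (simp only: pure_1_eq_iff)
qed

section \<open>The square of the differential\<close>

lemma pure_pair: "pure [a, b] = pure [a] \<otimes>\<^sub>T pure [b]"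
  by (simp add: tensor_pure)

lemma comult_coassociative:
  "comult_at uq_comult (Suc 0) (uq_comult h) = comult_at uq_comult 2 (uq_comult h)"
proof -
  have 2: "comult_at uq_comult 2 (pure [a] \<otimes>\<^sub>T x) = pure [a] \<otimes>\<^sub>T comult_at uq_comult (Suc 0) x" for a x
    using comult_at_tensor(2)[of "Suc 0" a x] by (simp add: numeral_2_eq_2)
  have 1: "comult_at uq_comult (Suc 0) (pure [a]) = uq_comult a" for a
    using comult_at_tensor(1)[of a "pure []"] by (simp add: tensor_unit)
  have diff: "comult_at uq_comult i (x - y) = comult_at uq_comult i x - comult_at uq_comult i y" for i x y
    using comult_at_uq_linear(1)[of i "x - y" y] by simp
  note s = comult_monomials[unfolded pure_pair] comult_at_uq_linear diff comult_at_tensor(1) 1 2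
    tensor_bilinear tensor_assoc uq_comult(1,3)
  have Suc: "Suc j + 2 = Suc (Suc (Suc j))" "j + 2 = Suc (Suc j)" for j by simp_all
  show ?thesis
    by (induction h rule: uq_monomial_induct) (simp_all only: s Suc, simp_all add: algebra_simps)
qed

lemma cobar_2: "cobar l g 2 x = pure [l] \<otimes>\<^sub>T x - comult_at uq_comult 1 x + comult_at uq_comult 2 x - x \<otimes>\<^sub>T pure [g]"
  by (simp add: cobar_def numeral_2_eq_2 scaleC_one)

text \<open>The Leibniz rule for a first factor of degree two.\<close>

lemma cobar_tensor_2:
  assumes "w \<in> tensor_power 2"
  shows "cobar l g (Suc (Suc n)) (w \<otimes>\<^sub>T x) = cobar l l 2 w \<otimes>\<^sub>T x + w \<otimes>\<^sub>T cobar l g n x"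
  using assms unfolding numeral_2_eq_2
proof (induction rule: tensor_power_Suc_induct)
  case (tensor a u)
  then obtain b where "u = pure [b]" by (rule tensor_power_1E)
  then show ?case
    by (simp add: tensor_assoc cobar_tensor[where k = l] cobar_1 tensor_bilinear)
qed (simp_all add: tensor_bilinear cobar_linear)

text \<open>The Leibniz rule reduces the claim to coassociativity in a single factor.\<close>

lemma cobar_cobar:
  assumes "x \<in> tensor_power n"
  shows "cobar (uK ^ j) (uK ^ m) (Suc n) (cobar (uK ^ j) (uK ^ m) n x) = 0"
  using assms
proof (induction n arbitrary: x)
  case 0
  then obtain s where "x = s *\<^sub>C pure []" by (rule tensor_power_0E)
  moreover have "uq_comult (uK ^ j - uK ^ m) = pure [uK ^ j, uK ^ j] - pure [uK ^ m, uK ^ m]"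
    using uq_comult(1)[of "uK ^ j - uK ^ m" "uK ^ m"] by (simp add: comult_monomials)
  ultimately show ?case
    by (simp only: cobar_0 cobar_1) (simp add: pure_2 uq_comult
        flip: complex_vector.scale_right_diff_distrib complex_vector.scale_right_distrib)
next
  case (Suc n)
  let ?l = "uK ^ j" and ?g = "uK ^ m"
  from Suc.prems show ?case
  proof (induction rule: tensor_power_Suc_induct)
    case (tensor h y)
    define w where "w = pure [?l, h] - uq_comult h + pure [h, ?l]"
    have w2: "w \<in> tensor_power 2"
      unfolding w_def by (intro tensor_power_intros uq_comult(8) pure_in_tensor_power) simp_all
    have "cobar ?l ?l 2 (pure [?l, h]) = pure [?l] \<otimes>\<^sub>T uq_comult h - pure [?l, h, ?l]"
      unfolding numeral_2_eq_2 pure_pair cobar_tensor[where k = ?l] cobar_1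
      by (simp add: comult_monomials tensor_bilinear tensor_pure)
    moreover have "cobar ?l ?l 2 (pure [h, ?l]) = pure [?l, h, ?l] - uq_comult h \<otimes>\<^sub>T pure [?l]"
      unfolding numeral_2_eq_2 pure_pair cobar_tensor[where k = ?l] cobar_1
      by (simp add: comult_monomials tensor_bilinear tensor_pure)
    moreover have "cobar ?l ?l 2 (uq_comult h) = pure [?l] \<otimes>\<^sub>T uq_comult h - uq_comult h \<otimes>\<^sub>T pure [?l]"
      by (simp add: cobar_2 comult_coassociative)
    ultimately have w: "cobar ?l ?l 2 w = 0"
      by (simp add: w_def cobar_linear)
    have eq: "cobar ?l ?g (Suc n) (pure [h] \<otimes>\<^sub>T y) = w \<otimes>\<^sub>T y - pure [h] \<otimes>\<^sub>T cobar ?l ?g n y"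
      unfolding w_def by (rule cobar_tensor)
    have eq2: "cobar ?l ?g (Suc (Suc n)) (pure [h] \<otimes>\<^sub>T z) = w \<otimes>\<^sub>T z - pure [h] \<otimes>\<^sub>T cobar ?l ?g (Suc n) z" for z
      unfolding w_def by (rule cobar_tensor)
    show ?case
      unfolding eq unfolding cobar_linear cobar_tensor_2[OF w2] w eq2 Suc.IH[OF tensor]
      by (simp add: tensor_bilinear)
  qed (simp_all add: cobar_linear)
qed

section \<open>Multiplicativity and parity\<close>

lemma tensor_times:
  assumes "a \<in> tensor_power n" "b \<in> tensor_power n"
  shows "(a \<otimes>\<^sub>T x) * (b \<otimes>\<^sub>T y) = (a * b) \<otimes>\<^sub>T (x * y)"
proof -
  have *: "(pure us \<otimes>\<^sub>T x) * (pure vs \<otimes>\<^sub>T y) = (pure us * pure vs) \<otimes>\<^sub>T (x * y)"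
    if len: "length us = n" "length vs = n" for us vs
  proof (induction x)
    case (pure xs)
    show ?case
      by (induction y) (use len in \<open>simp_all add: tensor_bilinear times_tens_bilinear tensor_pure
          pure_times_pure\<close>)
  qed (simp_all add: tensor_bilinear times_tens_bilinear)
  from assms(1) show ?thesis
  proof (induction rule: tensor_power_pure_induct)
    case (pure us)
    with assms(2) show ?case
      by (induction rule: tensor_power_pure_induct) (simp_all add: * tensor_bilinear times_tens_bilinear)
  qed (simp_all add: tensor_bilinear times_tens_bilinear)
qed

lemma comult_at_times:
  assumes "x \<in> tensor_power n" "y \<in> tensor_power n" "1 \<le> i" "i \<le> n"
  shows "comult_at uq_comult i (x * y) = comult_at uq_comult i x * comult_at uq_comult i y"
  using assms
proof (induction n arbitrary: i x y)
  case (Suc n)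
  have p1: "pure [h] \<in> tensor_power 1" for h :: uq by (simp add: pure_in_tensor_power)
  have pp: "pure [h] * pure [h'] = pure [h * h']" for h h' :: uq by (simp add: pure_times_pure)
  obtain k where k: "i = Suc k" using Suc.prems by (cases i) auto
  from Suc.prems(1) show ?case
  proof (induction rule: tensor_power_Suc_induct)
    case (tensor h x)
    from Suc.prems(2) show ?case
    proof (induction rule: tensor_power_Suc_induct)
      case (tensor h' y)
      show ?case
      proof (cases k)
        case 0
        show ?thesis
          unfolding k 0 tensor_times[OF p1 p1] pp comult_at_tensor
          by (simp add: tensor_times[OF uq_comult(8) uq_comult(8)] uq_comult)
      next
        case (Suc k')
        have "comult_at uq_comult k (x * y) = comult_at uq_comult k x * comult_at uq_comult k y"
          using Suc.prems k Suc by (intro Suc.IH tensor \<open>x \<in> _\<close>) auto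
        then show ?thesis
          using Suc by (simp add: k tensor_times[OF p1 p1] pp comult_at_tensor)
      qed
    qed (simp_all add: comult_at_uq_linear times_tens_bilinear)
  qed (simp_all add: comult_at_uq_linear times_tens_bilinear)
qed simp

lemma comult_at_in_tensor_power:
  assumes "x \<in> tensor_power n" "1 \<le> i" "i \<le> n"
  shows "comult_at uq_comult i x \<in> tensor_power (Suc n)"
  using assms
proof (induction n arbitrary: i x)
  case (Suc n)
  obtain k where k: "i = Suc k" using Suc.prems by (cases i) auto
  from Suc.prems(1) show ?case
  proof (induction rule: tensor_power_Suc_induct)
    case (tensor h x)
    show ?case
    proof (cases k)
      case 0
      then show ?thesis
        using tensor_in_tensor_power[OF uq_comult(8) tensor, of h] by (simp add: k comult_at_tensor)
    next
      case (Suc k')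
      have "comult_at uq_comult k x \<in> tensor_power (Suc n)"
        using Suc.prems k Suc by (intro Suc.IH tensor) auto
      from tensor_in_tensor_power[OF pure_in_tensor_power this, of "[h]" 1] show ?thesis
        using Suc by (simp add: k comult_at_tensor)
    qed
  qed (simp_all add: comult_at_uq_linear tensor_power_intros)
qed simp

lemma iter_comult_linear:
  "iter_comult uq_comult k (x + y) = iter_comult uq_comult k x + iter_comult uq_comult k y"
  "iter_comult uq_comult k (c *\<^sub>C x) = c *\<^sub>C iter_comult uq_comult k x"
  by (induction k) (simp_all add: pure_1 comult_at_uq_linear)

lemma iter_comult_in_tensor_power: "iter_comult uq_comult k x \<in> tensor_power (Suc k)"
  by (induction k) (simp_all add: pure_in_tensor_power comult_at_in_tensor_power)

lemma iter_comult_times: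
  "iter_comult uq_comult k (x * y) = iter_comult uq_comult k x * iter_comult uq_comult k y"
  by (induction k) (simp_all add: pure_times_pure comult_at_times[OF iter_comult_in_tensor_power
      iter_comult_in_tensor_power])

abbreviation diagonal_K :: "nat \<Rightarrow> nat \<Rightarrow> uq tens" where
  "diagonal_K n j \<equiv> pure (replicate n (uK ^ j))"

lemma diagonal_K_in_tensor_power: "diagonal_K n j \<in> tensor_power n"
  by (simp add: pure_in_tensor_power)

lemma comult_at_diagonal_K:
  "1 \<le> i \<Longrightarrow> i \<le> n \<Longrightarrow> comult_at uq_comult i (diagonal_K n j) = diagonal_K (Suc n) j"
proof (induction n arbitrary: i)
  case (Suc n)
  show ?case
  proof (cases "i = 1")
    case True
    then show ?thesis
      using comult_at_tensor(1)[of "uK ^ j" "diagonal_K n j"] by (simp add: comult_monomials tensor_pure)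
  next
    case False
    then obtain k where "i = Suc k" "1 \<le> k" "k \<le> n" using Suc.prems by (cases i) auto
    then show ?thesis
      using Suc.IH[of k] comult_at_tensor(2)[of k "uK ^ j" "diagonal_K n j"] by (simp add: tensor_pure)
  qed
qed simp

lemma iter_comult_uK_pow: "iter_comult uq_comult k (uK ^ j) = diagonal_K (Suc k) j"
proof (induction k)
  case (Suc k)
  then show ?case using comult_at_diagonal_K[of 1 "Suc k" j] by simp
qed simp

text \<open>The elements \<open>h\<close> whose iterated coproduct commutes with \<open>x\<close> form a subalgebra.\<close>

lemma DY_cochainsI:
  assumes "x \<in> tensor_power (Suc k)"
    and "\<And>h. h \<in> {uE, uG, uK} \<Longrightarrow> x * iter_comult uq_comult k h = iter_comult uq_comult k h * x"
  shows "x \<in> DY_cochains uq_comult (Suc k)"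
proof -
  define C where "C = {h. x * iter_comult uq_comult k h = iter_comult uq_comult k h * x}"
  have gens: "uE \<in> C" "uG \<in> C" "uK \<in> C" using assms(2) by (auto simp: C_def)
  have mult: "a * b \<in> C" if "a \<in> C" "b \<in> C" for a b
    using that unfolding C_def mem_Collect_eq iter_comult_times by (metis mult.assoc)
  have one: "1 \<in> C"
  proof -
    have "iter_comult uq_comult k 1 = pure (replicate (Suc k) 1)"
      using iter_comult_uK_pow[of k 0] by simp
    then show ?thesis using tensor_power_one[OF assms(1)] by (simp add: C_def)
  qed
  have pow: "uK ^ j \<in> C" for j by (induction j) (auto intro: one mult gens)
  have "h \<in> C" for h
  proof (induction h rule: uq_monomial_induct)
    case (add x y)
    then show ?case by (simp add: C_def iter_comult_linear times_tens_bilinear)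
  next
    case (scale c x)
    then show ?case by (simp add: C_def iter_comult_linear times_tens_bilinear)
  qed (intro mult gens pow)+
  then show ?thesis using assms(1) by (auto simp: C_def)
qed

text \<open>Conjugation by \<open>K \<otimes> \<dots> \<otimes> K\<close>, with \<open>K\<^sup>-\<^sup>1 = K\<^sup>3\<close>. Since \<open>K\<^sup>2\<close> is central it is an involution,
  and its eigenspaces for \<open>1\<close> and \<open>-1\<close> are the tensors of even and odd total degree in \<open>E\<close> and
  \<open>G\<close>.\<close>

definition conj_K :: "nat \<Rightarrow> uq tens \<Rightarrow> uq tens" where
  "conj_K n x = diagonal_K n 1 * x * diagonal_K n 3"

lemma conj_K_in_tensor_power: "x \<in> tensor_power n \<Longrightarrow> conj_K n x \<in> tensor_power n"
  unfolding conj_K_def by (intro tensor_power_times diagonal_K_in_tensor_power)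

lemma uK_conj: "uK * uK ^ j * uK ^ 3 = uK ^ j"
proof -
  have "uK * uK ^ j * uK ^ 3 = uK ^ (Suc j + 3)" by (simp only: power_add power_Suc)
  also have "\<dots> = uK ^ j" by (rule uK_pow_eqI) simp
  finally show ?thesis .
qed

text \<open>The twists are powers of \<open>K\<close> and hence fixed by the conjugation, and \<open>\<Delta> K = K \<otimes> K\<close>.\<close>

lemma cobar_conj_K:
  assumes "x \<in> tensor_power n"
  shows "cobar (uK ^ j) (uK ^ m) n (conj_K n x) = conj_K (Suc n) (cobar (uK ^ j) (uK ^ m) n x)"
proof -
  note d = diagonal_K_in_tensor_power
  have p1: "pure [h] \<in> tensor_power 1" for h :: uq by (simp add: pure_in_tensor_power)
  have cons: "diagonal_K (Suc n) i = pure [uK ^ i] \<otimes>\<^sub>T diagonal_K n i" for i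
    by (simp add: tensor_pure)
  have snoc: "diagonal_K (Suc n) i = diagonal_K n i \<otimes>\<^sub>T pure [uK ^ i]" for i
    by (simp add: tensor_pure flip: replicate_append_same)
  have l: "conj_K (Suc n) (pure [uK ^ j] \<otimes>\<^sub>T x) = pure [uK ^ j] \<otimes>\<^sub>T conj_K n x"
    unfolding conj_K_def cons tensor_times[OF p1 p1] pure_times_pure by (simp add: tensor_times[OF p1 p1]
        pure_times_pure uK_conj)
  have r: "conj_K (Suc n) (x \<otimes>\<^sub>T pure [uK ^ m]) = conj_K n x \<otimes>\<^sub>T pure [uK ^ m]"
    unfolding conj_K_def snoc tensor_times[OF d assms] tensor_times[OF tensor_power_times[OF d assms] d]
    by (simp add: pure_times_pure uK_conj)
  have i: "conj_K (Suc n) (comult_at uq_comult i x) = comult_at uq_comult i (conj_K n x)" if "i \<in> {1..n}" for i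
  proof -
    from that have i: "1 \<le> i" "i \<le> n" by simp_all
    show ?thesis
      by (simp only: conj_K_def comult_at_times[OF tensor_power_times[OF d assms] d i]
          comult_at_times[OF d assms i] comult_at_diagonal_K[OF i])
  qed
  have scale: "conj_K n (c *\<^sub>C x) = c *\<^sub>C conj_K n x" for n c x
    by (simp add: conj_K_def times_tens_bilinear)
  have "conj_K (Suc n) (\<Sum>i = 1..n. (-1) ^ i *\<^sub>C comult_at uq_comult i x) =
      (\<Sum>i = 1..n. conj_K (Suc n) ((-1) ^ i *\<^sub>C comult_at uq_comult i x))"
    by (simp add: conj_K_def sum_distrib_left sum_distrib_right)
  also have "\<dots> = (\<Sum>i = 1..n. (-1) ^ i *\<^sub>C comult_at uq_comult i (conj_K n x))"
    by (intro sum.cong refl) (simp only: scale i)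
  finally have sum: "conj_K (Suc n) (\<Sum>i = 1..n. (-1) ^ i *\<^sub>C comult_at uq_comult i x) =
      (\<Sum>i = 1..n. (-1) ^ i *\<^sub>C comult_at uq_comult i (conj_K n x))" .
  have add: "conj_K n (x + y) = conj_K n x + conj_K n y" for n x y
    by (simp add: conj_K_def times_tens_bilinear)
  show ?thesis
    unfolding cobar_def add scale sum l r ..
qed

lemma diagonal_K_times: "diagonal_K n i * diagonal_K n j = diagonal_K n (i + j)"
proof -
  have "map2 (*) (replicate n (uK ^ i)) (replicate n (uK ^ j)) = replicate n (uK ^ (i + j))"
    by (induction n) (simp_all add: power_add)
  then show ?thesis by (simp only: pure_times_pure length_replicate if_True refl)
qed

lemma diagonal_K_4:
  assumes "x \<in> tensor_power n"
  shows "diagonal_K n 4 * x = x" "x * diagonal_K n 4 = x"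
  using tensor_power_one[OF assms] by (simp_all add: uK_pow_4)

lemma diagonal_K_2_central:
  assumes "x \<in> tensor_power n"
  shows "diagonal_K n 2 * x = x * diagonal_K n 2"
  using assms
proof (induction rule: tensor_power_pure_induct)
  case (pure xs)
  have central: "uK ^ 2 * h = h * uK ^ 2" for h
  proof (induction h rule: uq_monomial_induct)
    case (E j)
    show ?case by (simp add: uK_pow_uE mult.assoc scaleC_one flip: mult.assoc[of "uK ^ 2" uE] power_add)
  next
    case (G j)
    show ?case by (simp add: uK_pow_uG mult.assoc scaleC_one flip: mult.assoc[of "uK ^ 2" uG] power_add)
  next
    case (EG j)
    have "uK ^ 2 * (uE * (uG * uK ^ j)) = uE * (uK ^ 2 * uG) * uK ^ j"
      by (simp add: uK_pow_uE scaleC_one mult.assoc flip: mult.assoc[of "uK ^ 2" uE])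
    also have "\<dots> = uE * (uG * uK ^ j) * uK ^ 2"
      by (simp add: uK_pow_uG mult.assoc scaleC_one add.commute flip: power_add)
    finally show ?case .
  qed (simp_all add: distrib_left distrib_right mult_scaleC_left mult_scaleC_right add.commute flip: power_add)
  have "map2 (*) (replicate (length xs) (uK ^ 2)) xs = map2 (*) xs (replicate (length xs) (uK ^ 2))"
    by (induction xs) (simp_all add: central)
  with pure show ?case by (simp add: pure_times_pure)
qed (simp_all add: times_tens_bilinear)

lemma conj_K_conj_K:
  assumes "x \<in> tensor_power n"
  shows "conj_K n (conj_K n x) = x"
proof -
  have "conj_K n (conj_K n x) = (diagonal_K n 1 * diagonal_K n 1) * x * (diagonal_K n 3 * diagonal_K n 3)"
    unfolding conj_K_def by (simp only: mult.assoc)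
  also have "\<dots> = (diagonal_K n 2 * x) * diagonal_K n 6"
    unfolding diagonal_K_times by (simp only: one_add_one numeral_plus_numeral add_num_simps)
  also have "\<dots> = x * (diagonal_K n 2 * diagonal_K n 6)"
    unfolding diagonal_K_2_central[OF assms] by (simp only: mult.assoc)
  also have "\<dots> = x * diagonal_K n 4 * diagonal_K n 4"
    unfolding mult.assoc diagonal_K_times by (simp only: numeral_plus_numeral add_num_simps)
  finally show ?thesis by (simp only: diagonal_K_4[OF assms])
qed

lemma commutes_K_iff:
  assumes "x \<in> tensor_power n"
  shows "diagonal_K n 1 * x = x * diagonal_K n 1 \<longleftrightarrow> conj_K n x = x"
proof
  assume "diagonal_K n 1 * x = x * diagonal_K n 1"
  then have "conj_K n x = x * (diagonal_K n 1 * diagonal_K n 3)"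
    unfolding conj_K_def by (simp only: mult.assoc)
  also have "\<dots> = x" unfolding diagonal_K_times using diagonal_K_4[OF assms] by simp
  finally show "conj_K n x = x" .
next
  assume "conj_K n x = x"
  then have "x * diagonal_K n 1 = diagonal_K n 1 * x * (diagonal_K n 3 * diagonal_K n 1)"
    unfolding conj_K_def by (metis mult.assoc)
  also have "\<dots> = diagonal_K n 1 * x"
    unfolding diagonal_K_times
    using diagonal_K_4[OF tensor_power_times[OF diagonal_K_in_tensor_power assms, of 1]] by simp
  finally show "diagonal_K n 1 * x = x * diagonal_K n 1" ..
qed

section \<open>Commutators with skew primitive elements\<close>

definition skew_primitive :: "uq \<Rightarrow> bool" where
  "skew_primitive h \<longleftrightarrow> uq_comult h = pure [1, h] + pure [h, uK] \<and> uK * h = - (h * uK)"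

lemma skew_primitive_uE: "skew_primitive uE" and skew_primitive_uG: "skew_primitive uG"
  using comult_monomials(2,3)[of 0] by (simp_all add: skew_primitive_def uK_uE uK_uG)

lemma iter_comult_2:
  "iter_comult uq_comult 2 h = comult_at uq_comult 1 (uq_comult h)"
  "iter_comult uq_comult 2 h = comult_at uq_comult 2 (uq_comult h)"
proof -
  have "iter_comult uq_comult 1 h = uq_comult h"
    using comult_at_tensor(1)[of h "pure []"] by (simp add: tensor_unit)
  then show "iter_comult uq_comult 2 h = comult_at uq_comult 1 (uq_comult h)"
    by (simp add: numeral_2_eq_2)
  then show "iter_comult uq_comult 2 h = comult_at uq_comult 2 (uq_comult h)"
    by (simp add: comult_coassociative)
qed

lemma iter_comult_1: "iter_comult uq_comult 1 h = uq_comult h"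
  using comult_at_tensor(1)[of h "pure []"] by (simp add: tensor_unit)

definition commutator :: "'a :: ring \<Rightarrow> 'a \<Rightarrow> 'a" where
  "commutator x y = x * y - y * x"

lemma commutator_linear:
  fixes x y z :: "'a :: complex_algebra_1 tens"
  shows "commutator x (y + z) = commutator x y + commutator x z"
      "commutator x (y - z) = commutator x y - commutator x z"
    "commutator x (c *\<^sub>C y) = c *\<^sub>C commutator x y"
  by (simp_all add: commutator_def algebra_simps times_tens_bilinear complex_vector.scale_right_diff_distrib)

text \<open>The coproduct of \<open>h\<close> in three factors is \<open>1 \<otimes> \<Delta> h + h \<otimes> K \<otimes> K\<close> and also \<open>\<Delta> h \<otimes> K + 1 \<otimes> 1 \<otimes>
  h\<close>. Commuting it past the outer faces leaves the commutator with \<open>y\<close> in the remaining two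
  factors, and the last face acquires the twist \<open>K\<close>.\<close>

lemma commutator_cobar_2:
  assumes h: "skew_primitive h" and y: "y \<in> tensor_power 2" "diagonal_K 2 1 * y = y * diagonal_K 2 1"
  shows "commutator (iter_comult uq_comult 2 h) (cobar 1 1 2 y) = cobar 1 uK 2 (commutator (uq_comult h) y)"
proof -
  let ?D = "uq_comult h" and ?I = "iter_comult uq_comult 2 h"
  have D: "?D = pure [1, h] + pure [h, uK]" using h by (simp add: skew_primitive_def)
  have p1: "pure [h] \<in> tensor_power 1" for h :: uq by (simp add: pure_in_tensor_power)
  have d2: "pure [1, 1] \<in> tensor_power 2" by (simp add: pure_in_tensor_power)
  have at: "comult_at uq_comult (Suc 0) (pure [a, b]) = uq_comult a \<otimes>\<^sub>T pure [b]" for a b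
    unfolding pure_pair by (rule comult_at_tensor)
  have I: "?I = pure [1, 1, h] + pure [1, h, uK] + pure [h, uK, uK]"
    unfolding iter_comult_2(1) D
    by (simp add: comult_at_uq_linear at uq_comult D tensor_bilinear tensor_pure)
  then have I1: "?I = pure [1] \<otimes>\<^sub>T ?D + pure [h] \<otimes>\<^sub>T diagonal_K 2 1"
    and I2: "?I = ?D \<otimes>\<^sub>T pure [uK] + pure [1, 1] \<otimes>\<^sub>T pure [h]"
    by (simp_all add: D tensor_bilinear tensor_pure numeral_2_eq_2)
  have one: "pure [1, 1] * y = y" "y * pure [1, 1] = y"
    using tensor_power_one[OF y(1)] by (simp_all add: numeral_2_eq_2)
  have l: "commutator ?I (pure [1] \<otimes>\<^sub>T y) = pure [1] \<otimes>\<^sub>T commutator ?D y"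
    unfolding commutator_def I1 times_tens_bilinear tensor_times[OF p1 p1] y(2)
    by (simp add: pure_times_pure tensor_bilinear)
  have r: "commutator ?I (y \<otimes>\<^sub>T pure [1]) = commutator ?D y \<otimes>\<^sub>T pure [uK]"
    unfolding commutator_def I2 times_tens_bilinear tensor_times[OF uq_comult(8) y(1)]
      tensor_times[OF y(1) uq_comult(8)] tensor_times[OF d2 y(1)] tensor_times[OF y(1) d2] one
    by (simp add: pure_times_pure tensor_bilinear)
  have c: "commutator ?I (comult_at uq_comult i y) = comult_at uq_comult i (commutator ?D y)" if "i \<in> {1, 2}" for i
  proof -
    have i: "1 \<le> i" "i \<le> 2" and I: "?I = comult_at uq_comult i ?D"
      using that iter_comult_2 by auto
    have diff: "comult_at uq_comult i (u - v) = comult_at uq_comult i u - comult_at uq_comult i v" for u v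
      using comult_at_uq_linear(1)[of i "u - v" v] by simp
    show ?thesis
      unfolding commutator_def I diff comult_at_times[OF uq_comult(8) y(1) i]
          comult_at_times[OF y(1) uq_comult(8) i] ..
  qed
  show ?thesis
    unfolding cobar_2 commutator_linear l r using c by simp
qed

lemma commutator_cobar_1:
  assumes h: "skew_primitive h" and a: "uK * a = a * uK"
  shows "commutator (uq_comult h) (cobar 1 1 (Suc 0) (pure [a])) = cobar 1 uK (Suc 0) (pure [h * a - a * h])"
proof -
  have D: "uq_comult h = pure [1, h] + pure [h, uK]" using h by (simp add: skew_primitive_def)
  have "uq_comult (h * a - a * h) = uq_comult h * uq_comult a - uq_comult a * uq_comult h"
    using uq_comult(1)[of "h * a - a * h" "a * h"] by (simp add: uq_comult)
  then show ?thesis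
    unfolding commutator_def cobar_1
    by (simp add: D right_diff_distrib left_diff_distrib distrib_left distrib_right
        pure_times_pure pure_2 a algebra_simps)
qed

text \<open>All mixed terms contain \<open>K b + b K\<close> or \<open>K h + h K\<close> and drop out.\<close>

lemma anticommutator_cobar_1:
  assumes h: "skew_primitive h" and b: "uK * b = - (b * uK)"
  shows "uq_comult h * cobar 1 uK (Suc 0) (pure [b]) + cobar 1 uK (Suc 0) (pure [b]) * uq_comult h
     = cobar 1 (uK ^ 2) (Suc 0) (pure [h * b + b * h])"
proof -
  have D: "uq_comult h = pure [1, h] + pure [h, uK]" and K: "uK * h = - (h * uK)"
    using h by (simp_all add: skew_primitive_def)
  have "uq_comult (h * b + b * h) = uq_comult h * uq_comult b + uq_comult b * uq_comult h"
    by (simp add: uq_comult)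
  then show ?thesis
    unfolding cobar_1
    by (simp add: D right_diff_distrib left_diff_distrib distrib_left distrib_right pure_times_pure pure_2 b K
        power2_eq_square algebra_simps)
qed

section \<open>Transgression of cocycles of degree three\<close>

text \<open>The cocycle \<open>x\<close> is a differential in the full cobar complex, and \<open>b\<^sub>E\<close>, \<open>b\<^sub>G\<close> measure the
  failure of a preimage \<open>y\<close> of \<open>x\<close> to commute with \<open>\<Delta> E\<close> and \<open>\<Delta> G\<close>.\<close>

definition transgresses :: "uq tens \<Rightarrow> uq \<Rightarrow> uq \<Rightarrow> bool" where
  "transgresses x b\<^sub>E b\<^sub>G \<longleftrightarrow> (\<exists>y \<in> tensor_power 2. diagonal_K 2 1 * y = y * diagonal_K 2 1 \<and> cobar 1 1 2 y = x
     \<and> commutator (uq_comult uE) y = cobar 1 uK (Suc 0) (pure [b\<^sub>E])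
     \<and> commutator (uq_comult uG) y = cobar 1 uK (Suc 0) (pure [b\<^sub>G]))"

lemma transgresses_add:
  assumes "transgresses x b c" "transgresses x' b' c'"
  shows "transgresses (x + x') (b + b') (c + c')"
proof -
  from assms obtain y y' where "y \<in> tensor_power 2" "diagonal_K 2 1 * y = y * diagonal_K 2 1"
      "cobar 1 1 2 y = x"
    "commutator (uq_comult uE) y = cobar 1 uK (Suc 0) (pure [b])"
        "commutator (uq_comult uG) y = cobar 1 uK (Suc 0) (pure [c])"
    "y' \<in> tensor_power 2" "diagonal_K 2 1 * y' = y' * diagonal_K 2 1" "cobar 1 1 2 y' = x'"
    "commutator (uq_comult uE) y' = cobar 1 uK (Suc 0) (pure [b'])"
        "commutator (uq_comult uG) y' = cobar 1 uK (Suc 0) (pure [c'])"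
    unfolding transgresses_def by blast
  then show ?thesis
    unfolding transgresses_def
    by (intro bexI[of _ "y + y'"])
      (simp_all add: commutator_linear cobar_linear times_tens_bilinear pure_1 tensor_power_add)
qed

lemma transgresses_scale:
  assumes "transgresses x b c"
  shows "transgresses (s *\<^sub>C x) (s *\<^sub>C b) (s *\<^sub>C c)"
proof -
  from assms obtain y where "y \<in> tensor_power 2" "diagonal_K 2 1 * y = y * diagonal_K 2 1" "cobar 1 1 2 y = x"
    "commutator (uq_comult uE) y = cobar 1 uK (Suc 0) (pure [b])"
        "commutator (uq_comult uG) y = cobar 1 uK (Suc 0) (pure [c])"
    unfolding transgresses_def by blast
  then show ?thesis
    unfolding transgresses_def
    by (intro bexI[of _ "s *\<^sub>C y"])
      (simp_all add: commutator_linear cobar_linear times_tens_bilinear pure_1 tensor_power_scale)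
qed

lemma cobar_0_boundary:
  assumes "z \<in> cobar_boundaries (uK ^ j) (uK ^ m) (Suc 0)"
  obtains s where "z = pure [s *\<^sub>C (uK ^ j - uK ^ m)]"
proof -
  from assms obtain c where "c \<in> tensor_power 0" "z = cobar (uK ^ j) (uK ^ m) 0 c" by auto
  moreover from this(1) obtain s where "c = s *\<^sub>C pure []" by (rule tensor_power_0E)
  ultimately show thesis using that by (simp add: cobar_0)
qed

lemma cobar_1_boundary:
  assumes "z \<in> cobar_boundaries l g (Suc (Suc 0))"
  obtains a where "z = cobar l g (Suc 0) (pure [a])"
  using assms by (auto elim!: tensor_power_1E)

text \<open>The commutator of \<open>x\<close> with the iterated coproduct of \<open>h\<close> is the square of a differential
  applied to \<open>b\<^sub>h\<close>.\<close>

lemma cocycle_of_transgresses: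
  assumes "transgresses x b\<^sub>E b\<^sub>G"
  shows "x \<in> DY_cocycles uq_comult 3"
proof -
  from assms obtain y where y: "y \<in> tensor_power 2" "diagonal_K 2 1 * y = y * diagonal_K 2 1"
    and x: "x = cobar 1 1 2 y"
    and E: "commutator (uq_comult uE) y = cobar 1 uK (Suc 0) (pure [b\<^sub>E])"
    and G: "commutator (uq_comult uG) y = cobar 1 uK (Suc 0) (pure [b\<^sub>G])"
    unfolding transgresses_def by blast
  have p1: "pure [b] \<in> tensor_power (Suc 0)" for b :: uq by (simp add: pure_in_tensor_power)
  have dd: "cobar 1 1 3 (cobar 1 1 2 y) = 0" "cobar 1 uK 2 (cobar 1 uK (Suc 0) (pure [b])) = 0" for b
    using cobar_cobar[OF y(1), of 0 0] cobar_cobar[OF p1, of 0 1 b]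
        by (simp_all add: numeral_2_eq_2 numeral_3_eq_3)
  have x3: "x \<in> tensor_power 3"
  proof -
    have "pure [1] \<otimes>\<^sub>T y \<in> tensor_power 3" "y \<otimes>\<^sub>T pure [1] \<in> tensor_power 3"
      using tensor_in_tensor_power[OF p1 y(1)] tensor_in_tensor_power[OF y(1) p1]
      by (simp_all add: numeral_2_eq_2 numeral_3_eq_3)
    then show ?thesis
      unfolding x cobar_2
      using comult_at_in_tensor_power[OF y(1), of 1] comult_at_in_tensor_power[OF y(1), of 2]
      by (auto intro!: tensor_power_intros)
  qed
  have "conj_K 2 y = y" using y commutes_K_iff by blast
  then have "conj_K 3 x = x" using cobar_conj_K[OF y(1), of 0 0] by (simp add: x)
  then have "x * iter_comult uq_comult 2 uK = iter_comult uq_comult 2 uK * x"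
    using commutes_K_iff[OF x3] iter_comult_uK_pow[of 2 1] by simp
  moreover have "x * iter_comult uq_comult 2 h = iter_comult uq_comult 2 h * x"
    if "skew_primitive h" "commutator (uq_comult h) y = cobar 1 uK (Suc 0) (pure [b])" for h b
    using commutator_cobar_2[OF that(1) y] unfolding that(2) dd x[symmetric] by (simp add: commutator_def)
  ultimately have "x \<in> DY_cochains uq_comult (Suc 2)"
    using x3 skew_primitive_uE skew_primitive_uG E G by (intro DY_cochainsI) auto
  then show ?thesis
    using dd(1) by (simp add: DY_cocycles_def DY_diff_eq_cobar x)
qed

lemma half_scaleC_double: "(1 / 2) *\<^sub>C (x + x) = x" for x :: "'a :: complex_vector"
proof -
  have "(1 / 2) *\<^sub>C (x + x) = (1 / 2 + 1 / 2) *\<^sub>C x" by (simp only: scaleC_add_left scaleC_add_right)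
  then show ?thesis by (simp add: scaleC_one)
qed

text \<open>A preimage under the differential can be averaged over the conjugation, with sign \<open>s\<close>.\<close>

lemma cobar_parity:
  assumes "z \<in> tensor_power n" "conj_K (Suc n) (cobar (uK ^ j) (uK ^ m) n z) = s *\<^sub>C cobar (uK ^ j) (uK ^ m) n z"
    and "s * s = 1"
  obtains z' where "z' \<in> tensor_power n" "conj_K n z' = s *\<^sub>C z'"
    "cobar (uK ^ j) (uK ^ m) n z' = cobar (uK ^ j) (uK ^ m) n z"
proof
  define z' where "z' = (1 / 2) *\<^sub>C (z + s *\<^sub>C conj_K n z)"
  show "z' \<in> tensor_power n"
    unfolding z'_def by (intro tensor_power_intros conj_K_in_tensor_power assms(1))
  have linear: "conj_K n (c *\<^sub>C (u + s *\<^sub>C v)) = c *\<^sub>C (conj_K n u + s *\<^sub>C conj_K n v)" for c u v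
    by (simp add: conj_K_def times_tens_bilinear)
  show "conj_K n z' = s *\<^sub>C z'"
    unfolding z'_def linear conj_K_conj_K[OF assms(1)]
    by (simp add: scaleC_add_right scaleC_scaleC assms(3) add.commute mult.left_commute scaleC_one)
  show "cobar (uK ^ j) (uK ^ m) n z' = cobar (uK ^ j) (uK ^ m) n z"
    unfolding z'_def cobar_linear cobar_conj_K[OF assms(1)] assms(2)
    by (simp only: scaleC_scaleC assms(3) scaleC_one half_scaleC_double)
qed

lemma conj_K_1:
  assumes "conj_K (Suc 0) (pure [b]) = s *\<^sub>C pure [b]"
  shows "uK * b = s *\<^sub>C (b * uK)"
proof -
  have "uK * b * uK ^ 3 = s *\<^sub>C b"
    using assms by (simp add: conj_K_def pure_times_pure pure_1_eq_iff flip: pure_1)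
  then have "uK * b * uK ^ 3 * uK = s *\<^sub>C (b * uK)" by (simp add: mult_scaleC_left)
  moreover have "uK ^ 3 * uK = 1" using uK_pow_4 by (simp add: power_numeral_reduce mult.assoc)
  ultimately show ?thesis by (simp add: mult.assoc)
qed

text \<open>The commutator is a cocycle of degree \<open>2\<close> with twists \<open>1\<close> and \<open>K\<close>, hence a boundary. It is
  odd because \<open>h\<close> is odd and \<open>y\<close> is even, so that an odd preimage exists.\<close>

lemma commutator_primitive:
  assumes h: "skew_primitive h" and y: "y \<in> tensor_power 2" "diagonal_K 2 1 * y = y * diagonal_K 2 1"
    and central: "commutator (iter_comult uq_comult 2 h) (cobar 1 1 2 y) = 0"
  obtains b where "uK * b = - (b * uK)" "commutator (uq_comult h) y = cobar 1 uK (Suc 0) (pure [b])"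
proof -
  let ?a = "commutator (uq_comult h) y"
  have D: "uq_comult h = pure [1, h] + pure [h, uK]" and K: "uK * h = - (h * uK)"
    using h by (simp_all add: skew_primitive_def)
  have a2: "?a \<in> tensor_power 2"
    unfolding commutator_def by (intro tensor_power_intros tensor_power_times uq_comult(8) y)
  have "cobar (uK ^ 0) (uK ^ 1) 2 ?a = 0"
    using commutator_cobar_2[OF h y] central by simp
  from cobar_exact[OF a2 this] have "?a \<in> cobar_boundaries 1 uK (Suc (Suc 0))"
    by (simp add: numeral_2_eq_2)
  then obtain b0 where "?a = cobar 1 uK (Suc 0) (pure [b0])"
    by (rule cobar_1_boundary)
  then have b0: "?a = cobar (uK ^ 0) (uK ^ 1) (Suc 0) (pure [b0])" by simp
  have "diagonal_K 2 1 * uq_comult h = - (uq_comult h * diagonal_K 2 1)"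
    unfolding D by (simp add: numeral_2_eq_2 times_tens_bilinear pure_times_pure K pure_2)
  note KD = this
  have "diagonal_K 2 1 * (uq_comult h * y) = - (uq_comult h * y * diagonal_K 2 1)"
    by (simp only: mult.assoc[symmetric] KD) (simp only: mult_minus_left mult.assoc y(2))
  moreover have "diagonal_K 2 1 * (y * uq_comult h) = - (y * uq_comult h * diagonal_K 2 1)"
    by (simp only: mult.assoc[symmetric] y(2)) (simp only: mult.assoc KD mult_minus_right)
  ultimately have "diagonal_K 2 1 * ?a = - (?a * diagonal_K 2 1)"
    unfolding commutator_def by (simp only: right_diff_distrib left_diff_distrib minus_diff_eq) simp
  then have "conj_K 2 ?a = - (?a * (diagonal_K 2 1 * diagonal_K 2 3))"
    unfolding conj_K_def by (simp add: mult.assoc)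
  also have "\<dots> = (- 1) *\<^sub>C ?a"
    using diagonal_K_times[of 2 1 3] diagonal_K_4(2)[OF a2] by simp
  finally obtain z where z: "z \<in> tensor_power (Suc 0)" "conj_K (Suc 0) z = (- 1) *\<^sub>C z"
      "cobar (uK ^ 0) (uK ^ 1) (Suc 0) z = ?a"
    using cobar_parity[of "pure [b0]" "Suc 0" 0 1 "-1"] b0
    by (auto simp: pure_in_tensor_power numeral_2_eq_2)
  obtain b where b: "z = pure [b]" using z(1) by (rule tensor_power_1E)
  show thesis
    using conj_K_1[of b "-1"] z by (intro that[of b]) (simp_all add: b)
qed

text \<open>The commutator with \<open>y\<close> is a derivation, and \<open>h h' + h' h\<close> is sent to \<open>0\<close> since it is a
  multiple of \<open>1 - K\<^sup>2\<close>. So the anticommutator is a cocycle of degree \<open>1\<close> with twists \<open>1\<close> and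
  \<open>K\<^sup>2\<close>, and such cocycles are boundaries of scalars.\<close>

lemma anticommutator_of_transgression:
  assumes h: "skew_primitive h" "skew_primitive h'" and y: "y \<in> tensor_power 2"
    and b: "uK * b = - (b * uK)" "commutator (uq_comult h) y = cobar 1 uK (Suc 0) (pure [b])"
    and b': "uK * b' = - (b' * uK)" "commutator (uq_comult h') y = cobar 1 uK (Suc 0) (pure [b'])"
    and hh: "h * h' + h' * h = t *\<^sub>C (1 - uK ^ 2)"
  obtains s where "h * b' + b' * h + (h' * b + b * h') = s *\<^sub>C (1 - uK ^ 2)"
proof -
  let ?D = "uq_comult h" and ?D' = "uq_comult h'"
  have "cobar 1 (uK ^ 2) (Suc 0) (pure [h * b' + b' * h + (h' * b + b * h')]) =
      ?D * commutator ?D' y + commutator ?D' y * ?D + (?D' * commutator ?D y + commutator ?D y * ?D')"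
    unfolding b(2) b'(2) anticommutator_cobar_1[OF h(1) b'(1)] anticommutator_cobar_1[OF h(2) b(1)]
    by (simp add: pure_1 cobar_linear)
  also have "\<dots> = commutator (uq_comult (h * h' + h' * h)) y"
    unfolding commutator_def uq_comult(1,2) by (simp add: algebra_simps)
  also have "uq_comult (h * h' + h' * h) = t *\<^sub>C (pure (replicate 2 1) - diagonal_K 2 2)"
  proof -
    have "uq_comult (1 - uK ^ 2) = pure [1, 1] - pure [uK ^ 2, uK ^ 2]"
      using uq_comult(1)[of "1 - uK ^ 2" "uK ^ 2"] by (simp add: uq_comult(4) comult_monomials)
    moreover have "pure (replicate 2 1) = pure [1, 1 :: uq]" "diagonal_K 2 2 = pure [uK ^ 2, uK ^ 2]"
      by (simp_all add: numeral_2_eq_2)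
    ultimately show ?thesis by (simp only: hh uq_comult(3))
  qed
  also have "commutator \<dots> y = 0"
    using tensor_power_one[OF y] diagonal_K_2_central[OF y]
    by (simp add: commutator_def times_tens_bilinear left_diff_distrib right_diff_distrib)
  finally have "cobar (uK ^ 0) (uK ^ 2) (Suc 0) (pure [h * b' + b' * h + (h' * b + b * h')]) = 0" by simp
  from cobar_exact[OF pure_in_tensor_power this]
  have "pure [h * b' + b' * h + (h' * b + b * h')] \<in> cobar_boundaries (uK ^ 0) (uK ^ 2) (Suc 0)" by simp
  then obtain s where "pure [h * b' + b' * h + (h' * b + b * h')] = pure [s *\<^sub>C (uK ^ 0 - uK ^ 2)]"
    by (rule cobar_0_boundary)
  then show thesis using that by (simp only: pure_1_eq_iff power_0)
qed

lemma even_or_odd_form: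
  assumes "uK * b = s *\<^sub>C (b * uK)" "s = 1 \<or> s = -1"
  shows "s = 1 \<Longrightarrow> b = (\<Sum>j<4. coord False False j b *\<^sub>C uK ^ j + coord True True j b *\<^sub>C (uE * (uG * uK ^ j)))"
    and "s = -1 \<Longrightarrow> b = (\<Sum>j<4. coord True False j b *\<^sub>C (uE * uK ^ j) + coord False True j b *\<^sub>C (uG * uK ^ j))"
proof -
  define A where "A = (\<Sum>j<4. coord False False j b *\<^sub>C uK ^ j + coord True True j b *\<^sub>C (uE * (uG * uK ^ j)))"
  define B where "B = (\<Sum>j<4. coord True False j b *\<^sub>C (uE * uK ^ j) + coord False True j b *\<^sub>C (uG * uK ^ j))"
  have "A + B = expansion b"
    unfolding expansion_def A_def B_def sum.distrib[symmetric]
    by (rule sum.cong[OF refl]) (simp only: add_ac)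
  then have b: "b = A + B" by (simp add: expansion_eq)
  have K: "uK * uK ^ j = uK ^ j * uK" "uK * (uE * (uG * uK ^ j)) = uE * (uG * uK ^ j) * uK"
    "uK * (uE * uK ^ j) = - (uE * uK ^ j * uK)" "uK * (uG * uK ^ j) = - (uG * uK ^ j * uK)" for j
    by (simp_all only: generator_times_monomial power_Suc2 mult.assoc)
  have KA: "uK * A = A * uK"
    by (simp add: A_def sum_distrib_left sum_distrib_right distrib_left distrib_right mult_scaleC_left
        mult_scaleC_right K)
  have KB: "uK * B = - (B * uK)"
    unfolding B_def sum_distrib_left sum_distrib_right sum_negf[symmetric]
    by (simp add: distrib_left distrib_right mult_scaleC_left mult_scaleC_right K)
  have cancel: "X = 0" if "X * uK + X * uK = 0" for X
  proof -
    have "X * uK = (1 / 2) *\<^sub>C (X * uK + X * uK)"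
      by (simp only: half_scaleC_double)
    then have "X * uK = 0" using that by simp
    then have "X * (uK * uK ^ 3) = 0" by (simp flip: mult.assoc)
    then show ?thesis using uK_pow_4 by (simp add: power_numeral_reduce)
  qed
  show "b = A" if "s = 1"
  proof -
    have "- (B * uK) = B * uK"
      using assms(1)[unfolded that, unfolded b] KA KB by (simp add: scaleC_one distrib_left distrib_right)
    then have "B * uK + B * uK = 0" by (metis add.left_inverse)
    then have "B = 0" by (rule cancel)
    then show ?thesis using b by simp
  qed
  show "b = B" if "s = -1"
  proof -
    have "- (A * uK) = A * uK"
      using assms(1)[unfolded that, unfolded b] KA KB by (simp add: scaleC_one distrib_left distrib_right)
    then have "A * uK + A * uK = 0" by (metis add.left_inverse)
    then have "A = 0" by (rule cancel)
    then show ?thesis using b by simp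
  qed
qed

lemma brackets:
  "uE * uK ^ j - uK ^ j * uE = (1 - (-1) ^ j) *\<^sub>C (uE * uK ^ j)"
  "uG * uK ^ j - uK ^ j * uG = (1 - (-1) ^ j) *\<^sub>C (uG * uK ^ j)"
  "uE * (uE * (uG * uK ^ j)) - uE * (uG * uK ^ j) * uE
      = (- ((-1) ^ j * \<i> / 2)) *\<^sub>C (uE * uK ^ j - uE * uK ^ (j + 2))"
  "uG * (uE * (uG * uK ^ j)) - uE * (uG * uK ^ j) * uG = (\<i> / 2) *\<^sub>C (uG * uK ^ j - uG * uK ^ (j + 2))"
  "uE * (uE * uK ^ j) + uE * uK ^ j * uE = 0" "uG * (uG * uK ^ j) + uG * uK ^ j * uG = 0"
  "uE * (uG * uK ^ j) + uG * uK ^ j * uE = ((-1) ^ j * \<i> / 2) *\<^sub>C (uK ^ j - uK ^ (j + 2))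
     + (1 - (-1) ^ j) *\<^sub>C (uE * (uG * uK ^ j))"
  "uG * (uE * uK ^ j) + uE * uK ^ j * uG = (\<i> / 2) *\<^sub>C (uK ^ j - uK ^ (j + 2))
     - (1 - (-1) ^ j) *\<^sub>C (uE * (uG * uK ^ j))"
proof -
  note s = mult.assoc uK_pow_uE uK_pow_uG mult_scaleC_right generator_times_monomial(5-8)
      right_diff_distrib complex_vector.scale_right_diff_distrib complex_vector.scale_left_diff_distrib
          scaleC_scaleC scaleC_one
  show "uE * uK ^ j - uK ^ j * uE = (1 - (-1) ^ j) *\<^sub>C (uE * uK ^ j)"
    by (simp only: s)
  show "uG * uK ^ j - uK ^ j * uG = (1 - (-1) ^ j) *\<^sub>C (uG * uK ^ j)"
    by (simp only: s)
  show "uE * (uE * (uG * uK ^ j)) - uE * (uG * uK ^ j) * uE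
      = (- ((-1) ^ j * \<i> / 2)) *\<^sub>C (uE * uK ^ j - uE * uK ^ (j + 2))"
    by (simp only: s) (simp add: generator_times_monomial(5,6) uE_uE uG_uG)
  show "uG * (uE * (uG * uK ^ j)) - uE * (uG * uK ^ j) * uG = (\<i> / 2) *\<^sub>C (uG * uK ^ j - uG * uK ^ (j + 2))"
    by (simp only: s) (simp add: generator_times_monomial(5,6) uE_uE uG_uG)
  show "uE * (uE * uK ^ j) + uE * uK ^ j * uE = 0"
    by (simp only: s) (simp add: generator_times_monomial(5,6) uE_uE uG_uG)
  show "uG * (uG * uK ^ j) + uG * uK ^ j * uG = 0"
    by (simp only: s) (simp add: generator_times_monomial(5,6) uE_uE uG_uG)
  show "uE * (uG * uK ^ j) + uG * uK ^ j * uE = ((-1) ^ j * \<i> / 2) *\<^sub>C (uK ^ j - uK ^ (j + 2))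
     + (1 - (-1) ^ j) *\<^sub>C (uE * (uG * uK ^ j))"
    by (simp only: s) (simp add: generator_times_monomial(5,6) uE_uE uG_uG)
  show "uG * (uE * uK ^ j) + uE * uK ^ j * uG = (\<i> / 2) *\<^sub>C (uK ^ j - uK ^ (j + 2))
     - (1 - (-1) ^ j) *\<^sub>C (uE * (uG * uK ^ j))"
    by (simp only: s) (simp add: generator_times_monomial(5,6) uE_uE uG_uG)
qed

text \<open>Exactness in degree \<open>3\<close> with trivial twists gives a preimage of \<open>x\<close>, which can be taken
  even.\<close>

lemma cocycle_transgresses:
  assumes "x \<in> DY_cocycles uq_comult 3"
  obtains b\<^sub>E b\<^sub>G s\<^sub>E s\<^sub>G s where "transgresses x b\<^sub>E b\<^sub>G" "uK * b\<^sub>E = - (b\<^sub>E * uK)" "uK * b\<^sub>G = - (b\<^sub>G * uK)"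
    "uE * b\<^sub>E + b\<^sub>E * uE = s\<^sub>E *\<^sub>C (1 - uK ^ 2)" "uG * b\<^sub>G + b\<^sub>G * uG = s\<^sub>G *\<^sub>C (1 - uK ^ 2)"
    "uE * b\<^sub>G + b\<^sub>G * uE + (uG * b\<^sub>E + b\<^sub>E * uG) = s *\<^sub>C (1 - uK ^ 2)"
proof -
  have "x \<in> DY_cochains uq_comult (Suc 2)" and d: "cobar 1 1 3 x = 0"
    using assms by (simp_all add: DY_cocycles_def DY_diff_eq_cobar)
  then have x3: "x \<in> tensor_power 3"
    and comm: "x * iter_comult uq_comult 2 h = iter_comult uq_comult 2 h * x" for h
    unfolding DY_cochains.simps by simp_all
  have "x \<in> cobar_boundaries (uK ^ 0) (uK ^ 0) (Suc 2)"
    using cobar_exact[of x 3 0 0] x3 d by simp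
  then obtain y0 where y0: "y0 \<in> tensor_power 2" "x = cobar (uK ^ 0) (uK ^ 0) 2 y0"
    unfolding cobar_boundaries.simps by blast
  have "conj_K 3 x = x"
    using commutes_K_iff[OF x3] comm[of uK] iter_comult_uK_pow[of 2 1] by simp
  then obtain y where y: "y \<in> tensor_power 2" "conj_K 2 y = y" "cobar 1 1 2 y = x"
    using cobar_parity[OF y0(1), of 0 0 1] y0(2) by (auto simp: scaleC_one)
  have even: "diagonal_K 2 1 * y = y * diagonal_K 2 1" using commutes_K_iff[OF y(1)] y(2) by blast
  have 0: "commutator (iter_comult uq_comult 2 h) (cobar 1 1 2 y) = 0" for h
    using comm by (simp add: commutator_def y)
  obtain b\<^sub>E where E: "uK * b\<^sub>E = - (b\<^sub>E * uK)" "commutator (uq_comult uE) y = cobar 1 uK (Suc 0) (pure [b\<^sub>E])"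
    using commutator_primitive[OF skew_primitive_uE y(1) even 0] .
  obtain b\<^sub>G where G: "uK * b\<^sub>G = - (b\<^sub>G * uK)" "commutator (uq_comult uG) y = cobar 1 uK (Suc 0) (pure [b\<^sub>G])"
    using commutator_primitive[OF skew_primitive_uG y(1) even 0] .
  have tr: "transgresses x b\<^sub>E b\<^sub>G"
    unfolding transgresses_def using y even E G by blast
  have hh: "uE * uE + uE * uE = 0 *\<^sub>C (1 - uK ^ 2)" "uG * uG + uG * uG = 0 *\<^sub>C (1 - uK ^ 2)"
    "uE * uG + uG * uE = (\<i> / 2) *\<^sub>C (1 - uK ^ 2)"
    by (simp_all add: uE_uE uG_uG uG_uE)
  have half: "u = (s / 2) *\<^sub>C v" if "u + u = s *\<^sub>C v" for u v :: uq and s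
    using arg_cong[OF that, of "\<lambda>w. (1 / 2) *\<^sub>C w"] by (simp add: half_scaleC_double scaleC_scaleC)
  obtain s\<^sub>E where "uE * b\<^sub>E + b\<^sub>E * uE + (uE * b\<^sub>E + b\<^sub>E * uE) = s\<^sub>E *\<^sub>C (1 - uK ^ 2)"
    using anticommutator_of_transgression[OF skew_primitive_uE skew_primitive_uE y(1) E E hh(1)] .
  moreover obtain s\<^sub>G where "uG * b\<^sub>G + b\<^sub>G * uG + (uG * b\<^sub>G + b\<^sub>G * uG) = s\<^sub>G *\<^sub>C (1 - uK ^ 2)"
    using anticommutator_of_transgression[OF skew_primitive_uG skew_primitive_uG y(1) G G hh(2)] .
  moreover obtain s where "uE * b\<^sub>G + b\<^sub>G * uE + (uG * b\<^sub>E + b\<^sub>E * uG) = s *\<^sub>C (1 - uK ^ 2)"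
    using anticommutator_of_transgression[OF skew_primitive_uE skew_primitive_uG y(1) E G hh(3)] .
  ultimately show thesis
    using half by (intro that[OF tr E(1) G(1)]) blast+
qed

lemma skew_primitive_cocycle:
  "cobar 1 uK (Suc 0) (pure [s *\<^sub>C (1 - uK) + \<alpha> *\<^sub>C uE + \<beta> *\<^sub>C uG]) = 0"
proof -
  have "cobar 1 uK (Suc 0) (pure [h]) = 0" if "h \<in> {1 - uK, uE, uG}" for h
    using that skew_primitive_uE skew_primitive_uG uq_comult(1)[of "1 - uK" uK]
    by (auto simp: cobar_1 skew_primitive_def uq_comult pure_2)
  then show ?thesis by (simp only: pure_1(1,2) cobar_linear insert_iff simp_thms) simp
qed

text \<open>Let \<open>x\<close> be the differential of a cochain \<open>z\<close> that commutes with the coproduct. Any other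
  even preimage of \<open>x\<close> differs from \<open>z\<close> by the differential of some \<open>a\<close>, and its commutators are
  those of that differential. The elements \<open>b\<^sub>h\<close> are determined by them up to cocycles of degree
  \<open>1\<close>.\<close>

lemma transgresses_coboundary:
  assumes "x \<in> DY_coboundaries uq_comult 3" "transgresses x b\<^sub>E b\<^sub>G"
  obtains a s\<^sub>E \<alpha>\<^sub>E \<beta>\<^sub>E s\<^sub>G \<alpha>\<^sub>G \<beta>\<^sub>G where "uK * a = a * uK"
    "b\<^sub>E = uE * a - a * uE + (s\<^sub>E *\<^sub>C (1 - uK) + \<alpha>\<^sub>E *\<^sub>C uE + \<beta>\<^sub>E *\<^sub>C uG)"
    "b\<^sub>G = uG * a - a * uG + (s\<^sub>G *\<^sub>C (1 - uK) + \<alpha>\<^sub>G *\<^sub>C uE + \<beta>\<^sub>G *\<^sub>C uG)"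
proof -
  have "x \<in> DY_coboundaries uq_comult (Suc 2)" using assms(1) by simp
  then obtain z where "z \<in> DY_cochains uq_comult (Suc 1)" and xz: "x = cobar 1 1 2 z"
    unfolding DY_coboundaries.simps DY_diff_eq_cobar by (auto simp: numeral_2_eq_2)
  then have z: "z \<in> tensor_power 2" and comm: "z * uq_comult h = uq_comult h * z" for h
    unfolding DY_cochains.simps iter_comult_1 by (simp_all add: numeral_2_eq_2)
  from assms(2) obtain y where y: "y \<in> tensor_power 2" "diagonal_K 2 1 * y = y * diagonal_K 2 1"
    and xy: "x = cobar 1 1 2 y"
    and E: "commutator (uq_comult uE) y = cobar 1 uK (Suc 0) (pure [b\<^sub>E])"
    and G: "commutator (uq_comult uG) y = cobar 1 uK (Suc 0) (pure [b\<^sub>G])"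
    unfolding transgresses_def by blast
  have "cobar (uK ^ 0) (uK ^ 0) 2 (y - z) = 0" using xy xz by (simp add: cobar_linear)
  from cobar_exact[OF tensor_power_diff[OF y(1) z] this]
  have "y - z \<in> cobar_boundaries 1 1 (Suc (Suc 0))" by (simp add: numeral_2_eq_2)
  then obtain a0 where a0: "y - z = cobar 1 1 (Suc 0) (pure [a0])" by (rule cobar_1_boundary)
  have "conj_K 2 (y - z) = y - z"
  proof -
    have "uq_comult uK = diagonal_K 2 1" by (simp add: uq_comult numeral_2_eq_2)
    then have "diagonal_K 2 1 * (y - z) = (y - z) * diagonal_K 2 1"
      using y(2) comm[of uK] by (simp only: left_diff_distrib right_diff_distrib)
    then show ?thesis using commutes_K_iff[OF tensor_power_diff[OF y(1) z]] by blast
  qed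
  then obtain w where "w \<in> tensor_power (Suc 0)" "conj_K (Suc 0) w = w" "cobar 1 1 (Suc 0) w = y - z"
    using cobar_parity[of "pure [a0]" "Suc 0" 0 0 1] a0
    by (auto simp: pure_in_tensor_power numeral_2_eq_2 scaleC_one)
  moreover from this(1) obtain a where "w = pure [a]" by (rule tensor_power_1E)
  ultimately have a: "uK * a = a * uK" "y - z = cobar 1 1 (Suc 0) (pure [a])"
    using conj_K_1[of a 1] by (simp_all add: scaleC_one)
  have b: "\<exists>s \<alpha> \<beta>. b = h * a - a * h + (s *\<^sub>C (1 - uK) + \<alpha> *\<^sub>C uE + \<beta> *\<^sub>C uG)"
    if h: "skew_primitive h" "commutator (uq_comult h) y = cobar 1 uK (Suc 0) (pure [b])" for h b
  proof -
    have "commutator (uq_comult h) y = commutator (uq_comult h) (cobar 1 1 (Suc 0) (pure [a]))"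
      using comm[of h] by (simp add: commutator_def right_diff_distrib left_diff_distrib flip: a(2))
    also have "\<dots> = cobar 1 uK (Suc 0) (pure [h * a - a * h])"
      by (rule commutator_cobar_1[OF h(1) a(1)])
    finally have "cobar (uK ^ 0) (uK ^ Suc 0) (Suc 0) (pure [b - (h * a - a * h)]) = 0"
      unfolding h(2) by (simp add: pure_1(4) cobar_linear)
    then obtain s \<alpha> \<beta> where
      "b - (h * a - a * h) = s *\<^sub>C (uK ^ 0 - uK ^ Suc 0) + \<alpha> *\<^sub>C (uE * uK ^ 0) + \<beta> *\<^sub>C (uG * uK ^ 0)"
      by (rule cobar_1_cocycle)
    then have "b = h * a - a * h + (s *\<^sub>C (1 - uK) + \<alpha> *\<^sub>C uE + \<beta> *\<^sub>C uG)"
      by (simp add: diff_eq_eq add.commute)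
    then show ?thesis by blast
  qed
  show thesis
    using b[OF skew_primitive_uE E] b[OF skew_primitive_uG G] that[OF a(1)] by blast
qed

text \<open>Subtracting the differential of \<open>a\<close> from the preimage \<open>y\<close> makes it commute with the
  coproduct.\<close>

lemma coboundary_of_transgresses:
  assumes "transgresses x b\<^sub>E b\<^sub>G" and a: "uK * a = a * uK"
    and b\<^sub>E: "b\<^sub>E = uE * a - a * uE + \<alpha>\<^sub>E *\<^sub>C uE + \<beta>\<^sub>E *\<^sub>C uG"
    and b\<^sub>G: "b\<^sub>G = uG * a - a * uG + \<alpha>\<^sub>G *\<^sub>C uE + \<beta>\<^sub>G *\<^sub>C uG"
  shows "x \<in> DY_coboundaries uq_comult 3"
proof -
  from assms(1) obtain y where y: "y \<in> tensor_power 2" "diagonal_K 2 1 * y = y * diagonal_K 2 1"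
    and x: "x = cobar 1 1 2 y"
    and E: "commutator (uq_comult uE) y = cobar 1 uK (Suc 0) (pure [b\<^sub>E])"
    and G: "commutator (uq_comult uG) y = cobar 1 uK (Suc 0) (pure [b\<^sub>G])"
    unfolding transgresses_def by blast
  have p1: "pure [a] \<in> tensor_power (Suc 0)" by (simp add: pure_in_tensor_power)
  define z where "z = y - cobar 1 1 (Suc 0) (pure [a])"
  have "cobar 1 1 (Suc 0) (pure [a]) \<in> tensor_power 2"
    unfolding cobar_1 by (intro tensor_power_intros pure_in_tensor_power uq_comult(8)) simp_all
  then have z: "z \<in> tensor_power (Suc 1)"
    using y(1) by (simp add: z_def tensor_power_diff numeral_2_eq_2)
  have dz: "x = cobar 1 1 2 z"
    using cobar_cobar[OF p1, of 0 0] by (simp add: z_def x cobar_linear numeral_2_eq_2)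
  have K: "z * iter_comult uq_comult 1 uK = iter_comult uq_comult 1 uK * z"
  proof -
    have "uq_comult uK = diagonal_K 2 1" by (simp add: uq_comult numeral_2_eq_2)
    moreover have "uq_comult uK * cobar 1 1 (Suc 0) (pure [a]) = cobar 1 1 (Suc 0) (pure [a]) * uq_comult uK"
      using arg_cong[OF a, of uq_comult, unfolded uq_comult(2,7)]
      by (simp add: cobar_1 uq_comult(7) distrib_left distrib_right left_diff_distrib right_diff_distrib
          pure_times_pure a)
    ultimately show ?thesis
      unfolding iter_comult_1 z_def using y(2) by (simp only: left_diff_distrib right_diff_distrib)
  qed
  have gen: "z * iter_comult uq_comult 1 h = iter_comult uq_comult 1 h * z"
    if h: "skew_primitive h" "commutator (uq_comult h) y = cobar 1 uK (Suc 0) (pure [b])"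
      and b: "b = h * a - a * h + \<alpha> *\<^sub>C uE + \<beta> *\<^sub>C uG" for h b \<alpha> \<beta>
  proof -
    have "b = (h * a - a * h) + (0 *\<^sub>C (1 - uK) + \<alpha> *\<^sub>C uE + \<beta> *\<^sub>C uG)"
      by (simp add: b)
    then have "cobar 1 uK (Suc 0) (pure [b]) = cobar 1 uK (Suc 0) (pure [h * a - a * h])
        + cobar 1 uK (Suc 0) (pure [0 *\<^sub>C (1 - uK) + \<alpha> *\<^sub>C uE + \<beta> *\<^sub>C uG])"
      by (simp only: pure_1(1)[of "h * a - a * h"] cobar_linear(1))
    then have "commutator (uq_comult h) z = 0"
      unfolding z_def commutator_linear commutator_cobar_1[OF h(1) a] h(2) skew_primitive_cocycle by simp
    then show ?thesis unfolding iter_comult_1 by (simp add: commutator_def)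
  qed
  have "z \<in> DY_cochains uq_comult (Suc 1)"
    using K gen[OF skew_primitive_uE E b\<^sub>E] gen[OF skew_primitive_uG G b\<^sub>G]
    by (intro DY_cochainsI z) auto
  then have "x \<in> DY_coboundaries uq_comult (Suc 2)"
    unfolding DY_coboundaries.simps DY_diff_eq_cobar by (simp add: dz numeral_2_eq_2)
  then show ?thesis by simp
qed

section \<open>Normal form of a transgression\<close>

lemma coord_sum: "coord a b j (\<Sum>i\<in>A. f i) = (\<Sum>i\<in>A. coord a b j (f i))"
  by (induction A rule: infinite_finite_induct) (simp_all add: coord_linear)

lemma even_form:
  assumes "uK * a = a * uK"
  obtains c e where "a = (\<Sum>j<4. c j *\<^sub>C uK ^ j + e j *\<^sub>C (uE * (uG * uK ^ j)))"
  using even_or_odd_form(1)[of a 1] assms by (simp add: scaleC_one)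

lemma odd_form:
  assumes "uK * b = - (b * uK)"
  obtains \<alpha> \<beta> where "b = (\<Sum>j<4. \<alpha> j *\<^sub>C (uE * uK ^ j) + \<beta> j *\<^sub>C (uG * uK ^ j))"
  using even_or_odd_form(2)[of b "-1"] assms by simp

text \<open>These combinations of coordinates vanish on all pairs of commutators \<open>([E, a], [G, a])\<close>
  and read off the three parameters of the normal form of a transgression.\<close>

lemma commutator_even_coords:
  assumes "uK * a = a * uK"
  shows "coord False True 2 (uE * a - a * uE) = 0" "coord True False 2 (uG * a - a * uG) = 0"
    "coord True False 2 (uE * a - a * uE) + coord False True 2 (uG * a - a * uG) = 0"
proof -
  from assms obtain c e where a: "a = (\<Sum>j<4. c j *\<^sub>C uK ^ j + e j *\<^sub>C (uE * (uG * uK ^ j)))"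
    by (rule even_form)
  have E: "uE * a - a * uE = (\<Sum>j<4. c j *\<^sub>C (uE * uK ^ j - uK ^ j * uE)
      + e j *\<^sub>C (uE * (uE * (uG * uK ^ j)) - uE * (uG * uK ^ j) * uE))"
    unfolding a sum_distrib_left sum_distrib_right sum_subtractf[symmetric]
    by (simp only: distrib_left distrib_right mult_scaleC_left mult_scaleC_right
        complex_vector.scale_right_diff_distrib add_diff_add)
  have G: "uG * a - a * uG = (\<Sum>j<4. c j *\<^sub>C (uG * uK ^ j - uK ^ j * uG)
      + e j *\<^sub>C (uG * (uE * (uG * uK ^ j)) - uE * (uG * uK ^ j) * uG))"
    unfolding a sum_distrib_left sum_distrib_right sum_subtractf[symmetric]
    by (simp only: distrib_left distrib_right mult_scaleC_left mult_scaleC_right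
        complex_vector.scale_right_diff_distrib add_diff_add)
  show "coord False True 2 (uE * a - a * uE) = 0" "coord True False 2 (uG * a - a * uG) = 0"
    "coord True False 2 (uE * a - a * uE) + coord False True 2 (uG * a - a * uG) = 0"
    unfolding E G brackets coord_sum coord_linear coord_monomials
    by (simp_all add: sum_lessThan_4)
qed

text \<open>For \<open>j\<close> odd, the coordinates of the anticommutators at \<open>E G K\<^sup>j\<close> make the coefficients of
  \<open>G K\<^sup>j\<close> in \<open>b\<^sub>E\<close> and of \<open>E K\<^sup>j\<close> in \<open>b\<^sub>G\<close> vanish, and those of \<open>E K\<^sup>j\<close> in \<open>b\<^sub>E\<close> and \<open>G K\<^sup>j\<close> in \<open>b\<^sub>G\<close>
  agree; these terms are commutators with \<open>K\<^sup>j\<close>. The commutator with \<open>E G\<close> removes the difference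
  of the coefficients of \<open>E K\<^sup>2\<close> in \<open>b\<^sub>E\<close> and of \<open>G K\<^sup>2\<close> in \<open>b\<^sub>G\<close>.\<close>

lemma transgression_normal_form:
  assumes odd: "uK * b\<^sub>E = - (b\<^sub>E * uK)" "uK * b\<^sub>G = - (b\<^sub>G * uK)"
    and E: "uE * b\<^sub>E + b\<^sub>E * uE = s\<^sub>E *\<^sub>C (1 - uK ^ 2)" and G: "uG * b\<^sub>G + b\<^sub>G * uG = s\<^sub>G *\<^sub>C (1 - uK ^ 2)"
    and EG: "uE * b\<^sub>G + b\<^sub>G * uE + (uG * b\<^sub>E + b\<^sub>E * uG) = s *\<^sub>C (1 - uK ^ 2)"
  obtains a \<beta> \<gamma> \<sigma> \<alpha>\<^sub>E \<beta>\<^sub>E \<alpha>\<^sub>G \<beta>\<^sub>G where "uK * a = a * uK"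
    "b\<^sub>E = \<beta> *\<^sub>C (uG * uK ^ 2) + \<sigma> *\<^sub>C (uE * uK ^ 2) + (uE * a - a * uE + \<alpha>\<^sub>E *\<^sub>C uE + \<beta>\<^sub>E *\<^sub>C uG)"
    "b\<^sub>G = \<gamma> *\<^sub>C (uE * uK ^ 2) + \<sigma> *\<^sub>C (uG * uK ^ 2) + (uG * a - a * uG + \<alpha>\<^sub>G *\<^sub>C uE + \<beta>\<^sub>G *\<^sub>C uG)"
proof -
  obtain \<alpha> \<beta> where b\<^sub>E: "b\<^sub>E = (\<Sum>j<4. \<alpha> j *\<^sub>C (uE * uK ^ j) + \<beta> j *\<^sub>C (uG * uK ^ j))"
    using odd(1) by (rule odd_form)
  obtain \<gamma> \<zeta> where b\<^sub>G: "b\<^sub>G = (\<Sum>j<4. \<gamma> j *\<^sub>C (uE * uK ^ j) + \<zeta> j *\<^sub>C (uG * uK ^ j))"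
    using odd(2) by (rule odd_form)
  have anti: "h * (\<Sum>j<4. \<alpha> j *\<^sub>C (uE * uK ^ j) + \<beta> j *\<^sub>C (uG * uK ^ j)) +
      (\<Sum>j<4. \<alpha> j *\<^sub>C (uE * uK ^ j) + \<beta> j *\<^sub>C (uG * uK ^ j)) * h =
      (\<Sum>j<4. \<alpha> j *\<^sub>C (h * (uE * uK ^ j) + uE * uK ^ j * h) + \<beta> j *\<^sub>C (h * (uG * uK ^ j) + uG * uK ^ j * h))"
    for h \<alpha> \<beta>
    unfolding sum_distrib_left sum_distrib_right sum.distrib[symmetric]
    by (rule sum.cong[OF refl]) (simp only: distrib_left distrib_right mult_scaleC_left mult_scaleC_right
        scaleC_add_right add_ac)
  have top: "coord True True j (s *\<^sub>C (1 - uK ^ 2)) = 0" for s j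
    using coord_monomials(1)[of True True j 0] by (simp add: coord_linear coord_monomials)
  have one: "coord True True j 1 = 0" for j
    using coord_monomials(1)[of True True j 0] by simp
  note expand = b\<^sub>E b\<^sub>G anti top brackets coord_sum coord_linear coord_monomials
  have "\<beta> 1 = 0" using arg_cong[OF E, of "coord True True 1"] unfolding expand by (simp add: sum_lessThan_4 one)
  moreover have "\<beta> 3 = 0" using arg_cong[OF E, of "coord True True 3"] unfolding expand
      by (simp add: sum_lessThan_4 one)
  moreover have "\<gamma> 1 = 0" using arg_cong[OF G, of "coord True True 1"] unfolding expand
      by (simp add: sum_lessThan_4 one)
  moreover have "\<gamma> 3 = 0" using arg_cong[OF G, of "coord True True 3"] unfolding expand
      by (simp add: sum_lessThan_4 one)
  moreover have "\<zeta> 1 = \<alpha> 1" using arg_cong[OF EG, of "coord True True 1"] unfolding expand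
      by (simp add: sum_lessThan_4 one)
  moreover have "\<zeta> 3 = \<alpha> 3" using arg_cong[OF EG, of "coord True True 3"] unfolding expand
      by (simp add: sum_lessThan_4 one)
  ultimately have z: "\<beta> 1 = 0" "\<beta> 3 = 0" "\<gamma> 1 = 0" "\<gamma> 3 = 0" "\<zeta> 1 = \<alpha> 1" "\<zeta> 3 = \<alpha> 3" by simp_all
  define \<sigma> \<rho> where "\<sigma> = (\<alpha> 2 + \<zeta> 2) / 2" and "\<rho> = (\<alpha> 2 - \<zeta> 2) / 2"
  \<comment> \<open>The commutators of \<open>E\<close> with \<open>K\<^sup>j\<close> and \<open>E G\<close> are \<open>2 E K\<^sup>j\<close>, for odd \<open>j\<close>, and \<open>- (\<i> / 2) (E - E K\<^sup>2)\<close>.\<close>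
  define a where "a = (\<alpha> 1 / 2) *\<^sub>C uK ^ 1 + (\<alpha> 3 / 2) *\<^sub>C uK ^ 3 + (- 2 * \<i> * \<rho>) *\<^sub>C (uE * (uG * uK ^ 0))"
  have comm: "h * a - a * h = (\<alpha> 1 / 2) *\<^sub>C (h * uK ^ 1 - uK ^ 1 * h) + (\<alpha> 3 / 2) *\<^sub>C (h * uK ^ 3 - uK ^ 3 * h)
      + (- 2 * \<i> * \<rho>) *\<^sub>C (h * (uE * (uG * uK ^ 0)) - uE * (uG * uK ^ 0) * h)" for h
    unfolding a_def by (simp only: distrib_left distrib_right mult_scaleC_left mult_scaleC_right
        complex_vector.scale_right_diff_distrib add_diff_add)
  have split: "\<alpha> 2 = \<sigma> + \<rho>" "\<zeta> 2 = \<sigma> - \<rho>"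
    by (simp_all add: \<sigma>_def \<rho>_def field_simps)
  have i2: "\<i> * (\<rho> * \<i>) = - \<rho>" by (simp add: mult.left_commute[of \<i> \<rho>])
  note z = z[unfolded One_nat_def] i2
  show thesis
  proof (rule that[of a "\<beta> 2" \<sigma> "\<alpha> 0 + \<rho>" "\<beta> 0" "\<gamma> 2" "\<gamma> 0" "\<zeta> 0 - \<rho>"])
    show "uK * a = a * uK"
      unfolding a_def
      by (simp only: distrib_left distrib_right mult_scaleC_left mult_scaleC_right
          generator_times_monomial(1,4) power_Suc2 mult.assoc)
    show "b\<^sub>E = \<beta> 2 *\<^sub>C (uG * uK ^ 2) + \<sigma> *\<^sub>C (uE * uK ^ 2)
        + (uE * a - a * uE + (\<alpha> 0 + \<rho>) *\<^sub>C uE + \<beta> 0 *\<^sub>C uG)"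
      unfolding b\<^sub>E comm brackets sum_lessThan_4 split
      by (simp add: z scaleC_add_left complex_vector.scale_left_diff_distrib
          complex_vector.scale_right_diff_distrib del: add_2_eq_Suc')
    show "b\<^sub>G = \<gamma> 2 *\<^sub>C (uE * uK ^ 2) + \<sigma> *\<^sub>C (uG * uK ^ 2)
        + (uG * a - a * uG + \<gamma> 0 *\<^sub>C uE + (\<zeta> 0 - \<rho>) *\<^sub>C uG)"
      unfolding b\<^sub>G comm brackets sum_lessThan_4 split
      by (simp add: z scaleC_add_left complex_vector.scale_left_diff_distrib
          complex_vector.scale_right_diff_distrib del: add_2_eq_Suc')
  qed
qed

section \<open>The three cocycles\<close>

lemma uq_comult_zero: "uq_comult 0 = 0" and uq_comult_neg: "uq_comult (- x) = - uq_comult x"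
  using uq_comult(3)[of 0 0] uq_comult(3)[of "-1" x] by simp_all

text \<open>Rewriting rules that bring words in the generators with small exponents to the form of
  monomials.\<close>

lemma uK_powers:
  "uK * uK = uK ^ 2" "uK * uK ^ 2 = uK ^ 3" "uK * uK ^ 3 = 1" "uK ^ 2 * uK = uK ^ 3" "uK ^ 2 * uK ^ 2 = 1"
  "uK ^ 2 * uK ^ 3 = uK" "uK ^ 3 * uK = 1" "uK ^ 3 * uK ^ 2 = uK" "uK ^ 3 * uK ^ 3 = uK ^ 2"
  "uK ^ 4 = 1" "uK ^ 5 = uK" "uK ^ 6 = uK ^ 2"
proof -
  have *: "uK ^ i * uK ^ j = uK ^ ((i + j) mod 4)" for i j
    by (simp only: uK_pow_mod power_add)
  show "uK * uK = uK ^ 2" "uK * uK ^ 2 = uK ^ 3" "uK * uK ^ 3 = 1" "uK ^ 2 * uK = uK ^ 3" "uK ^ 2 * uK ^ 2 = 1"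
    "uK ^ 2 * uK ^ 3 = uK" "uK ^ 3 * uK = 1" "uK ^ 3 * uK ^ 2 = uK" "uK ^ 3 * uK ^ 3 = uK ^ 2"
    using *[of 1 1] *[of 1 2] *[of 1 3] *[of 2 1] *[of 2 2] *[of 2 3] *[of 3 1] *[of 3 2] *[of 3 3]
    by (simp_all only: power_one_right) (simp_all add: power2_eq_square)
  show "uK ^ 4 = 1" "uK ^ 5 = uK" "uK ^ 6 = uK ^ 2"
    using uK_pow_mod[of 4] uK_pow_mod[of 5] uK_pow_mod[of 6] by simp_all
qed

lemma monomial_products:
  "uK * (uE * z) = - (uE * (uK * z))" "uK * (uG * z) = - (uG * (uK * z))"
  "uK ^ 2 * (uE * z) = uE * (uK ^ 2 * z)" "uK ^ 2 * (uG * z) = uG * (uK ^ 2 * z)"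
  "uK ^ 3 * (uE * z) = - (uE * (uK ^ 3 * z))" "uK ^ 3 * (uG * z) = - (uG * (uK ^ 3 * z))"
  "uK ^ 2 * uE = uE * uK ^ 2" "uK ^ 2 * uG = uG * uK ^ 2" "uK ^ 3 * uE = - (uE * uK ^ 3)"
      "uK ^ 3 * uG = - (uG * uK ^ 3)"
  "uG * (uE * z) = (\<i> / 2) *\<^sub>C (z - uK ^ 2 * z) - uE * (uG * z)" "uE * (uE * z) = 0" "uG * (uG * z) = 0"
proof -
  show 1: "uK ^ 2 * uE = uE * uK ^ 2" "uK ^ 2 * uG = uG * uK ^ 2" "uK ^ 3 * uE = - (uE * uK ^ 3)"
      "uK ^ 3 * uG = - (uG * uK ^ 3)"
    using uK_pow_uE[of 2] uK_pow_uG[of 2] uK_pow_uE[of 3] uK_pow_uG[of 3] by (simp_all add: scaleC_one)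
  show "uK * (uE * z) = - (uE * (uK * z))" "uK * (uG * z) = - (uG * (uK * z))"
    "uK ^ 2 * (uE * z) = uE * (uK ^ 2 * z)" "uK ^ 2 * (uG * z) = uG * (uK ^ 2 * z)"
    "uK ^ 3 * (uE * z) = - (uE * (uK ^ 3 * z))" "uK ^ 3 * (uG * z) = - (uG * (uK ^ 3 * z))"
    "uG * (uE * z) = (\<i> / 2) *\<^sub>C (z - uK ^ 2 * z) - uE * (uG * z)" "uE * (uE * z) = 0" "uG * (uG * z) = 0"
    by (simp_all only: mult.assoc[symmetric] uK_uE uK_uG 1 uG_uE uE_uE uG_uG left_diff_distrib mult_scaleC_left
        mult_minus_left mult_zero_left mult_1_left)
qed

lemma comult_low_monomials:
  "uq_comult uE = pure [1] \<otimes>\<^sub>T pure [uE] + pure [uE] \<otimes>\<^sub>T pure [uK]"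
  "uq_comult (uE * uK) = pure [uK] \<otimes>\<^sub>T pure [uE * uK] + pure [uE * uK] \<otimes>\<^sub>T pure [uK ^ 2]"
  "uq_comult (uE * uK ^ 2) = pure [uK ^ 2] \<otimes>\<^sub>T pure [uE * uK ^ 2] + pure [uE * uK ^ 2] \<otimes>\<^sub>T pure [uK ^ 3]"
  "uq_comult (uE * uK ^ 3) = pure [uK ^ 3] \<otimes>\<^sub>T pure [uE * uK ^ 3] + pure [uE * uK ^ 3] \<otimes>\<^sub>T pure [1]"
  "uq_comult uG = pure [1] \<otimes>\<^sub>T pure [uG] + pure [uG] \<otimes>\<^sub>T pure [uK]"
  "uq_comult (uG * uK) = pure [uK] \<otimes>\<^sub>T pure [uG * uK] + pure [uG * uK] \<otimes>\<^sub>T pure [uK ^ 2]"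
  "uq_comult (uG * uK ^ 2) = pure [uK ^ 2] \<otimes>\<^sub>T pure [uG * uK ^ 2] + pure [uG * uK ^ 2] \<otimes>\<^sub>T pure [uK ^ 3]"
  "uq_comult (uG * uK ^ 3) = pure [uK ^ 3] \<otimes>\<^sub>T pure [uG * uK ^ 3] + pure [uG * uK ^ 3] \<otimes>\<^sub>T pure [1]"
  using comult_monomials(2)[of 0] comult_monomials(2)[of 1] comult_monomials(2)[of 2] comult_monomials(2)[of 3]
    comult_monomials(3)[of 0] comult_monomials(3)[of 1] comult_monomials(3)[of 2] comult_monomials(3)[of 3]
  by (simp_all add: pure_pair uK_powers uK_pow_4)

lemma cobar_2_pair:
  "cobar 1 1 2 (pure [a] \<otimes>\<^sub>T pure [b]) = pure [1] \<otimes>\<^sub>T pure [a] \<otimes>\<^sub>T pure [b] - uq_comult a \<otimes>\<^sub>T pure [b]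
     + pure [a] \<otimes>\<^sub>T uq_comult b - pure [a] \<otimes>\<^sub>T pure [b] \<otimes>\<^sub>T pure [1]"
  unfolding numeral_2_eq_2 cobar_tensor[where k = 1] cobar_1
      by (simp add: pure_pair tensor_bilinear tensor_assoc)

lemma pair_times: "(pure [a] \<otimes>\<^sub>T pure [b]) * (pure [c] \<otimes>\<^sub>T pure [d]) = pure [a * c] \<otimes>\<^sub>T pure [b * d]"
  by (simp add: tensor_pure pure_times_pure)

lemma pure_triple: "pure [a, b, c] = pure [a] \<otimes>\<^sub>T pure [b] \<otimes>\<^sub>T pure [c]"
  by (simp add: tensor_pure)

lemmas tensor_calculation = uq_comult_zero uq_comult_neg uq_comult(3) pure_pair uK_powers
  monomial_products comult_low_monomials cobar_2_pair pair_times cobar_linear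
  tensor_bilinear tensor_assoc times_tens_bilinear pure_1 scaleC_scaleC scaleC_one scaleC_add_right
  complex_vector.scale_right_diff_distrib left_diff_distrib right_diff_distrib distrib_left distrib_right
  mult.assoc uK_uE uK_uG uE_uE uG_uG uG_uE mult_scaleC_left mult_scaleC_right

text \<open>The preimage \<open>y\<close> is quadratic in \<open>E\<close>, so it commutes with \<open>\<Delta> E\<close>.\<close>

lemma dy_c1_transgresses: "transgresses dy_c1 0 ((- \<i> / 4) *\<^sub>C (uE * uK ^ 2))"
proof -
  define y where "y = (1 / 2) *\<^sub>C (pure [uE] \<otimes>\<^sub>T pure [uE * uK] + pure [uE] \<otimes>\<^sub>T pure [uE * uK ^ 3]
      + pure [uE * uK ^ 2] \<otimes>\<^sub>T pure [uE * uK ^ 3])"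
  have K: "diagonal_K 2 1 = pure [uK] \<otimes>\<^sub>T pure [uK]" by (simp add: tensor_pure numeral_2_eq_2)
  show ?thesis
    unfolding transgresses_def
  proof (intro bexI[of _ y] conjI)
    show "y \<in> tensor_power 2"
      unfolding y_def pure_pair[symmetric] by (intro tensor_power_intros pure_in_tensor_power) simp_all
    show "diagonal_K 2 1 * y = y * diagonal_K 2 1"
      unfolding K y_def by (simp add: tensor_calculation)
    show "cobar 1 1 2 y = dy_c1"
      unfolding dy_c1_def y_def pure_triple uq_e_def uF_eq by (simp add: tensor_calculation)
    show "commutator (uq_comult uE) y = cobar 1 uK (Suc 0) (pure [0])"
      unfolding commutator_def y_def cobar_1 by (simp add: tensor_calculation)
    show "commutator (uq_comult uG) y = cobar 1 uK (Suc 0) (pure [(- \<i> / 4) *\<^sub>C (uE * uK ^ 2)])"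
      unfolding commutator_def y_def cobar_1 by (simp add: tensor_calculation)
  qed
qed

lemma dy_c2_transgresses: "transgresses dy_c2 ((- \<i> / 4) *\<^sub>C (uG * uK ^ 2)) 0"
proof -
  define y where "y = (1 / 2) *\<^sub>C (pure [uG] \<otimes>\<^sub>T pure [uG * uK] + pure [uG] \<otimes>\<^sub>T pure [uG * uK ^ 3]
      + pure [uG * uK ^ 2] \<otimes>\<^sub>T pure [uG * uK ^ 3])"
  have K: "diagonal_K 2 1 = pure [uK] \<otimes>\<^sub>T pure [uK]" by (simp add: tensor_pure numeral_2_eq_2)
  show ?thesis
    unfolding transgresses_def
  proof (intro bexI[of _ y] conjI)
    show "y \<in> tensor_power 2"
      unfolding y_def pure_pair[symmetric] by (intro tensor_power_intros pure_in_tensor_power) simp_all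
    show "diagonal_K 2 1 * y = y * diagonal_K 2 1"
      unfolding K y_def by (simp add: tensor_calculation)
    show "cobar 1 1 2 y = dy_c2"
      unfolding dy_c2_def y_def pure_triple uq_e_def uF_eq by (simp add: tensor_calculation)
    show "commutator (uq_comult uE) y = cobar 1 uK (Suc 0) (pure [(- \<i> / 4) *\<^sub>C (uG * uK ^ 2)])"
      unfolding commutator_def y_def cobar_1 by (simp add: tensor_calculation)
    show "commutator (uq_comult uG) y = cobar 1 uK (Suc 0) (pure [0])"
      unfolding commutator_def y_def cobar_1 by (simp add: tensor_calculation)
  qed
qed

text \<open>Here the preimage is a mixed form in \<open>E\<close> and \<open>G\<close>, and commutators with both are nonzero.\<close>

lemma dy_c3_transgresses: "transgresses dy_c3 ((\<i> / 4) *\<^sub>C (uE * uK ^ 2)) ((\<i> / 4) *\<^sub>C (uG * uK ^ 2))"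
proof -
  define y where "y = (1 / 2) *\<^sub>C (pure [uE * uK ^ 2] \<otimes>\<^sub>T pure [uG * uK] - pure [uG] \<otimes>\<^sub>T pure [uE * uK]
      - pure [uG] \<otimes>\<^sub>T pure [uE * uK ^ 3] - pure [uG * uK ^ 2] \<otimes>\<^sub>T pure [uE * uK ^ 3])"
  have K: "diagonal_K 2 1 = pure [uK] \<otimes>\<^sub>T pure [uK]" by (simp add: tensor_pure numeral_2_eq_2)
  show ?thesis
    unfolding transgresses_def
  proof (intro bexI[of _ y] conjI)
    show "y \<in> tensor_power 2"
      unfolding y_def pure_pair[symmetric] by (intro tensor_power_intros pure_in_tensor_power) simp_all
    show "diagonal_K 2 1 * y = y * diagonal_K 2 1"
      unfolding K y_def by (simp add: tensor_calculation)
    show "cobar 1 1 2 y = dy_c3"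
      unfolding dy_c3_def y_def pure_triple uq_e_def uF_eq by (simp add: tensor_calculation)
    show "commutator (uq_comult uE) y = cobar 1 uK (Suc 0) (pure [(\<i> / 4) *\<^sub>C (uE * uK ^ 2)])"
      unfolding commutator_def y_def cobar_1 by (simp add: tensor_calculation)
    show "commutator (uq_comult uG) y = cobar 1 uK (Suc 0) (pure [(\<i> / 4) *\<^sub>C (uG * uK ^ 2)])"
      unfolding commutator_def y_def cobar_1 by (simp add: tensor_calculation)
  qed
qed

section \<open>The basis of the third cohomology\<close>

text \<open>The coset map is linear, so linear combinations of cosets are cosets of linear
  combinations. The index set keeps track of repetitions before the cosets are known to be
  distinct.\<close>

lemma basis_quotient_space:
  fixes Z B :: "'a :: complex_vector set" and c :: "'i \<Rightarrow> 'a"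
  assumes B: "complex_vector.subspace B" and Z: "complex_vector.subspace Z"
    and V: "vectorspace class_ring (quotient_space Z B)"
    and I: "finite I" and c: "c ` I \<subseteq> Z"
    and span: "\<And>z. z \<in> Z \<Longrightarrow> \<exists>f. z - (\<Sum>i\<in>I. f i *\<^sub>C c i) \<in> B"
    and indep: "\<And>f. (\<Sum>i\<in>I. f i *\<^sub>C c i) \<in> B \<Longrightarrow> \<forall>i\<in>I. f i = 0"
  defines "co \<equiv> \<lambda>z. (+) z ` B"
  shows "inj_on (\<lambda>i. co (c i)) I \<and> vectorspace.basis class_ring (quotient_space Z B) ((\<lambda>i. co (c i)) ` I)"
proof -
  let ?Q = "quotient_space Z B"
  interpret V: vectorspace class_ring ?Q by (rule V)
  note sub = complex_vector.subspace_0[OF B] complex_vector.subspace_add[OF B]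
    complex_vector.subspace_diff[OF B] complex_vector.subspace_scale[OF B] complex_vector.subspace_neg[OF B]
  have co_eq: "co x = co y \<longleftrightarrow> x - y \<in> B" for x y
  proof
    assume "co x = co y"
    moreover have "x \<in> co x" unfolding co_def by (rule image_eqI[OF _ sub(1)]) simp
    ultimately obtain b where "b \<in> B" "x = y + b" unfolding co_def by auto
    then show "x - y \<in> B" by simp
  next
    assume d: "x - y \<in> B"
    have "co x \<subseteq> co y" if "x - y \<in> B" for x y
    proof
      fix w assume "w \<in> co x"
      then obtain b where "b \<in> B" "w = x + b" unfolding co_def by auto
      then have "w = y + ((x - y) + b)" by simp
      then show "w \<in> co y" unfolding co_def using sub(2)[OF that \<open>b \<in> B\<close>] by (rule image_eqI)
    qed
    from this[OF d] this[of y x] sub(5)[OF d] show "co x = co y" by auto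
  qed
  have carrier: "carrier ?Q = co ` Z" by (simp add: quotient_space_def co_def)
  have zero: "\<zero>\<^bsub>?Q\<^esub> = co 0" by (simp add: quotient_space_def co_def)
  have add: "co x \<oplus>\<^bsub>?Q\<^esub> co y = co (x + y)" for x y
  proof -
    have "{u + v | u v. u \<in> co x \<and> v \<in> co y} = co (x + y)"
    proof (intro equalityI subsetI; unfold co_def)
      fix w assume "w \<in> {u + v | u v. u \<in> (+) x ` B \<and> v \<in> (+) y ` B}"
      then obtain b b' where b: "b \<in> B" "b' \<in> B" "w = (x + b) + (y + b')" by blast
      then have "w = (x + y) + (b + b')" by (simp add: algebra_simps)
      then show "w \<in> (+) (x + y) ` B" using sub(2)[OF b(1,2)] by (rule image_eqI)
    next
      fix w assume "w \<in> (+) (x + y) ` B"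
      then obtain b where "b \<in> B" "w = (x + 0) + (y + b)" by (auto simp: add.assoc)
      then show "w \<in> {u + v | u v. u \<in> (+) x ` B \<and> v \<in> (+) y ` B}" using sub(1) by blast
    qed
    then show ?thesis by (simp add: quotient_space_def)
  qed
  have smult: "a \<odot>\<^bsub>?Q\<^esub> co x = co (a *\<^sub>C x)" for a x
  proof -
    have "{a *\<^sub>C u + v | u v. u \<in> co x \<and> v \<in> B} = co (a *\<^sub>C x)"
    proof (intro equalityI subsetI; unfold co_def)
      fix w assume "w \<in> {a *\<^sub>C u + v | u v. u \<in> (+) x ` B \<and> v \<in> B}"
      then obtain b b' where b: "b \<in> B" "b' \<in> B" "w = a *\<^sub>C (x + b) + b'" by blast
      then have "w = a *\<^sub>C x + (a *\<^sub>C b + b')" by (simp add: scaleC_add_right add.assoc)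
      then show "w \<in> (+) (a *\<^sub>C x) ` B" using sub(2)[OF sub(4)[OF b(1)] b(2)] by (rule image_eqI)
    next
      fix w assume "w \<in> (+) (a *\<^sub>C x) ` B"
      then obtain b where "b \<in> B" "w = a *\<^sub>C (x + 0) + b" by auto
      then show "w \<in> {a *\<^sub>C u + v | u v. u \<in> (+) x ` B \<and> v \<in> B}" using sub(1) by blast
    qed
    then show ?thesis by (simp add: quotient_space_def)
  qed
  have Zsum: "(\<Sum>i\<in>J. f i *\<^sub>C c i) \<in> Z" if "J \<subseteq> I" for f J
    using that c by (intro complex_vector.subspace_sum[OF Z] complex_vector.subspace_scale[OF Z]) auto
  have inj: "inj_on (\<lambda>i. co (c i)) I"
  proof (rule inj_onI)
    fix i j assume ij: "i \<in> I" "j \<in> I" "co (c i) = co (c j)"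
    let ?f = "\<lambda>k. (if k = i then 1 else 0) - (if k = j then 1 else 0 :: complex)"
    have "(\<Sum>k\<in>I. ?f k *\<^sub>C c k) = c i - c j"
      using I ij(1,2)
      by (simp add: complex_vector.scale_left_diff_distrib sum_subtractf if_distrib[of "\<lambda>r. r *\<^sub>C _"]
          scaleC_one cong: if_cong)
    then have "\<forall>k\<in>I. ?f k = 0" using ij(3) co_eq by (intro indep) simp
    then show "i = j" using ij by (auto split: if_splits)
  qed
  have lincomb: "V.lincomb a ((\<lambda>i. co (c i)) ` J) = co (\<Sum>i\<in>J. a (co (c i)) *\<^sub>C c i)" if "J \<subseteq> I" for a J
  proof -
    have in_carrier: "a (co (c i)) \<odot>\<^bsub>?Q\<^esub> co (c i) \<in> carrier ?Q" if "i \<in> J" for i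
      using that \<open>J \<subseteq> I\<close> c unfolding smult carrier
      by (intro imageI complex_vector.subspace_scale[OF Z]) auto
    have "V.lincomb a ((\<lambda>i. co (c i)) ` J) = (\<Oplus>\<^bsub>?Q\<^esub>i\<in>J. a (co (c i)) \<odot>\<^bsub>?Q\<^esub> co (c i))"
      unfolding V.lincomb_def
      using in_carrier inj_on_subset[OF inj that] by (subst V.finsum_reindex) auto
    also have "\<dots> = co (\<Sum>i\<in>J. a (co (c i)) *\<^sub>C c i)"
      using finite_subset[OF that I] that in_carrier
    proof (induction J rule: finite_induct)
      case empty
      show ?case by (simp add: zero)
    next
      case (insert i J)
      then show ?case by (subst V.finsum_insert) (auto simp: smult add)
    qed
    finally show ?thesis .
  qed
  have sub_carrier: "(\<lambda>i. co (c i)) ` I \<subseteq> carrier ?Q"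
    using c by (auto simp: carrier)
  have "V.lin_indpt ((\<lambda>i. co (c i)) ` I)"
  proof (rule V.finite_lin_indpt2)
    fix a assume "V.lincomb a ((\<lambda>i. co (c i)) ` I) = \<zero>\<^bsub>?Q\<^esub>"
    then have "\<forall>i\<in>I. a (co (c i)) = 0"
      unfolding lincomb[OF order_refl] zero co_eq by (intro indep) simp
    then show "\<forall>v\<in>(\<lambda>i. co (c i)) ` I. a v = \<zero>\<^bsub>class_ring\<^esub>" by simp
  qed (use I sub_carrier in auto)
  moreover have "V.gen_set ((\<lambda>i. co (c i)) ` I)"
  proof
    show "V.span ((\<lambda>i. co (c i)) ` I) \<subseteq> carrier ?Q"
      using sub_carrier by (rule V.span_is_subset2)
    show "carrier ?Q \<subseteq> V.span ((\<lambda>i. co (c i)) ` I)"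
    proof
      fix X assume "X \<in> carrier ?Q"
      then obtain z where z: "z \<in> Z" "X = co z" unfolding carrier by auto
      obtain f where f: "z - (\<Sum>i\<in>I. f i *\<^sub>C c i) \<in> B" using span[OF z(1)] by blast
      define a where "a v = f (the_inv_into I (\<lambda>i. co (c i)) v)" for v
      have "a (co (c i)) = f i" if "i \<in> I" for i
        using the_inv_into_f_f[OF inj that] by (simp add: a_def)
      then have "X = V.lincomb a ((\<lambda>i. co (c i)) ` I)"
        using f co_eq by (simp add: lincomb z)
      then show "X \<in> V.span ((\<lambda>i. co (c i)) ` I)"
        unfolding V.finite_span[OF finite_imageI[OF I] sub_carrier] by auto
    qed
  qed
  ultimately show ?thesis
    using inj sub_carrier by (simp add: V.basis_def)
qed

lemma subspace_DY_cocycles_uq: "complex_vector.subspace (DY_cocycles uq_comult n)"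
  unfolding DY_cocycles_def DY_diff_eq_cobar
  by (rule complex_vector.subspaceI)
    (auto simp: cobar_linear complex_vector.subspace_0[OF DY_cochains_subspace]
      complex_vector.subspace_add[OF DY_cochains_subspace] complex_vector.subspace_scale[OF DY_cochains_subspace])

lemma subspace_DY_coboundaries_uq: "complex_vector.subspace (DY_coboundaries uq_comult (Suc k))"
proof -
  have "complex_vector.subspace (cobar 1 1 k ` DY_cochains uq_comult k)"
  proof (rule complex_vector.subspaceI)
    show "0 \<in> cobar 1 1 k ` DY_cochains uq_comult k"
      by (rule image_eqI[OF _ complex_vector.subspace_0[OF DY_cochains_subspace]]) (simp add: cobar_linear)
  qed (auto simp flip: cobar_linear intro!: imageI complex_vector.subspace_add[OF DY_cochains_subspace]
      complex_vector.subspace_scale[OF DY_cochains_subspace])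
  then show ?thesis by (simp add: DY_diff_eq_cobar)
qed

lemma dy_combination_transgresses:
  "transgresses (x *\<^sub>C dy_c1 + y *\<^sub>C dy_c2 + z *\<^sub>C dy_c3)
     ((- y * \<i> / 4) *\<^sub>C (uG * uK ^ 2) + (z * \<i> / 4) *\<^sub>C (uE * uK ^ 2))
     ((- x * \<i> / 4) *\<^sub>C (uE * uK ^ 2) + (z * \<i> / 4) *\<^sub>C (uG * uK ^ 2))"
  using transgresses_add[OF transgresses_add[OF transgresses_scale[OF dy_c1_transgresses, of x]
      transgresses_scale[OF dy_c2_transgresses, of y]] transgresses_scale[OF dy_c3_transgresses, of z]]
  by (simp add: scaleC_scaleC)

lemma dy_classes_span:
  assumes "z \<in> DY_cocycles uq_comult 3"
  shows "\<exists>p q r. z - (p *\<^sub>C dy_c1 + q *\<^sub>C dy_c2 + r *\<^sub>C dy_c3) \<in> DY_coboundaries uq_comult 3"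
proof -
  obtain b\<^sub>E b\<^sub>G s\<^sub>E s\<^sub>G s where tr: "transgresses z b\<^sub>E b\<^sub>G"
    and odd: "uK * b\<^sub>E = - (b\<^sub>E * uK)" "uK * b\<^sub>G = - (b\<^sub>G * uK)"
    and anti: "uE * b\<^sub>E + b\<^sub>E * uE = s\<^sub>E *\<^sub>C (1 - uK ^ 2)" "uG * b\<^sub>G + b\<^sub>G * uG = s\<^sub>G *\<^sub>C (1 - uK ^ 2)"
    "uE * b\<^sub>G + b\<^sub>G * uE + (uG * b\<^sub>E + b\<^sub>E * uG) = s *\<^sub>C (1 - uK ^ 2)"
    using assms by (rule cocycle_transgresses)
  obtain a \<beta> \<gamma> \<sigma> \<alpha>\<^sub>E \<beta>\<^sub>E \<alpha>\<^sub>G \<beta>\<^sub>G where a: "uK * a = a * uK" and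
    b: "b\<^sub>E = \<beta> *\<^sub>C (uG * uK ^ 2) + \<sigma> *\<^sub>C (uE * uK ^ 2) + (uE * a - a * uE + \<alpha>\<^sub>E *\<^sub>C uE + \<beta>\<^sub>E *\<^sub>C uG)"
    "b\<^sub>G = \<gamma> *\<^sub>C (uE * uK ^ 2) + \<sigma> *\<^sub>C (uG * uK ^ 2) + (uG * a - a * uG + \<alpha>\<^sub>G *\<^sub>C uE + \<beta>\<^sub>G *\<^sub>C uG)"
    using odd anti by (rule transgression_normal_form)
  \<comment> \<open>The factors invert the scalars \<open>- \<i> / 4\<close>, \<open>- \<i> / 4\<close>, \<open>\<i> / 4\<close> in the transgressions of the three cocycles.\<close>
  define p q r where "p = 4 * \<i> * \<gamma>" and "q = 4 * \<i> * \<beta>" and "r = - 4 * \<i> * \<sigma>"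
  have coeff: "- p * \<i> / 4 = \<gamma>" "- q * \<i> / 4 = \<beta>" "r * \<i> / 4 = \<sigma>"
    by (simp_all add: p_def q_def r_def mult.left_commute[of \<i>] mult.assoc)
  let ?c = "p *\<^sub>C dy_c1 + q *\<^sub>C dy_c2 + r *\<^sub>C dy_c3"
  have "transgresses (z + (- 1) *\<^sub>C ?c) (uE * a - a * uE + \<alpha>\<^sub>E *\<^sub>C uE + \<beta>\<^sub>E *\<^sub>C uG)
      (uG * a - a * uG + \<alpha>\<^sub>G *\<^sub>C uE + \<beta>\<^sub>G *\<^sub>C uG)"
    using transgresses_add[OF tr transgresses_scale[OF dy_combination_transgresses[of p q r], of "-1"]]
    unfolding coeff b by (simp add: add.commute)
  then have "z + (- 1) *\<^sub>C ?c \<in> DY_coboundaries uq_comult 3"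
    using a by (rule coboundary_of_transgresses) simp_all
  moreover have "z + (- 1) *\<^sub>C ?c = z - ?c"
    unfolding complex_vector.scale_minus_left complex_vector.scale_one by (rule diff_conv_add_uminus[symmetric])
  ultimately show ?thesis by metis
qed

text \<open>Trivial pairs have no coordinates at the monomials \<open>G K\<^sup>2\<close> in \<open>b\<^sub>E\<close> and \<open>E K\<^sup>2\<close> in \<open>b\<^sub>G\<close>, and
  those at \<open>E K\<^sup>2\<close> and \<open>G K\<^sup>2\<close> cancel.\<close>

lemma dy_classes_independent:
  assumes "x *\<^sub>C dy_c1 + y *\<^sub>C dy_c2 + z *\<^sub>C dy_c3 \<in> DY_coboundaries uq_comult 3"
  shows "x = 0 \<and> y = 0 \<and> z = 0"
proof -
  obtain a s\<^sub>E \<alpha>\<^sub>E \<beta>\<^sub>E s\<^sub>G \<alpha>\<^sub>G \<beta>\<^sub>G where a: "uK * a = a * uK"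
    and E: "(- y * \<i> / 4) *\<^sub>C (uG * uK ^ 2) + (z * \<i> / 4) *\<^sub>C (uE * uK ^ 2)
      = uE * a - a * uE + (s\<^sub>E *\<^sub>C (1 - uK) + \<alpha>\<^sub>E *\<^sub>C uE + \<beta>\<^sub>E *\<^sub>C uG)"
    and G: "(- x * \<i> / 4) *\<^sub>C (uE * uK ^ 2) + (z * \<i> / 4) *\<^sub>C (uG * uK ^ 2)
      = uG * a - a * uG + (s\<^sub>G *\<^sub>C (1 - uK) + \<alpha>\<^sub>G *\<^sub>C uE + \<beta>\<^sub>G *\<^sub>C uG)"
    using assms dy_combination_transgresses by (rule transgresses_coboundary)
  have low: "coord b c 2 1 = 0" "coord b c 2 uK = 0" "coord b c 2 uE = 0" "coord b c 2 uG = 0" for b c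
    using coord_monomials(1)[of b c 2 0] coord_monomials(1)[of b c 2 1]
      coord_monomials(2)[of b c 2 0] coord_monomials(3)[of b c 2 0] by simp_all
  note comm = commutator_even_coords[OF a]
  have E': "coord b c 2 ((- y * \<i> / 4) *\<^sub>C (uG * uK ^ 2) + (z * \<i> / 4) *\<^sub>C (uE * uK ^ 2))
      = coord b c 2 (uE * a - a * uE)" for b c
    unfolding E by (simp only: coord_linear low) simp
  have G': "coord b c 2 ((- x * \<i> / 4) *\<^sub>C (uE * uK ^ 2) + (z * \<i> / 4) *\<^sub>C (uG * uK ^ 2))
      = coord b c 2 (uG * a - a * uG)" for b c
    unfolding G by (simp only: coord_linear low) simp
  have "y = 0"
    using E'[of False True, unfolded comm(1)] unfolding coord_linear coord_monomials by simp
  moreover have "x = 0"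
    using G'[of True False, unfolded comm(2)] unfolding coord_linear coord_monomials by simp
  moreover have "z = 0"
    using comm(3)[folded E' G'] unfolding coord_linear coord_monomials by simp
  ultimately show ?thesis by simp
qed

theorem proposition6p6:
  shows "{dy_c1, dy_c2, dy_c3} \<subseteq> DY_cocycles uq_comult 3 \<and>
    distinct (map (DY_class uq_comult 3) [dy_c1, dy_c2, dy_c3]) \<and>
    vectorspace.basis class_ring (DY_cohomology uq_comult 3)
      (DY_class uq_comult 3 ` {dy_c1, dy_c2, dy_c3})"
proof -
  define c where "c i = [dy_c1, dy_c2, dy_c3] ! i" for i
  have sum: "(\<Sum>i<3. f i *\<^sub>C c i) = f 0 *\<^sub>C dy_c1 + f 1 *\<^sub>C dy_c2 + f 2 *\<^sub>C dy_c3" for f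
    by (simp add: c_def eval_nat_numeral)
  have image: "h ` c ` {..<3} = {h dy_c1, h dy_c2, h dy_c3}" for h :: "uq tens \<Rightarrow> 'z"
    by (auto simp: c_def eval_nat_numeral lessThan_Suc)
  have cocycles: "{dy_c1, dy_c2, dy_c3} \<subseteq> DY_cocycles uq_comult 3"
    using cocycle_of_transgresses dy_c1_transgresses dy_c2_transgresses dy_c3_transgresses by blast
  have "inj_on (\<lambda>i. (+) (c i) ` DY_coboundaries uq_comult 3) {..<3} \<and>
    vectorspace.basis class_ring (quotient_space (DY_cocycles uq_comult 3) (DY_coboundaries uq_comult 3))
      ((\<lambda>i. (+) (c i) ` DY_coboundaries uq_comult 3) ` {..<3})"
  proof (rule basis_quotient_space)
    show "complex_vector.subspace (DY_coboundaries uq_comult 3)"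
      using subspace_DY_coboundaries_uq[of 2] by simp
    show "vectorspace class_ring (quotient_space (DY_cocycles uq_comult 3) (DY_coboundaries uq_comult 3))"
      using vectorspace_DY_cohomology_uq[of 3] by (simp add: DY_cohomology_def)
    show "c ` {..<3} \<subseteq> DY_cocycles uq_comult 3"
      using cocycles image[of id] by simp
    show "\<exists>f. z - (\<Sum>i<3. f i *\<^sub>C c i) \<in> DY_coboundaries uq_comult 3" if z: "z \<in> DY_cocycles uq_comult 3" for z
    proof -
      obtain p q r where "z - (p *\<^sub>C dy_c1 + q *\<^sub>C dy_c2 + r *\<^sub>C dy_c3) \<in> DY_coboundaries uq_comult 3"
        using dy_classes_span[OF z] by blast
      then show ?thesis by (intro exI[of _ "\<lambda>i. [p, q, r] ! i"]) (simp add: sum)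
    qed
    show "\<forall>i\<in>{..<3}. f i = 0" if "(\<Sum>i<3. f i *\<^sub>C c i) \<in> DY_coboundaries uq_comult 3" for f
      using dy_classes_independent[OF that[unfolded sum]] by (auto simp: eval_nat_numeral lessThan_Suc)
  qed (simp_all add: subspace_DY_cocycles_uq)
  then have inj: "inj_on (\<lambda>i. DY_class uq_comult 3 (c i)) {..<3}"
    and basis: "vectorspace.basis class_ring (DY_cohomology uq_comult 3) (DY_class uq_comult 3 ` c ` {..<3})"
    by (simp_all add: DY_cohomology_def DY_class_def image_image)
  have "distinct (map (DY_class uq_comult 3) [dy_c1, dy_c2, dy_c3])"
    using inj_onD[OF inj, of 0 1] inj_onD[OF inj, of 0 2] inj_onD[OF inj, of 1 2] by (auto simp: c_def)
  with cocycles basis show ?thesis by (simp add: image)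
qed

end
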